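(* For all natural numbers $n$, \[ \mathcal{Q}(n) \geq \left( \left( 1 - o(1) \right) \frac{n}{e^3} \right)^n, \] where $o(1)$ denotes a quantity tending to $0$ as $n\to\infty$. That is, there exists a function $\delta:\mathbb{N}\to\mathbb{R}$ with $\delta(n)\to 0$ as $n\to\infty$ such that $\mathcal{Q}(n) \geq \left( (1-\delta(n))\, n e^{-3} \right)^n$ for all $n\in\mathbb{N}$.
   Context: Write $[n]=\{1,\dots,n\}$ and identify the $n\times n$ chessboard with $[n]^2$. A queen at $(x,y)\in[n]^2$ attacks all squares $(x',y')\in[n]^2$ such that $x'=x$, $y'=y$, $x'+y'=x+y$, or $x'-y'=x-y$ (ordinary, non-toroidal equalities of integers). A partial $n$-queens configuration is a set $Q\subset[n]^2$ such that every row, every column, and every (non-toroidal) diagonal of either type contains at most one element of $Q$. An $n$-queens configuration is a partial $n$-queens configuration of size $n$. $\mathcal{Q}(n)$ denotes the number of $n$-queens configurations. *)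

theory Defs
  imports Complex_Main
begin

definition board :: "nat \<Rightarrow> (int \<times> int) set" where
  "board n = {1..int n} \<times> {1..int n}"

text \<open>Coordinates are integers so that the differences indexing the second family of diagonals are
  not truncated.  Lines not meeting the board satisfy the bounds vacuously.\<close>

definition partial_queens_config :: "nat \<Rightarrow> (int \<times> int) set \<Rightarrow> bool" where
  "partial_queens_config n Q \<longleftrightarrow>
     Q \<subseteq> board n \<and>
     (\<forall>c. card {(x, y) \<in> Q. x = c} \<le> 1) \<and>
     (\<forall>c. card {(x, y) \<in> Q. y = c} \<le> 1) \<and>
     (\<forall>c. card {(x, y) \<in> Q. x + y = c} \<le> 1) \<and>
     (\<forall>c. card {(x, y) \<in> Q. x - y = c} \<le> 1)"

definition queens_config :: "nat \<Rightarrow> (int \<times> int) set \<Rightarrow> bool" where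
  "queens_config n Q \<longleftrightarrow> partial_queens_config n Q \<and> card Q = n"

definition queens_count :: "nat \<Rightarrow> nat" where
  "queens_count n = card {Q. queens_config n Q}"

end

theory Submission
  imports Defs "HOL-Combinatorics.Multiset_Permutations"
begin

text \<open>
  Let a line be a row, a column, or a residue class modulo \<open>n\<close> of diagonals of either kind.  Then
  every line has \<open>n\<close> squares, and the board becomes a 4-partite hypergraph in which two lines of
  different type share at most two squares.  A matching of this hypergraph is a partial
  configuration even on the torus.  If the lines of a random matching with \<open>t\<close> queens behaved
  independently, then \<open>n\<^sup>2 (1 - t / n)\<^sup>4\<close> squares would be available to the next queen, and the
  product of these numbers over all \<open>t\<close>, divided by \<open>n!\<close> for the order of the queens, is
  \<open>(n / e\<^sup>3)\<^sup>n\<close> up to a subexponential factor.  The proof makes this count rigorous for the first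
  \<open>(1 - \<epsilon>) n\<close> queens and then completes the configuration by local changes, for which the ordinary
  board has room since it has about twice as many diagonals as residue classes.

  The random process is a nibble: in each of boundedly many rounds a small multiple of \<open>n\<close> squares
  is sampled from the whole board, and those samples are added that are available and meet no other
  sample of the round.  As the samples are drawn from the whole board, a run is a function of
  independent variables, and one sample influences only boundedly many queens
  (\<open>card_proc_update\<close>).  McDiarmid's inequality (\<open>bounded_differences_tail\<close>) concentrates the number
  of available squares on each line.  The expectation is the same for all lines of one type, because
  translations of the torus are symmetries (\<open>mean_deg_eq\<close>).  So the hypergraph of available squares
  stays nearly regular for free, and no errors accumulate from round to round.  Given regularity, the
  union bound for the squares that a round destroys is sharp to first order, and it yields the
  predicted number of available squares (\<open>avail_lower\<close>).

  Counting is done by comparing the number of all runs with the number of runs that end in a given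
  matching.  A sample is not available, or it collides with another sample, or it is the
  next queen of the matching in some order; weighing these alternatives bounds the number of
  runs (\<open>sum_run_weight_le\<close>), and \<open>many_matchings\<close> follows.

  For the completion, let row \<open>r\<close> and column \<open>c\<close> be uncovered.  A queen \<open>(x, y)\<close> may be replaced
  by \<open>(x, c)\<close> and \<open>(r, y)\<close> if the four diagonals of the new queens are free.  A diagonal is certainly
  free if its residue class is used by a queen on the other diagonal of the class, and
  already the samples of the first rounds provide, for all \<open>r\<close> and \<open>c\<close>, linearly many queens for which
  all four diagonals are free for this reason (\<open>mean_absorbers_ge\<close>).  Each switch spoils at most nine
  of them for any \<open>r\<close> and \<open>c\<close>, so \<open>\<epsilon> n\<close> switches can be made if \<open>\<epsilon>\<close> is small, and double counting of
  the switches (\<open>card_switchable_le_queens_count\<close>) recovers the factor that the missing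
  queens contribute.
\<close>

section \<open>Concentration of functions of independent samples\<close>

definition words :: "'a set \<Rightarrow> nat \<Rightarrow> 'a list set" where
  "words A t = {xs. set xs \<subseteq> A \<and> length xs = t}"

lemma finite_words [simp]: "finite A \<Longrightarrow> finite (words A t)"
  by (simp add: words_def finite_lists_length_eq)

lemma card_words: "finite A \<Longrightarrow> card (words A t) = card A ^ t"
  by (simp add: words_def card_lists_length_eq)

lemma sum_words_0 [simp]: "(\<Sum>w\<in>words A 0. f w) = f []"
proof -
  have "words A 0 = {[]}" by (auto simp: words_def)
  then show ?thesis by simp
qed

lemma sum_words_append:
  assumes "finite A"
  shows "(\<Sum>w\<in>words A (m + t). f w) = (\<Sum>u\<in>words A m. \<Sum>v\<in>words A t. f (u @ v))"
proof -
  have "(\<Sum>u\<in>words A m. \<Sum>v\<in>words A t. f (u @ v)) = (\<Sum>(u, v)\<in>words A m \<times> words A t. f (u @ v))"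
    using assms by (simp add: sum.cartesian_product)
  also have "\<dots> = (\<Sum>w\<in>words A (m + t). f w)"
    by (rule sum.reindex_bij_witness[where i = "\<lambda>w. (take m w, drop m w)" and j = "\<lambda>(u, v). u @ v"])
       (auto simp: words_def dest: in_set_takeD in_set_dropD)
  finally show ?thesis by simp
qed

lemma sum_words_1: "(\<Sum>w\<in>words A (Suc 0). f w) = (\<Sum>x\<in>A. f [x])"
  by (rule sum.reindex_bij_witness[where i = "\<lambda>x. [x]" and j = hd])
     (auto simp: words_def length_Suc_conv)

lemma sum_words_Suc:
  assumes "finite A"
  shows "(\<Sum>w\<in>words A (Suc t). f w) = (\<Sum>x\<in>A. \<Sum>v\<in>words A t. f (x # v))"
  using sum_words_append[OF assms, of f 1 t] by (simp add: sum_words_1)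

definition mean :: "'a set \<Rightarrow> ('a \<Rightarrow> real) \<Rightarrow> real" where
  "mean X f = (\<Sum>x\<in>X. f x) / card X"

lemma exp_le_id_plus_exp_square: "exp y \<le> y + exp (y\<^sup>2)" for y :: real
proof -
  have q: "1 + y\<^sup>2 \<le> exp (y\<^sup>2)" by (rule exp_ge_add_one_self)
  consider "y \<ge> 1" | "0 \<le> y" "y < 1" | "y < 0" by linarith
  then show ?thesis
  proof cases
    case 1
    then have "y \<le> y\<^sup>2" by (simp add: power2_eq_square)
    then have "exp y \<le> exp (y\<^sup>2)" by simp
    then show ?thesis using 1 by linarith
  next
    case 2
    then have "exp y \<le> 1 + y + y\<^sup>2" by (intro exp_bound) auto
    then show ?thesis using q by linarith
  next
    case 3
    define u where "u = - y"
    have u: "u > 0" using 3 by (simp add: u_def)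
    have "1 + u + u\<^sup>2 / 2 \<le> exp u" using u by (intro exp_lower_Taylor_quadratic) simp
    moreover have "(1 - u + u\<^sup>2) * (1 + u + u\<^sup>2 / 2) = 1 + u\<^sup>2 / 2 + u ^ 3 / 2 + u ^ 4 / 2"
      by (simp add: field_simps power2_eq_square power3_eq_cube power4_eq_xxxx)
    moreover have "1 - u + u\<^sup>2 \<ge> 0"
    proof -
      have "1 - u + u\<^sup>2 = (u - 1/2)\<^sup>2 + 3/4" by (simp add: power2_eq_square field_simps)
      then show ?thesis by simp
    qed
    moreover have "u\<^sup>2 \<ge> 0" "u ^ 3 \<ge> 0" "u ^ 4 \<ge> 0" using u by simp_all
    ultimately have "1 \<le> (1 - u + u\<^sup>2) * exp u"
      using mult_left_mono[of "1 + u + u\<^sup>2 / 2" "exp u" "1 - u + u\<^sup>2"] by linarith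
    then have "exp (- u) \<le> 1 - u + u\<^sup>2" by (simp add: exp_minus field_simps)
    then show ?thesis using q unfolding u_def power2_minus minus_minus by linarith
  qed
qed

lemma sum_minus_mean:
  assumes "finite X" "X \<noteq> {}"
  shows "(\<Sum>x\<in>X. f x - mean X f) = 0"
  using assms by (simp add: mean_def sum_subtractf)

text \<open>The linear term of \<open>exp_le_id_plus_exp_square\<close> averages to zero.\<close>

lemma exp_moment_bounded_range:
  assumes X: "finite X" "X \<noteq> {}" and c: "\<And>x y. x \<in> X \<Longrightarrow> y \<in> X \<Longrightarrow> \<bar>f x - f y\<bar> \<le> c"
  shows "(\<Sum>x\<in>X. exp (l * (f x - mean X f))) \<le> card X * exp (l\<^sup>2 * c\<^sup>2)"
proof -
  have bd: "\<bar>f x - mean X f\<bar> \<le> c" if x: "x \<in> X" for x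
  proof -
    have cX: "real (card X) > 0" using X by (simp add: card_gt_0_iff)
    have "card X * (f x - mean X f) = (\<Sum>y\<in>X. f x - f y)"
      using cX by (simp add: mean_def sum_subtractf field_simps)
    then have "\<bar>card X * (f x - mean X f)\<bar> \<le> (\<Sum>y\<in>X. \<bar>f x - f y\<bar>)"
      by (metis sum_abs)
    also have "\<dots> \<le> (\<Sum>y\<in>X. c)" using c x by (intro sum_mono) auto
    finally show ?thesis using cX by (simp add: abs_mult)
  qed
  have "(\<Sum>x\<in>X. exp (l * (f x - mean X f))) \<le> (\<Sum>x\<in>X. l * (f x - mean X f) + exp (l\<^sup>2 * c\<^sup>2))"
  proof (rule sum_mono)
    fix x assume x: "x \<in> X"
    have "(l * (f x - mean X f))\<^sup>2 \<le> l\<^sup>2 * c\<^sup>2"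
      using power_mono[OF bd[OF x], of 2] by (simp add: power_mult_distrib mult_left_mono)
    then show "exp (l * (f x - mean X f)) \<le> l * (f x - mean X f) + exp (l\<^sup>2 * c\<^sup>2)"
      using exp_le_id_plus_exp_square[of "l * (f x - mean X f)"] by (smt (verit) exp_le_cancel_iff)
  qed
  also have "\<dots> = card X * exp (l\<^sup>2 * c\<^sup>2)"
    using sum_minus_mean[OF X, of f] by (simp add: sum.distrib flip: sum_distrib_left)
  finally show ?thesis .
qed

text \<open>McDiarmid's inequality in moment form: the coordinates are integrated out one at a time, and
  averaging over one coordinate preserves the bounded differences in all others.\<close>

lemma exp_moment_bounded_differences:
  assumes A: "finite A" "A \<noteq> {}"
    and c: "\<And>w p x. w \<in> words A t \<Longrightarrow> p < t \<Longrightarrow> x \<in> A \<Longrightarrow> \<bar>f (w[p := x]) - f w\<bar> \<le> c"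
  shows "(\<Sum>w\<in>words A t. exp (l * (f w - mean (words A t) f))) \<le> (card A * exp (l\<^sup>2 * c\<^sup>2)) ^ t"
  using c
proof (induction t arbitrary: f)
  case 0
  then show ?case by (simp add: mean_def card_words[OF A(1)])
next
  case (Suc t)
  define h where "h v = mean A (\<lambda>x. f (x # v))" for v
  have cA: "real (card A) > 0" using A by (simp add: card_gt_0_iff)
  have meq: "mean (words A (Suc t)) f = mean (words A t) h"
    using cA by (simp add: mean_def h_def sum_words_Suc[OF A(1)] card_words[OF A(1)]
        flip: sum_divide_distrib) (subst sum.swap, simp add: mult.commute)
  have inner: "(\<Sum>x\<in>A. exp (l * (f (x # v) - h v))) \<le> card A * exp (l\<^sup>2 * c\<^sup>2)"
    if v: "v \<in> words A t" for v
    unfolding h_def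
  proof (rule exp_moment_bounded_range[OF A])
    fix x y assume "x \<in> A" "y \<in> A"
    then show "\<bar>f (x # v) - f (y # v)\<bar> \<le> c"
      using Suc.prems[of "y # v" 0 x] v by (auto simp: words_def)
  qed
  have hd: "\<bar>h (v[p := x]) - h v\<bar> \<le> c" if v: "v \<in> words A t" and p: "p < t" and x: "x \<in> A" for v p x
  proof -
    have "card A * (h (v[p := x]) - h v) = (\<Sum>y\<in>A. f (y # v[p := x]) - f (y # v))"
      using cA by (simp add: h_def mean_def sum_subtractf field_simps)
    then have "\<bar>card A * (h (v[p := x]) - h v)\<bar> \<le> (\<Sum>y\<in>A. \<bar>f (y # v[p := x]) - f (y # v)\<bar>)"
      by (metis sum_abs)
    also have "\<dots> \<le> (\<Sum>y\<in>A. c)"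
    proof (rule sum_mono)
      fix y assume "y \<in> A"
      then show "\<bar>f (y # v[p := x]) - f (y # v)\<bar> \<le> c"
        using Suc.prems[of "y # v" "Suc p" x] v p x by (auto simp: words_def)
    qed
    finally show ?thesis using cA by (simp add: abs_mult)
  qed
  have "(\<Sum>w\<in>words A (Suc t). exp (l * (f w - mean (words A (Suc t)) f)))
      = (\<Sum>v\<in>words A t. exp (l * (h v - mean (words A t) h)) * (\<Sum>x\<in>A. exp (l * (f (x # v) - h v))))"
    unfolding sum_words_Suc[OF A(1)] meq
    by (subst sum.swap) (simp add: sum_distrib_left algebra_simps flip: exp_add)
  also have "\<dots> \<le> (\<Sum>v\<in>words A t. exp (l * (h v - mean (words A t) h)) * (card A * exp (l\<^sup>2 * c\<^sup>2)))"
    by (intro sum_mono mult_left_mono inner) auto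
  also have "\<dots> \<le> (card A * exp (l\<^sup>2 * c\<^sup>2)) ^ t * (card A * exp (l\<^sup>2 * c\<^sup>2))"
    unfolding sum_distrib_right[symmetric] by (intro mult_right_mono Suc.IH hd) auto
  finally show ?case by (simp add: mult.commute)
qed

lemma bounded_differences_upper_tail:
  assumes A: "finite A" "A \<noteq> {}"
    and c: "\<And>w p x. w \<in> words A t \<Longrightarrow> p < t \<Longrightarrow> x \<in> A \<Longrightarrow> \<bar>f (w[p := x]) - f w\<bar> \<le> c"
    and pos: "c > 0" "t > 0" "a \<ge> 0"
  shows "card {w \<in> words A t. f w - mean (words A t) f \<ge> a}
         \<le> card (words A t) * exp (- (a\<^sup>2 / (4 * real t * c\<^sup>2)))"
proof -
  define l where "l = a / (2 * real t * c\<^sup>2)"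
  let ?B = "{w \<in> words A t. f w - mean (words A t) f \<ge> a}"
  have l0: "l \<ge> 0" using pos by (simp add: l_def)
  have "card ?B * exp (l * a) = (\<Sum>w\<in>?B. exp (l * a))" by simp
  also have "\<dots> \<le> (\<Sum>w\<in>?B. exp (l * (f w - mean (words A t) f)))"
    using l0 by (intro sum_mono) (auto intro: mult_left_mono)
  also have "\<dots> \<le> (\<Sum>w\<in>words A t. exp (l * (f w - mean (words A t) f)))"
    using A by (intro sum_mono2) auto
  also have "\<dots> \<le> (card A * exp (l\<^sup>2 * c\<^sup>2)) ^ t"
    by (rule exp_moment_bounded_differences[OF A c])
  also have "\<dots> = card (words A t) * exp (t * (l\<^sup>2 * c\<^sup>2))"
    by (simp add: power_mult_distrib card_words[OF A(1)] exp_of_nat_mult)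
  finally have "card ?B \<le> card (words A t) * (exp (t * (l\<^sup>2 * c\<^sup>2)) * exp (- (l * a)))"
    by (simp add: exp_minus field_simps)
  also have "exp (t * (l\<^sup>2 * c\<^sup>2)) * exp (- (l * a)) = exp (- (a\<^sup>2 / (4 * real t * c\<^sup>2)))"
  proof -
    have "t * (l\<^sup>2 * c\<^sup>2) = a\<^sup>2 / (4 * real t * c\<^sup>2)"
      using pos by (simp add: l_def power2_eq_square)
    moreover have "l * a = 2 * (a\<^sup>2 / (4 * real t * c\<^sup>2))"
      by (simp add: l_def power2_eq_square)
    ultimately show ?thesis by (simp flip: exp_add)
  qed
  finally show ?thesis .
qed

lemma mean_uminus: "mean X (\<lambda>x. - f x) = - mean X f"
  by (simp add: mean_def sum_negf)

text \<open>McDiarmid's inequality for uniformly distributed words, with a constant that is not optimal.\<close>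

theorem bounded_differences_tail:
  assumes A: "finite A" "A \<noteq> {}"
    and c: "\<And>w p x. w \<in> words A t \<Longrightarrow> p < t \<Longrightarrow> x \<in> A \<Longrightarrow> \<bar>f (w[p := x]) - f w\<bar> \<le> c"
    and pos: "c > 0" "t > 0" "a \<ge> 0"
  shows "card {w \<in> words A t. \<bar>f w - mean (words A t) f\<bar> \<ge> a}
         \<le> 2 * card (words A t) * exp (- (a\<^sup>2 / (4 * real t * c\<^sup>2)))"
proof -
  let ?m = "mean (words A t) f"
  have "{w \<in> words A t. \<bar>f w - ?m\<bar> \<ge> a}
      \<subseteq> {w \<in> words A t. f w - ?m \<ge> a} \<union> {w \<in> words A t. - f w - mean (words A t) (\<lambda>w. - f w) \<ge> a}"
    by (auto simp: mean_uminus)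
  then have "card {w \<in> words A t. \<bar>f w - ?m\<bar> \<ge> a}
      \<le> card {w \<in> words A t. f w - ?m \<ge> a} + card {w \<in> words A t. - f w - mean (words A t) (\<lambda>w. - f w) \<ge> a}"
    using A by (intro order_trans[OF card_mono card_Un_le]) auto
  then have "real (card {w \<in> words A t. \<bar>f w - ?m\<bar> \<ge> a})
      \<le> card {w \<in> words A t. f w - ?m \<ge> a} + card {w \<in> words A t. - f w - mean (words A t) (\<lambda>w. - f w) \<ge> a}"
    by linarith
  also have "\<dots> \<le> card (words A t) * exp (- (a\<^sup>2 / (4 * real t * c\<^sup>2)))
      + card (words A t) * exp (- (a\<^sup>2 / (4 * real t * c\<^sup>2)))"
    unfolding of_nat_add
  proof (rule add_mono)
    show "card {w \<in> words A t. f w - ?m \<ge> a} \<le> card (words A t) * exp (- (a\<^sup>2 / (4 * real t * c\<^sup>2)))"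
      by (rule bounded_differences_upper_tail[OF A c pos])
    have "\<bar>- f (w[p := x]) - - f w\<bar> \<le> c" if "w \<in> words A t" "p < t" "x \<in> A" for w p x
      using c[OF that] by linarith
    then show "card {w \<in> words A t. - f w - mean (words A t) (\<lambda>w. - f w) \<ge> a}
        \<le> card (words A t) * exp (- (a\<^sup>2 / (4 * real t * c\<^sup>2)))"
      by (rule bounded_differences_upper_tail[OF A _ pos])
  qed
  finally show ?thesis by simp
qed

section \<open>Line systems and the nibble\<close>

text \<open>The properties of the torus on which the nibble depends: four types of lines, regularity, small
  codegrees, and a symmetry group that is transitive on the lines of each type.\<close>

locale line_system =
  fixes A :: "'e set" and ln :: "nat \<Rightarrow> 'e \<Rightarrow> int" and n :: nat
  assumes n_pos: "n > 0"
    and finite_A [simp]: "finite A"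
    and ln_range: "e \<in> A \<Longrightarrow> k < 4 \<Longrightarrow> ln k e \<in> {0..<int n}"
    and card_line: "k < 4 \<Longrightarrow> i \<in> {0..<int n} \<Longrightarrow> card {e \<in> A. ln k e = i} = n"
    and card_two_lines:
      "k < 4 \<Longrightarrow> l < 4 \<Longrightarrow> k \<noteq> l \<Longrightarrow> card {e \<in> A. ln k e = i \<and> ln l e = i'} \<le> 2"
    and line_symmetry: "k < 4 \<Longrightarrow> i \<in> {0..<int n} \<Longrightarrow> i' \<in> {0..<int n} \<Longrightarrow>
      \<exists>\<tau>. bij_betw \<tau> A A \<and>
          (\<forall>e\<in>A. \<forall>f\<in>A. \<forall>l<4. ln l (\<tau> e) = ln l (\<tau> f) \<longleftrightarrow> ln l e = ln l f) \<and>
          (\<forall>e\<in>A. ln k (\<tau> e) = i' \<longleftrightarrow> ln k e = i)"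
begin

definition meets :: "'e \<Rightarrow> 'e \<Rightarrow> bool" where
  "meets e f \<longleftrightarrow> (\<exists>k<4. ln k e = ln k f)"

definition matching :: "'e set \<Rightarrow> bool" where
  "matching M \<longleftrightarrow> M \<subseteq> A \<and> (\<forall>e\<in>M. \<forall>f\<in>M. e \<noteq> f \<longrightarrow> \<not> meets e f)"

definition avail :: "'e set \<Rightarrow> 'e set" where
  "avail Q = {e \<in> A. \<forall>q\<in>Q. \<not> meets q e}"

text \<open>All other samples count here, including those that are unavailable.  With this rule the
  isolated samples do not depend on earlier rounds, which keeps the influence of a sample bounded.\<close>

definition isolated :: "'e list \<Rightarrow> 'e set" where
  "isolated r = {r ! i | i. i < length r \<and> (\<forall>j<length r. j \<noteq> i \<longrightarrow> \<not> meets (r ! i) (r ! j))}"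

definition step :: "'e set \<Rightarrow> 'e list \<Rightarrow> 'e set" where
  "step Q r = Q \<union> (isolated r \<inter> avail Q)"

definition chunk :: "nat \<Rightarrow> nat \<Rightarrow> 'e list \<Rightarrow> 'e list" where
  "chunk s j w = take s (drop (j * s) w)"

primrec proc :: "nat \<Rightarrow> nat \<Rightarrow> 'e list \<Rightarrow> 'e set" where
  "proc s 0 w = {}"
| "proc s (Suc j) w = step (proc s j w) (chunk s j w)"

text \<open>The number of available elements on the line \<open>i\<close> of type \<open>k\<close> if the line itself is uncovered.  The
  condition on the line is left out so that the quantity makes sense for every line and depends
  smoothly on \<open>Q\<close>.\<close>

definition deg :: "nat \<Rightarrow> int \<Rightarrow> 'e set \<Rightarrow> nat" where
  "deg k i Q = card {e \<in> A. ln k e = i \<and> (\<forall>l<4. l \<noteq> k \<longrightarrow> (\<forall>q\<in>Q. ln l q \<noteq> ln l e))}"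

lemma meets_sym: "meets e f \<longleftrightarrow> meets f e"
  by (auto simp: meets_def)

lemma meets_refl [simp]: "meets e e"
  unfolding meets_def by (intro exI[of _ 0]) simp

lemma card_A: "card A = n\<^sup>2"
proof -
  have "A = (\<Union>i\<in>{0..<int n}. {e \<in> A. ln 0 e = i})"
    using ln_range by fastforce
  moreover have "card (\<Union>i\<in>{0..<int n}. {e \<in> A. ln 0 e = i})
      = (\<Sum>i\<in>{0..<int n}. card {e \<in> A. ln 0 e = i})"
    by (rule card_UN_disjoint) auto
  ultimately have "card A = (\<Sum>i\<in>{0..<int n}. card {e \<in> A. ln 0 e = i})" by simp
  also have "\<dots> = (\<Sum>i\<in>{0..<int n}. n)"
    by (intro sum.cong refl card_line) auto
  finally show ?thesis by (simp add: power2_eq_square)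
qed

lemma A_nonempty: "A \<noteq> {}"
  using card_A n_pos by auto

lemma card_words_A: "card (words A t) = n ^ (2 * t)"
  by (simp add: card_words card_A power_mult)

lemma card_words_A_pos: "card (words A t) > 0"
  using n_pos by (simp add: card_words_A)

lemma matching_finite: "matching M \<Longrightarrow> finite M"
  unfolding matching_def using finite_A finite_subset by blast

lemma matching_subset: "matching M \<Longrightarrow> N \<subseteq> M \<Longrightarrow> matching N"
  unfolding matching_def by blast

lemma matching_line_unique:
  "matching M \<Longrightarrow> e \<in> M \<Longrightarrow> f \<in> M \<Longrightarrow> k < 4 \<Longrightarrow> ln k e = ln k f \<Longrightarrow> e = f"
  unfolding matching_def meets_def by blast

lemma card_matching_line: "matching M \<Longrightarrow> k < 4 \<Longrightarrow> card {e \<in> M. ln k e = i} \<le> 1"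
  using matching_finite[of M] matching_line_unique[of M]
  by (simp add: card_le_Suc0_iff_eq)

lemma card_matching_meets:
  assumes "matching M"
  shows "card {e \<in> M. meets e x} \<le> 4"
proof -
  have "{e \<in> M. meets e x} = (\<Union>k<4. {e \<in> M. ln k e = ln k x})"
    by (auto simp: meets_def)
  then have "card {e \<in> M. meets e x} \<le> (\<Sum>k<4. card {e \<in> M. ln k e = ln k x})"
    by (simp add: card_UN_le)
  also have "\<dots> \<le> (\<Sum>k<(4::nat). 1)"
    using card_matching_line[OF assms] by (intro sum_mono) auto
  finally show ?thesis by simp
qed

lemma isolated_subset: "isolated r \<subseteq> set r"
  by (auto simp: isolated_def)

lemma matching_isolated: "set r \<subseteq> A \<Longrightarrow> matching (isolated r)"
  unfolding matching_def
proof (intro conjI ballI impI)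
  assume "set r \<subseteq> A"
  then show "isolated r \<subseteq> A" using isolated_subset by blast
next
  fix e f assume "e \<in> isolated r" "f \<in> isolated r" "e \<noteq> f"
  then show "\<not> meets e f" unfolding isolated_def by blast
qed

lemma matching_step:
  assumes "matching Q" "set r \<subseteq> A"
  shows "matching (step Q r)"
  unfolding matching_def
proof (intro conjI ballI impI)
  note Q = assms(1)[unfolded matching_def] and I = matching_isolated[OF assms(2), unfolded matching_def]
  show "step Q r \<subseteq> A" using Q by (auto simp: step_def avail_def)
  fix e f assume e: "e \<in> step Q r" and f: "f \<in> step Q r" and ne: "e \<noteq> f"
  consider "e \<in> Q" "f \<in> Q" | "e \<in> Q" "f \<in> avail Q" | "e \<in> avail Q" "f \<in> Q"
    | "e \<in> isolated r" "f \<in> isolated r"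
    using e f unfolding step_def by blast
  then show "\<not> meets e f"
  proof cases
    case 1 then show ?thesis using Q ne by simp
  next
    case 2 then show ?thesis by (simp add: avail_def)
  next
    case 3 then show ?thesis by (simp add: avail_def meets_sym[of e f])
  next
    case 4 then show ?thesis using I ne by simp
  qed
qed

lemma set_chunk: "set (chunk s j w) \<subseteq> set w"
  unfolding chunk_def by (meson order_trans set_take_subset set_drop_subset)

lemma matching_proc: "set w \<subseteq> A \<Longrightarrow> matching (proc s j w)"
proof (induction j)
  case 0
  then show ?case by (simp add: matching_def)
next
  case (Suc j)
  then show ?case using set_chunk[of s j w] by (simp add: matching_step)
qed

text \<open>An element isolated only before the update was either the overwritten one or meets the new one;
  the latter elements are disjoint from each other, so each of the four lines of \<open>x\<close> lies on at
  most one of them.\<close>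

lemma card_isolated_update:
  assumes "set r \<subseteq> A"
  shows "card (isolated r - isolated (r[p := x])) \<le> 5"
proof -
  have "isolated r - isolated (r[p := x]) \<subseteq> insert (r ! p) {e \<in> isolated r. meets e x}"
  proof
    fix e assume e: "e \<in> isolated r - isolated (r[p := x])"
    then obtain i where i: "i < length r" "e = r ! i"
      "\<forall>j<length r. j \<noteq> i \<longrightarrow> \<not> meets (r ! i) (r ! j)"
      by (auto simp: isolated_def)
    show "e \<in> insert (r ! p) {e \<in> isolated r. meets e x}"
    proof (cases "i = p")
      case False
      then have "r[p := x] ! i = e" using i by simp
      have "\<exists>j<length r. j \<noteq> i \<and> meets e (r[p := x] ! j)"
      proof (rule ccontr)
        assume "\<not> ?thesis"
        then have "i < length (r[p := x]) \<and>
            (\<forall>j<length (r[p := x]). j \<noteq> i \<longrightarrow> \<not> meets (r[p := x] ! i) (r[p := x] ! j))"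
          using \<open>r[p := x] ! i = e\<close> i(1) by auto
        then have "e \<in> isolated (r[p := x])"
          unfolding isolated_def using \<open>r[p := x] ! i = e\<close>[symmetric] by blast
        then show False using e by simp
      qed
      then obtain j where j: "j < length r" "j \<noteq> i" "meets e (r[p := x] ! j)" by blast
      then have "j = p" using i by (metis nth_list_update_neq)
      then show ?thesis using j e by auto
    qed (use i in auto)
  qed
  then have "card (isolated r - isolated (r[p := x])) \<le> card (insert (r ! p) {e \<in> isolated r. meets e x})"
    using matching_finite[OF matching_isolated[OF assms]] by (intro card_mono) auto
  also have "\<dots> \<le> Suc (card {e \<in> isolated r. meets e x})"
    by (rule card_insert_le_m1) auto
  also have "\<dots> \<le> 5" using card_matching_meets[OF matching_isolated[OF assms], of x] by simp
  finally show ?thesis .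
qed

lemma card_isolated_update':
  assumes "set r \<subseteq> A" "x \<in> A"
  shows "card (isolated (r[p := x]) - isolated r) \<le> 5"
  using card_isolated_update[of "r[p := x]" p "r ! p"] assms set_update_subset_insert[of r p x] by auto

lemma chunk_update:
  "chunk s j (w[p := x]) = chunk s j w \<or> chunk s j (w[p := x]) = (chunk s j w)[p - j * s := x]"
proof (cases "p < j * s")
  case True
  then show ?thesis by (simp add: chunk_def drop_update_cancel)
next
  case False
  then show ?thesis by (simp add: chunk_def drop_update_swap take_update_swap)
qed

lemma card_isolated_chunk_update:
  assumes "set w \<subseteq> A" "x \<in> A"
  shows "card (isolated (chunk s j w) - isolated (chunk s j (w[p := x]))) \<le> 5"
    and "card (isolated (chunk s j (w[p := x])) - isolated (chunk s j w)) \<le> 5"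
proof -
  have c: "set (chunk s j w) \<subseteq> A" using set_chunk assms by blast
  show "card (isolated (chunk s j w) - isolated (chunk s j (w[p := x]))) \<le> 5"
    using chunk_update[of s j w p x] card_isolated_update[OF c] by auto
  show "card (isolated (chunk s j (w[p := x])) - isolated (chunk s j w)) \<le> 5"
    using chunk_update[of s j w p x] card_isolated_update'[OF c assms(2)] by auto
qed

text \<open>Isolated samples are disjoint, so a queen that is present in only one of the two runs blocks at most
  four of them, one for each of its lines.\<close>

lemma card_step_diff:
  assumes "matching Q" "matching Q'" "set r \<subseteq> A"
    and r: "card (isolated r - isolated r') \<le> 5"
    and Q: "card (Q - Q') \<le> d" "card (Q' - Q) \<le> d"
  shows "card (step Q r - step Q' r') \<le> 5 * d + 5"
proof -
  let ?X = "\<Union>q\<in>Q' - Q. {e \<in> isolated r. meets e q}"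
  have fin: "finite Q" "finite Q'" "finite (isolated r)"
    using assms matching_finite matching_isolated by auto
  have "step Q r - step Q' r' \<subseteq> (Q - Q') \<union> (isolated r - isolated r') \<union> ?X"
  proof
    fix e assume e: "e \<in> step Q r - step Q' r'"
    show "e \<in> (Q - Q') \<union> (isolated r - isolated r') \<union> ?X"
    proof (cases "e \<in> Q \<or> e \<notin> isolated r \<or> e \<notin> isolated r'")
      case True
      moreover have "e \<in> Q \<or> e \<in> isolated r" "e \<notin> Q'" using e by (auto simp: step_def)
      ultimately have "e \<in> Q - Q' \<or> e \<in> isolated r - isolated r'" by auto
      then show ?thesis by (elim disjE) (simp_all only: Un_iff simp_thms)
    next
      case False
      then have "e \<in> avail Q" "e \<notin> avail Q'" using e unfolding step_def by auto
      then obtain q where "q \<in> Q' - Q" "meets q e" unfolding avail_def by auto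
      then show ?thesis using False meets_sym[of q e] by auto
    qed
  qed
  then have "card (step Q r - step Q' r') \<le> card ((Q - Q') \<union> (isolated r - isolated r') \<union> ?X)"
    using fin by (intro card_mono) auto
  also have "\<dots> \<le> card (Q - Q') + card (isolated r - isolated r') + card ?X"
    by (meson add_le_mono1 card_Un_le le_trans)
  also have "card ?X \<le> (\<Sum>q\<in>Q' - Q. card {e \<in> isolated r. meets e q})"
    using fin by (intro card_UN_le) auto
  also have "\<dots> \<le> (\<Sum>q\<in>Q' - Q. 4)"
    using assms(3) by (intro sum_mono card_matching_meets matching_isolated) auto
  finally show ?thesis using r Q by simp
qed

lemma card_proc_update:
  assumes "set w \<subseteq> A" "x \<in> A"
  shows "card (proc s j w - proc s j (w[p := x])) \<le> 2 * 5 ^ j - 2 \<and>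
         card (proc s j (w[p := x]) - proc s j w) \<le> 2 * 5 ^ j - 2"
proof (induction j)
  case (Suc j)
  have w': "set (w[p := x]) \<subseteq> A" using assms set_update_subset_insert[of w p x] by auto
  have c: "set (chunk s j w) \<subseteq> A" "set (chunk s j (w[p := x])) \<subseteq> A"
    using set_chunk assms w' by blast+
  note m = matching_proc[OF assms(1), of s j] matching_proc[OF w', of s j]
  have "5 * (2 * 5 ^ j - 2) + 5 \<le> 2 * 5 ^ Suc j - (2::nat)"
  proof -
    have "5 * (2 * q - 2) + 5 \<le> 2 * (5 * q) - 2" if "q \<ge> 1" for q :: nat
      using that by linarith
    then show ?thesis by simp
  qed
  then show ?case
    using card_step_diff[OF m c(1) card_isolated_chunk_update(1)[OF assms]]
      card_step_diff[OF m(2,1) c(2) card_isolated_chunk_update(2)[OF assms]] Suc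
    unfolding proc.simps by (meson le_trans)
qed simp

text \<open>A queen has three lines of other types, and each of them shares at most two elements with the given
  line.\<close>

lemma deg_le_deg_plus:
  assumes "finite Q'" "k < 4"
  shows "deg k i Q \<le> deg k i Q' + 6 * card (Q' - Q)"
proof -
  let ?S = "\<lambda>Q. {e \<in> A. ln k e = i \<and> (\<forall>l<4. l \<noteq> k \<longrightarrow> (\<forall>q\<in>Q. ln l q \<noteq> ln l e))}"
  let ?X = "\<Union>(q, l)\<in>(Q' - Q) \<times> ({..<4} - {k}). {e \<in> A. ln k e = i \<and> ln l e = ln l q}"
  have "?S Q \<subseteq> ?S Q' \<union> ?X"
  proof
    fix e assume e: "e \<in> ?S Q"
    show "e \<in> ?S Q' \<union> ?X"
    proof (cases "e \<in> ?S Q'")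
      case False
      have eA: "e \<in> A" "ln k e = i" and free: "\<And>l q. l < 4 \<Longrightarrow> l \<noteq> k \<Longrightarrow> q \<in> Q \<Longrightarrow> ln l q \<noteq> ln l e"
        using e by auto
      from False eA obtain l q where lq: "l < 4" "l \<noteq> k" "q \<in> Q'" "ln l q = ln l e" by auto
      then have "(q, l) \<in> (Q' - Q) \<times> ({..<4} - {k})" using free by auto
      then show ?thesis using eA lq(4) by (intro UnI2 UN_I[of "(q, l)"]) auto
    qed blast
  qed
  then have "card (?S Q) \<le> card (?S Q' \<union> ?X)"
    using assms by (intro card_mono) auto
  also have "\<dots> \<le> card (?S Q') + card ?X" by (rule card_Un_le)
  also have "card ?X \<le> (\<Sum>(q, l)\<in>(Q' - Q) \<times> ({..<4} - {k}). card {e \<in> A. ln k e = i \<and> ln l e = ln l q})"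
    using assms by (intro order_trans[OF card_UN_le]) (auto simp: case_prod_unfold)
  also have "\<dots> \<le> (\<Sum>(q, l)\<in>(Q' - Q) \<times> ({..<4} - {k}). 2)"
    using assms by (intro sum_mono) (auto intro: card_two_lines)
  also have "\<dots> = 6 * card (Q' - Q)" using assms by (simp add: card_cartesian_product)
  finally show ?thesis by (simp add: deg_def)
qed

lemma deg_proc_update:
  assumes "set w \<subseteq> A" "x \<in> A" "k < 4"
  shows "\<bar>real (deg k i (proc s j (w[p := x]))) - deg k i (proc s j w)\<bar> \<le> 12 * 5 ^ j"
proof -
  have w': "set (w[p := x]) \<subseteq> A" using assms set_update_subset_insert[of w p x] by auto
  note f = matching_finite[OF matching_proc[OF assms(1), of s j]] matching_finite[OF matching_proc[OF w', of s j]]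
  have "deg k i (proc s j (w[p := x])) \<le> deg k i (proc s j w) + 12 * 5 ^ j"
    "deg k i (proc s j w) \<le> deg k i (proc s j (w[p := x])) + 12 * 5 ^ j"
    using deg_le_deg_plus[OF f(1) assms(3), of i "proc s j (w[p := x])"]
      deg_le_deg_plus[OF f(2) assms(3), of i "proc s j w"] card_proc_update[OF assms(1,2), of s j p]
    by linarith+
  then have "real (deg k i (proc s j (w[p := x]))) \<le> real (deg k i (proc s j w) + 12 * 5 ^ j)"
    "real (deg k i (proc s j w)) \<le> real (deg k i (proc s j (w[p := x])) + 12 * 5 ^ j)"
    unfolding of_nat_le_iff by simp_all
  then show ?thesis unfolding of_nat_add of_nat_mult of_nat_power of_nat_numeral by linarith
qed

lemma card_le_card_plus_diff: "finite Y \<Longrightarrow> finite X \<Longrightarrow> card X \<le> card Y + card (X - Y)"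
  by (metis Diff_cancel Un_Diff_cancel card_Un_le card_mono finite_Un le_trans sup_ge2)

lemma card_proc_update_real:
  assumes "set w \<subseteq> A" "x \<in> A"
  shows "\<bar>real (card (proc s j (w[p := x]))) - card (proc s j w)\<bar> \<le> 12 * 5 ^ j"
proof -
  have w': "set (w[p := x]) \<subseteq> A" using assms set_update_subset_insert[of w p x] by auto
  note f = matching_finite[OF matching_proc[OF assms(1), of s j]] matching_finite[OF matching_proc[OF w', of s j]]
  have "card (proc s j (w[p := x])) \<le> card (proc s j w) + 12 * 5 ^ j"
    "card (proc s j w) \<le> card (proc s j (w[p := x])) + 12 * 5 ^ j"
    using card_le_card_plus_diff[OF f(1) f(2)] card_le_card_plus_diff[OF f(2) f(1)]
      card_proc_update[OF assms, of s j p] by linarith+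
  then have "real (card (proc s j (w[p := x]))) \<le> real (card (proc s j w) + 12 * 5 ^ j)"
    "real (card (proc s j w)) \<le> real (card (proc s j (w[p := x])) + 12 * 5 ^ j)"
    unfolding of_nat_le_iff by simp_all
  then show ?thesis unfolding of_nat_add of_nat_mult of_nat_power of_nat_numeral by linarith
qed

lemma isolated_map:
  assumes "set r \<subseteq> A" "\<And>e f. e \<in> A \<Longrightarrow> f \<in> A \<Longrightarrow> meets (\<tau> e) (\<tau> f) \<longleftrightarrow> meets e f"
  shows "isolated (map \<tau> r) = \<tau> ` isolated r"
proof -
  have "meets (map \<tau> r ! i) (map \<tau> r ! j) \<longleftrightarrow> meets (r ! i) (r ! j)" if "i < length r" "j < length r" for i j
    using assms that nth_mem by (simp add: subset_iff)
  then have iff: "(\<forall>j<length r. j \<noteq> i \<longrightarrow> \<not> meets (map \<tau> r ! i) (map \<tau> r ! j))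
      \<longleftrightarrow> (\<forall>j<length r. j \<noteq> i \<longrightarrow> \<not> meets (r ! i) (r ! j))" if "i < length r" for i
    using that by blast
  show ?thesis
  proof (intro equalityI subsetI)
    fix f assume "f \<in> isolated (map \<tau> r)"
    then obtain i where i: "f = map \<tau> r ! i" "i < length r"
      "\<forall>j<length r. j \<noteq> i \<longrightarrow> \<not> meets (map \<tau> r ! i) (map \<tau> r ! j)"
      unfolding isolated_def length_map by blast
    then have "r ! i \<in> isolated r" unfolding isolated_def iff[OF i(2)] by blast
    then show "f \<in> \<tau> ` isolated r" using i by simp
  next
    fix f assume "f \<in> \<tau> ` isolated r"
    then obtain i where i: "f = \<tau> (r ! i)" "i < length r"
      "\<forall>j<length r. j \<noteq> i \<longrightarrow> \<not> meets (r ! i) (r ! j)"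
      unfolding isolated_def by blast
    then have "\<forall>j<length r. j \<noteq> i \<longrightarrow> \<not> meets (map \<tau> r ! i) (map \<tau> r ! j)"
      using iff[OF i(2)] by blast
    moreover have "f = map \<tau> r ! i" using i by simp
    ultimately show "f \<in> isolated (map \<tau> r)"
      using i(2) unfolding isolated_def length_map by blast
  qed
qed

lemma proc_map:
  assumes w: "set w \<subseteq> A" and \<tau>: "bij_betw \<tau> A A"
    and pres: "\<And>e f. e \<in> A \<Longrightarrow> f \<in> A \<Longrightarrow> meets (\<tau> e) (\<tau> f) \<longleftrightarrow> meets e f"
  shows "proc s j (map \<tau> w) = \<tau> ` proc s j w"
proof (induction j)
  case (Suc j)
  let ?Q = "proc s j w" and ?r = "chunk s j w"
  have r: "set ?r \<subseteq> A" using w set_chunk by blast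
  have "chunk s j (map \<tau> w) = map \<tau> ?r" by (simp add: chunk_def drop_map take_map)
  then have iso: "isolated (chunk s j (map \<tau> w)) = \<tau> ` isolated ?r"
    using isolated_map[OF r pres] by simp
  have QA: "?Q \<subseteq> A" using matching_proc[OF w] by (simp add: matching_def)
  have iA: "isolated ?r \<subseteq> A" using isolated_subset r by blast
  have im: "\<tau> e \<in> A" if "e \<in> A" for e using that \<tau> bij_betwE by blast
  have "\<tau> e \<in> avail (\<tau> ` ?Q) \<longleftrightarrow> e \<in> avail ?Q" if "e \<in> A" for e
    using that QA im pres by (auto simp: avail_def subset_iff)
  then have "\<tau> ` isolated ?r \<inter> avail (\<tau> ` ?Q) = \<tau> ` (isolated ?r \<inter> avail ?Q)"
    using iA by blast
  then show ?case by (simp add: step_def Suc iso image_Un)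
qed simp

text \<open>A symmetry of the line system permutes the words, hence the average degree of a line depends
  only on the type of the line.\<close>

lemma mean_deg_eq:
  assumes "k < 4" "i \<in> {0..<int n}" "i' \<in> {0..<int n}"
  shows "mean (words A t) (\<lambda>w. real (deg k i (proc s j w))) = mean (words A t) (\<lambda>w. real (deg k i' (proc s j w)))"
proof -
  obtain \<tau> where \<tau>: "bij_betw \<tau> A A"
    "\<And>e f l. e \<in> A \<Longrightarrow> f \<in> A \<Longrightarrow> l < 4 \<Longrightarrow> ln l (\<tau> e) = ln l (\<tau> f) \<longleftrightarrow> ln l e = ln l f"
    "\<And>e. e \<in> A \<Longrightarrow> ln k (\<tau> e) = i' \<longleftrightarrow> ln k e = i"
    using line_symmetry[OF assms] by blast
  have pres: "meets (\<tau> e) (\<tau> f) \<longleftrightarrow> meets e f" if "e \<in> A" "f \<in> A" for e f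
    using \<tau>(2)[OF that] by (auto simp: meets_def)
  have im: "\<tau> e \<in> A" if "e \<in> A" for e using that \<tau>(1) bij_betwE by blast
  have deg_eq: "deg k i' (\<tau> ` Q) = deg k i Q" if Q: "Q \<subseteq> A" for Q
  proof -
    let ?S = "\<lambda>i Q. {e \<in> A. ln k e = i \<and> (\<forall>l<4. l \<noteq> k \<longrightarrow> (\<forall>q\<in>Q. ln l q \<noteq> ln l e))}"
    have mem: "\<tau> e \<in> ?S i' (\<tau> ` Q) \<longleftrightarrow> e \<in> ?S i Q" if "e \<in> A" for e
      using that Q im \<tau>(2,3) by (auto simp: subset_iff)
    have "bij_betw \<tau> (?S i Q) (?S i' (\<tau> ` Q))"
      unfolding bij_betw_def
    proof
      show "inj_on \<tau> (?S i Q)" using \<tau>(1) by (auto simp: bij_betw_def inj_on_def)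
      show "\<tau> ` ?S i Q = ?S i' (\<tau> ` Q)"
      proof (intro equalityI subsetI)
        fix f assume "f \<in> \<tau> ` ?S i Q"
        then obtain e where "e \<in> ?S i Q" "f = \<tau> e" by blast
        then show "f \<in> ?S i' (\<tau> ` Q)" using mem[of e] by blast
      next
        fix f assume f: "f \<in> ?S i' (\<tau> ` Q)"
        then have "f \<in> \<tau> ` A" using bij_betw_imp_surj_on[OF \<tau>(1)] by simp
        then obtain e where "e \<in> A" "f = \<tau> e" by blast
        then show "f \<in> \<tau> ` ?S i Q" using f mem[of e] by blast
      qed
    qed
    from bij_betw_same_card[OF this] show ?thesis unfolding deg_def by (rule sym)
  qed
  have "(\<Sum>w\<in>words A t. real (deg k i (proc s j w))) = (\<Sum>w\<in>words A t. real (deg k i' (proc s j (map \<tau> w))))"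
  proof (rule sum.cong[OF refl])
    fix w assume "w \<in> words A t"
    then have w: "set w \<subseteq> A" by (simp add: words_def)
    then have "proc s j w \<subseteq> A" using matching_proc by (simp add: matching_def)
    then show "real (deg k i (proc s j w)) = real (deg k i' (proc s j (map \<tau> w)))"
      by (simp add: proc_map[OF w \<tau>(1) pres] deg_eq)
  qed
  also have "\<dots> = (\<Sum>w\<in>words A t. real (deg k i' (proc s j w)))"
  proof (rule sum.reindex_bij_betw)
    have inv: "inv_into A \<tau> e \<in> A" "\<tau> (inv_into A \<tau> e) = e" "inv_into A \<tau> (\<tau> e) = e" if "e \<in> A" for e
      using \<tau>(1) that by (auto simp: bij_betw_def inv_into_into f_inv_into_f)
    show "bij_betw (map \<tau>) (words A t) (words A t)"
      by (rule bij_betwI[where g = "map (inv_into A \<tau>)"])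
         (auto simp: words_def subset_iff inv im intro!: map_idI)
  qed
  finally show ?thesis by (simp add: mean_def)
qed

definition mean_deg :: "nat \<Rightarrow> nat \<Rightarrow> nat \<Rightarrow> nat \<Rightarrow> real" where
  "mean_deg t s k j = mean (words A t) (\<lambda>w. real (deg k 0 (proc s j w)))"

definition mean_size :: "nat \<Rightarrow> nat \<Rightarrow> nat \<Rightarrow> real" where
  "mean_size t s j = mean (words A t) (\<lambda>w. real (card (proc s j w)))"

lemma deg_tail:
  assumes "k < 4" "i \<in> {0..<int n}" "t > 0" "a \<ge> 0"
  shows "card {w \<in> words A t. \<bar>real (deg k i (proc s j w)) - mean_deg t s k j\<bar> \<ge> a}
    \<le> 2 * card (words A t) * exp (- (a\<^sup>2 / (4 * real t * (12 * 5 ^ j)\<^sup>2)))"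
proof -
  have "mean_deg t s k j = mean (words A t) (\<lambda>w. real (deg k i (proc s j w)))"
    unfolding mean_deg_def using assms n_pos by (intro mean_deg_eq) auto
  then show ?thesis
    using bounded_differences_tail[OF finite_A A_nonempty, of t "\<lambda>w. real (deg k i (proc s j w))" "12 * 5 ^ j" a]
      deg_proc_update assms by (auto simp: words_def)
qed

lemma size_tail:
  assumes "t > 0" "a \<ge> 0"
  shows "card {w \<in> words A t. \<bar>real (card (proc s j w)) - mean_size t s j\<bar> \<ge> a}
    \<le> 2 * card (words A t) * exp (- (a\<^sup>2 / (4 * real t * (12 * 5 ^ j)\<^sup>2)))"
  using bounded_differences_tail[OF finite_A A_nonempty, of t "\<lambda>w. real (card (proc s j w))" "12 * 5 ^ j" a]
    card_proc_update_real assms by (auto simp: words_def mean_size_def)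

end

section \<open>Available elements\<close>

context line_system
begin

lemma avail_line_card_eq_sum:
  assumes Q: "matching Q" and k: "k < 4"
  shows "card (avail Q) = (\<Sum>i\<in>{0..<int n} - ln k ` Q. deg k i Q)"
    and "card ({0..<int n} - ln k ` Q) = n - card Q"
proof -
  let ?U = "{0..<int n} - ln k ` Q"
  let ?S = "\<lambda>i. {e \<in> A. ln k e = i \<and> (\<forall>l<4. l \<noteq> k \<longrightarrow> (\<forall>q\<in>Q. ln l q \<noteq> ln l e))}"
  have QA: "Q \<subseteq> A" using Q by (simp add: matching_def)
  have "avail Q = (\<Union>i\<in>?U. ?S i)"
  proof (intro equalityI subsetI)
    fix e assume e: "e \<in> avail Q"
    then have eA: "e \<in> A" and free: "\<And>q l. q \<in> Q \<Longrightarrow> l < 4 \<Longrightarrow> ln l q \<noteq> ln l e"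
      by (auto simp: avail_def meets_def)
    have "ln k e \<notin> ln k ` Q" using free k by (metis imageE)
    then have "ln k e \<in> ?U" using ln_range[OF eA k] by simp
    moreover have "e \<in> ?S (ln k e)" using eA free by auto
    ultimately show "e \<in> (\<Union>i\<in>?U. ?S i)" by blast
  next
    fix e assume "e \<in> (\<Union>i\<in>?U. ?S i)"
    then have eA: "e \<in> A" and e: "ln k e \<notin> ln k ` Q"
      "\<And>q l. q \<in> Q \<Longrightarrow> l < 4 \<Longrightarrow> l \<noteq> k \<Longrightarrow> ln l q \<noteq> ln l e" by auto
    have "ln l q \<noteq> ln l e" if "q \<in> Q" "l < 4" for q l
      using e that by (cases "l = k") (auto simp: image_iff)
    then show "e \<in> avail Q" using eA by (auto simp: avail_def meets_def)
  qed
  then show "card (avail Q) = (\<Sum>i\<in>?U. deg k i Q)"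
    unfolding deg_def by (simp, subst card_UN_disjoint) auto
  have "inj_on (ln k) Q" using matching_line_unique[OF Q _ _ k] by (auto simp: inj_on_def)
  moreover have "ln k ` Q \<subseteq> {0..<int n}" using QA ln_range[OF _ k] by auto
  ultimately show "card ?U = n - card Q"
    using matching_finite[OF Q] by (subst card_Diff_subset) (auto simp: card_image)
qed

lemma card_matching_le: "matching Q \<Longrightarrow> card Q \<le> n"
proof -
  assume Q: "matching Q"
  have "inj_on (ln 0) Q" using matching_line_unique[OF Q, of _ _ 0] by (auto simp: inj_on_def)
  moreover have "ln 0 ` Q \<subseteq> {0..<int n}" using Q ln_range[of _ 0] by (auto simp: matching_def)
  ultimately show ?thesis
    using card_mono[of "{0..<int n}" "ln 0 ` Q"] by (simp add: card_image)
qed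

lemma card_avail_line_le_deg: "card {f \<in> avail Q. ln k f = i} \<le> deg k i Q"
  unfolding deg_def by (intro card_mono) (auto simp: avail_def meets_def)

lemma avail_subset: "avail Q \<subseteq> A"
  by (auto simp: avail_def)

lemma finite_avail [simp]: "finite (avail Q)"
  using avail_subset finite_A finite_subset by blast

text \<open>If all lines of one type have nearly the same degree then that degree is nearly the average
  number of available elements on an uncovered line.  So adding \<open>m\<close> elements destroys at most
  about \<open>4 m\<close> times this average, whatever their position.\<close>

lemma card_avail_union_ge:
  fixes a :: real and D :: "nat \<Rightarrow> real"
  assumes Q: "matching Q" and M: "finite M"
    and N: "card Q < n" and a: "a \<ge> 0"
    and reg: "\<And>k i. k < 4 \<Longrightarrow> i \<in> {0..<int n} \<Longrightarrow> \<bar>real (deg k i Q) - D k\<bar> \<le> a"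
    and MA: "M \<subseteq> A"
  shows "real (card (avail (Q \<union> M)))
    \<ge> card (avail Q) * (1 - 4 * card M / real (n - card Q)) - 8 * a * card M"
proof -
  define N H where "N = real (n - card Q)" and "H = real (card (avail Q))"
  have Npos: "N > 0" using assms(3) by (simp add: N_def)
  have deg_le: "real (deg k i Q) \<le> H / N + 2 * a" if k: "k < 4" and i: "i \<in> {0..<int n}" for k i
  proof -
    have "N * (D k - a) = (\<Sum>i\<in>{0..<int n} - ln k ` Q. D k - a)"
      using avail_line_card_eq_sum(2)[OF Q k] by (simp add: N_def)
    also have "\<dots> \<le> (\<Sum>i\<in>{0..<int n} - ln k ` Q. real (deg k i Q))"
    proof (rule sum_mono)
      fix i assume "i \<in> {0..<int n} - ln k ` Q"
      then show "D k - a \<le> real (deg k i Q)" using reg[OF k, of i] by (auto simp: abs_le_iff)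
    qed
    also have "\<dots> = H" using avail_line_card_eq_sum(1)[OF Q k] by (simp add: H_def)
    finally have "D k - a \<le> H / N" using Npos by (simp add: field_simps)
    then show ?thesis using reg[OF k i] by linarith
  qed
  let ?X = "\<Union>(e, k)\<in>M \<times> {..<4}. {f \<in> avail Q. ln k f = ln k e}"
  have "avail Q \<subseteq> avail (Q \<union> M) \<union> ?X"
  proof
    fix f assume f: "f \<in> avail Q"
    show "f \<in> avail (Q \<union> M) \<union> ?X"
    proof (cases "\<exists>e\<in>M. meets e f")
      case True
      then obtain e k where "e \<in> M" "k < 4" "ln k e = ln k f" by (auto simp: meets_def)
      then show ?thesis using f by (intro UnI2 UN_I[of "(e, k)"]) auto
    qed (use f in \<open>auto simp: avail_def\<close>)
  qed
  then have "card (avail Q) \<le> card (avail (Q \<union> M) \<union> ?X)"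
    using M by (intro card_mono) auto
  also have "\<dots> \<le> card (avail (Q \<union> M)) + card ?X" by (rule card_Un_le)
  finally have "H \<le> card (avail (Q \<union> M)) + real (card ?X)" unfolding H_def by linarith
  also have "card ?X \<le> (\<Sum>(e, k)\<in>M \<times> {..<4}. card {f \<in> avail Q. ln k f = ln k e})"
    using M by (intro order_trans[OF card_UN_le]) (auto simp: case_prod_unfold)
  then have "real (card ?X) \<le> real (\<Sum>(e, k)\<in>M \<times> {..<4}. card {f \<in> avail Q. ln k f = ln k e})"
    unfolding of_nat_le_iff .
  also have "\<dots> \<le> (\<Sum>(e, k)\<in>M \<times> {..<4::nat}. H / N + 2 * a)"
    unfolding case_prod_unfold of_nat_sum
  proof (rule sum_mono)
    fix p :: "'e \<times> nat" assume "p \<in> M \<times> {..<4}"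
    then have p: "fst p \<in> A" "snd p < 4" using MA by auto
    have "card {f \<in> avail Q. ln (snd p) f = ln (snd p) (fst p)} \<le> deg (snd p) (ln (snd p) (fst p)) Q"
      by (rule card_avail_line_le_deg)
    then show "real (card {f \<in> avail Q. ln (snd p) f = ln (snd p) (fst p)}) \<le> H / N + 2 * a"
      using deg_le[OF p(2) ln_range[OF p]] by linarith
  qed
  also have "\<dots> = 4 * card M * (H / N + 2 * a)" by (simp add: card_cartesian_product)
  finally show ?thesis unfolding N_def[symmetric] H_def[symmetric] by (simp add: algebra_simps)
qed

section \<open>Samples that collide\<close>

definition isolated_pos :: "'e list \<Rightarrow> nat set" where
  "isolated_pos r = {i. i < length r \<and> (\<forall>j<length r. j \<noteq> i \<longrightarrow> \<not> meets (r ! i) (r ! j))}"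

definition collisions :: "'e list \<Rightarrow> nat" where
  "collisions r = card ({..<length r} - isolated_pos r)"

lemma isolated_eq: "isolated r = (!) r ` isolated_pos r"
  by (auto simp: isolated_def isolated_pos_def)

lemma isolated_pos_subset: "isolated_pos r \<subseteq> {..<length r}"
  by (auto simp: isolated_pos_def)

lemma finite_isolated_pos [simp]: "finite (isolated_pos r)"
  using isolated_pos_subset finite_subset by blast

lemma inj_on_isolated_pos: "inj_on ((!) r) (isolated_pos r)"
proof (rule inj_onI, rule ccontr)
  fix i j assume "i \<in> isolated_pos r" "j \<in> isolated_pos r" "r ! i = r ! j" "i \<noteq> j"
  then show False using meets_refl[of "r ! j"] by (auto simp: isolated_pos_def)
qed

lemma card_isolated: "card (isolated r) = length r - collisions r"
proof -
  have "card (isolated r) = card (isolated_pos r)"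
    unfolding isolated_eq by (rule card_image[OF inj_on_isolated_pos])
  moreover have "collisions r = length r - card (isolated_pos r)"
    unfolding collisions_def by (subst card_Diff_subset) (auto simp: isolated_pos_subset)
  moreover have "card (isolated_pos r) \<le> length r"
    using card_mono[OF _ isolated_pos_subset[of r]] by simp
  ultimately show ?thesis by simp
qed

lemma card_positions: "card {i. i < length r \<and> P (r ! i)} = length (filter P r)"
  by (simp add: length_filter_conv_card)

text \<open>Every sample in \<open>H\<close> that does not collide contributes to the set on the right.\<close>

lemma card_isolated_Int_ge: "length (filter (\<lambda>e. e \<in> H) r) \<le> card (isolated r \<inter> H) + collisions r"
proof -
  let ?P = "{i. i < length r \<and> r ! i \<in> H}"
  have "card ?P \<le> card ((isolated_pos r \<inter> ?P) \<union> ({..<length r} - isolated_pos r))"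
    by (intro card_mono) auto
  also have "\<dots> \<le> card (isolated_pos r \<inter> ?P) + collisions r"
    unfolding collisions_def by (rule card_Un_le)
  also have "card (isolated_pos r \<inter> ?P) = card ((!) r ` (isolated_pos r \<inter> ?P))"
    by (rule card_image[symmetric]) (rule inj_on_subset[OF inj_on_isolated_pos], blast)
  also have "(!) r ` (isolated_pos r \<inter> ?P) = isolated r \<inter> H"
    unfolding isolated_eq by (auto simp: isolated_pos_def)
  finally show ?thesis by (simp add: length_filter_conv_card)
qed

text \<open>A new sample turns at most the samples that it meets into collisions, and itself if there is one.\<close>

lemma collisions_Cons:
  assumes "set r \<subseteq> A" "x \<in> A"
  shows "collisions (x # r) \<le> collisions r + 2 * length (filter (meets x) r)"
proof -
  let ?c = "length (filter (meets x) r)"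
  let ?B = "{i. i < length r \<and> meets x (r ! i)}"
  have cB: "card ?B = ?c" by (rule card_positions)
  have "{..<length (x # r)} - isolated_pos (x # r)
      \<subseteq> Suc ` ({..<length r} - isolated_pos r) \<union> Suc ` ?B \<union> (if ?B = {} then {} else {0})"
  proof
    fix i assume i: "i \<in> {..<length (x # r)} - isolated_pos (x # r)"
    then obtain j where j: "j < length (x # r)" "j \<noteq> i" "meets ((x # r) ! i) ((x # r) ! j)"
      by (auto simp: isolated_pos_def)
    show "i \<in> Suc ` ({..<length r} - isolated_pos r) \<union> Suc ` ?B \<union> (if ?B = {} then {} else {0})"
    proof (cases i)
      case 0
      then obtain j' where "j = Suc j'" using j by (cases j) auto
      then have "?B \<noteq> {}" using j 0 by auto
      then show ?thesis using 0 by simp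
    next
      case (Suc i')
      then have i': "i' < length r" using i by simp
      show ?thesis
      proof (cases j)
        case 0
        then have "i' \<in> ?B" using j Suc i' by (simp add: meets_sym)
        then show ?thesis using Suc by simp
      next
        case (Suc j')
        then have "i' \<notin> isolated_pos r" using j \<open>i = Suc i'\<close> by (auto simp: isolated_pos_def)
        then show ?thesis using i' \<open>i = Suc i'\<close> by simp
      qed
    qed
  qed
  then have "collisions (x # r) \<le> card (Suc ` ({..<length r} - isolated_pos r) \<union> Suc ` ?B \<union> (if ?B = {} then {} else {0}))"
    unfolding collisions_def by (intro card_mono) auto
  also have "\<dots> \<le> card (Suc ` ({..<length r} - isolated_pos r)) + card (Suc ` ?B) + card (if ?B = {} then {} else {0::nat})"
    by (intro order_trans[OF card_Un_le] add_mono card_Un_le le_refl)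
  also have "\<dots> \<le> collisions r + ?c + (if ?B = {} then 0 else 1)"
    using cB by (simp add: card_image collisions_def)
  also have "(if ?B = {} then 0 else 1) \<le> ?c"
    using cB by (auto simp: card_gt_0_iff Suc_le_eq simp flip: cB)
  finally show ?thesis by simp
qed

lemma card_meets_le: "x \<in> A \<Longrightarrow> card {e \<in> A. meets e x} \<le> 4 * n"
proof -
  assume x: "x \<in> A"
  have "{e \<in> A. meets e x} = (\<Union>k<4. {e \<in> A. ln k e = ln k x})" by (auto simp: meets_def)
  then have "card {e \<in> A. meets e x} \<le> (\<Sum>k<4. card {e \<in> A. ln k e = ln k x})"
    by (simp add: card_UN_le)
  also have "\<dots> = (\<Sum>k<(4::nat). n)"
    using ln_range[OF x] by (intro sum.cong refl card_line) auto
  finally show ?thesis by simp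
qed

lemma sum_filter_words:
  "(\<Sum>r\<in>words A t. real (length (filter P r))) * real n ^ 2 = real t * card {e \<in> A. P e} * card (words A t)"
proof (induction t)
  case (Suc t)
  have c: "real (card (words A (Suc t))) = real n ^ 2 * card (words A t)"
    by (simp add: card_words_A power2_eq_square)
  have "(\<Sum>r\<in>words A (Suc t). real (length (filter P r)))
      = (\<Sum>x\<in>A. \<Sum>r\<in>words A t. (if P x then 1 else 0 :: real) + real (length (filter P r)))"
    by (auto simp: sum_words_Suc intro!: sum.cong)
  also have "\<dots> = (\<Sum>x\<in>A. if P x then 1 else 0 :: real) * card (words A t) + real n ^ 2 * (\<Sum>r\<in>words A t. real (length (filter P r)))"
    by (simp add: sum.distrib card_A sum_distrib_right sum_distrib_left mult.commute)
  also have "(\<Sum>x\<in>A. if P x then 1 else 0 :: real) = real (card {e \<in> A. P e})"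
    by (simp add: sum.If_cases Int_def)
  finally show ?case using Suc c by (simp add: algebra_simps)
qed simp

lemma sum_collisions_le:
  "(\<Sum>r\<in>words A t. real (collisions r)) \<le> 4 * real t ^ 2 / n * card (words A t)"
proof (induction t)
  case (Suc t)
  have c: "real (card (words A (Suc t))) = real n ^ 2 * card (words A t)"
    by (simp add: card_words_A power2_eq_square)
  have "(\<Sum>r\<in>words A (Suc t). real (collisions r))
      \<le> (\<Sum>x\<in>A. \<Sum>r\<in>words A t. real (collisions r) + 2 * real (length (filter (meets x) r)))"
    unfolding sum_words_Suc[OF finite_A]
  proof (intro sum_mono)
    fix x r assume "x \<in> A" "r \<in> words A t"
    then show "real (collisions (x # r)) \<le> real (collisions r) + 2 * real (length (filter (meets x) r))"
      using collisions_Cons[of r x] by (auto simp: words_def)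
  qed
  also have "\<dots> = real n ^ 2 * (\<Sum>r\<in>words A t. real (collisions r))
      + 2 * (\<Sum>x\<in>A. \<Sum>r\<in>words A t. real (length (filter (meets x) r)))"
    by (simp add: sum.distrib card_A sum_distrib_left)
  also have "(\<Sum>x\<in>A. \<Sum>r\<in>words A t. real (length (filter (meets x) r))) \<le> (\<Sum>x\<in>A. 4 * real t * card (words A t) / n)"
  proof (rule sum_mono)
    fix x assume x: "x \<in> A"
    have "card {e \<in> A. meets x e} \<le> 4 * n" using card_meets_le[OF x] by (simp add: meets_sym[of x])
    then have "real (card {e \<in> A. meets x e}) \<le> 4 * real n" by linarith
    then have "real t * card {e \<in> A. meets x e} * card (words A t) \<le> real t * (4 * real n) * card (words A t)"
      by (intro mult_right_mono mult_left_mono) auto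
    then have "(\<Sum>r\<in>words A t. real (length (filter (meets x) r))) * real n ^ 2 \<le> real t * (4 * real n) * card (words A t)"
      by (simp add: sum_filter_words)
    then show "(\<Sum>r\<in>words A t. real (length (filter (meets x) r))) \<le> 4 * real t * card (words A t) / n"
      using n_pos by (simp add: field_simps power2_eq_square)
  qed
  also have "\<dots> = 4 * real t * real n * card (words A t)"
    using n_pos by (simp add: card_A power2_eq_square)
  finally have "(\<Sum>r\<in>words A (Suc t). real (collisions r))
     \<le> real n ^ 2 * (\<Sum>r\<in>words A t. real (collisions r)) + 2 * (4 * real t * real n * card (words A t))"
    by simp
  then have "(\<Sum>r\<in>words A (Suc t). real (collisions r))
     \<le> real n ^ 2 * (4 * real t ^ 2 / n * card (words A t)) + 2 * (4 * real t * real n * card (words A t))"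
    using mult_left_mono[OF Suc.IH zero_le_power2[of "real n"]] by linarith
  also have "\<dots> = (4 * real t ^ 2 + 8 * real t) / n * (real n ^ 2 * card (words A t))"
    using n_pos by (simp add: field_simps power2_eq_square)
  also have "\<dots> \<le> 4 * real (Suc t) ^ 2 / n * (real n ^ 2 * card (words A t))"
    by (intro mult_right_mono divide_right_mono) (auto simp: power2_eq_square algebra_simps)
  finally show ?case using c by simp
qed (simp add: collisions_def)

section \<open>Rounds as independent blocks of samples\<close>

lemma chunk_append: "Suc i * s \<le> length u \<Longrightarrow> chunk s i (u @ v) = chunk s i u"
  by (simp add: chunk_def)

lemma proc_append: "j * s \<le> length u \<Longrightarrow> proc s j (u @ v) = proc s j u"
proof (induction j)
  case (Suc j)
  then show ?case using chunk_append[of j s u v] by simp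
qed simp

lemma chunk_middle: "length u = j * s \<Longrightarrow> length r = s \<Longrightarrow> chunk s j (u @ r @ v) = r"
  by (simp add: chunk_def)

lemma sum_words_proc_chunk:
  fixes g :: "'e set \<Rightarrow> 'e list \<Rightarrow> real"
  assumes "Suc j * s \<le> t"
  shows "(\<Sum>w\<in>words A t. g (proc s j w) (chunk s j w))
    = card (words A (t - Suc j * s)) * (\<Sum>u\<in>words A (j * s). \<Sum>r\<in>words A s. g (proc s j u) r)"
proof -
  have t: "t = j * s + (s + (t - Suc j * s))" using assms by simp
  have "(\<Sum>w\<in>words A t. g (proc s j w) (chunk s j w))
     = (\<Sum>u\<in>words A (j * s). \<Sum>r\<in>words A s. \<Sum>v\<in>words A (t - Suc j * s).
          g (proc s j (u @ r @ v)) (chunk s j (u @ r @ v)))"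
    by (subst t) (simp add: sum_words_append)
  also have "\<dots> = (\<Sum>u\<in>words A (j * s). \<Sum>r\<in>words A s. \<Sum>v\<in>words A (t - Suc j * s). g (proc s j u) r)"
    by (intro sum.cong refl) (simp add: words_def proc_append chunk_middle)
  finally show ?thesis by (simp add: sum_distrib_left)
qed

lemma card_words_split:
  "Suc j * s \<le> t \<Longrightarrow> card (words A t) = card (words A (t - Suc j * s)) * (card (words A (j * s)) * card (words A s))"
  by (simp add: card_words_A flip: power_add mult_2) (simp add: algebra_simps)

lemma sum_collisions_chunk_le:
  assumes "Suc j * s \<le> t"
  shows "(\<Sum>w\<in>words A t. real (collisions (chunk s j w))) \<le> 4 * real s ^ 2 / n * card (words A t)"
proof -
  have "(\<Sum>w\<in>words A t. real (collisions (chunk s j w)))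
      = card (words A (t - Suc j * s)) * (card (words A (j * s)) * (\<Sum>r\<in>words A s. real (collisions r)))"
    using sum_words_proc_chunk[OF assms, of "\<lambda>_ r. real (collisions r)"] by simp
  also have "\<dots> \<le> card (words A (t - Suc j * s)) * (card (words A (j * s)) * (4 * real s ^ 2 / n * card (words A s)))"
    by (intro mult_left_mono sum_collisions_le) auto
  also have "\<dots> = 4 * real s ^ 2 / n * card (words A t)"
    using card_words_split[OF assms] by simp
  finally show ?thesis .
qed

text \<open>The expected gain of a round: a sample is available with probability \<open>card (avail Q) / n\<^sup>2\<close>, and
  few samples collide.\<close>

lemma mean_size_Suc_ge:
  assumes "Suc j * s \<le> t"
  shows "mean_size t s (Suc j)
    \<ge> mean_size t s j + s / real n ^ 2 * mean (words A t) (\<lambda>w. real (card (avail (proc s j w)))) - 4 * real s ^ 2 / n"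
proof -
  let ?W = "words A t"
  have card_Suc: "real (card (proc s (Suc j) w))
      \<ge> card (proc s j w) + (real (length (filter (\<lambda>e. e \<in> avail (proc s j w)) (chunk s j w))) - collisions (chunk s j w))"
    if w: "w \<in> ?W" for w
  proof -
    let ?Q = "proc s j w" and ?r = "chunk s j w"
    have wA: "set w \<subseteq> A" using w by (simp add: words_def)
    have "?Q \<inter> (isolated ?r \<inter> avail ?Q) = {}" by (auto simp: avail_def)
    then have "card (proc s (Suc j) w) = card ?Q + card (isolated ?r \<inter> avail ?Q)"
      using matching_finite[OF matching_proc[OF wA]] by (simp add: step_def card_Un_disjoint)
    then show ?thesis using card_isolated_Int_ge[of "avail ?Q" ?r] by linarith
  qed
  have flt: "(\<Sum>w\<in>?W. real (length (filter (\<lambda>e. e \<in> avail (proc s j w)) (chunk s j w)))) * real n ^ 2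
      = s * (\<Sum>w\<in>?W. real (card (avail (proc s j w))))"
  proof -
    have e: "(\<Sum>r\<in>words A s. real (length (filter (\<lambda>e. e \<in> avail Q) r))) * real n ^ 2
        = (\<Sum>r\<in>words A s. s * real (card (avail Q)))" for Q
    proof -
      have "{e \<in> A. e \<in> avail Q} = avail Q" using avail_subset by blast
      then show ?thesis by (simp add: sum_filter_words)
    qed
    have "(\<Sum>w\<in>?W. real (length (filter (\<lambda>e. e \<in> avail (proc s j w)) (chunk s j w)))) * real n ^ 2
       = card (words A (t - Suc j * s)) * (\<Sum>u\<in>words A (j * s).
           (\<Sum>r\<in>words A s. real (length (filter (\<lambda>e. e \<in> avail (proc s j u)) r))) * real n ^ 2)"
      using sum_words_proc_chunk[OF assms, of "\<lambda>Q r. real (length (filter (\<lambda>e. e \<in> avail Q) r))"]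
      by (simp add: sum_distrib_right)
    also have "\<dots> = (\<Sum>w\<in>?W. s * real (card (avail (proc s j w))))"
      unfolding e using sum_words_proc_chunk[OF assms, of "\<lambda>Q r. s * real (card (avail Q))"] by simp
    finally show ?thesis by (simp add: sum_distrib_left)
  qed
  have "(\<Sum>w\<in>?W. real (card (proc s (Suc j) w)))
     \<ge> (\<Sum>w\<in>?W. card (proc s j w) + (real (length (filter (\<lambda>e. e \<in> avail (proc s j w)) (chunk s j w))) - collisions (chunk s j w)))"
    by (intro sum_mono card_Suc)
  moreover have "(\<Sum>w\<in>?W. real (length (filter (\<lambda>e. e \<in> avail (proc s j w)) (chunk s j w))))
      = s / real n ^ 2 * (\<Sum>w\<in>?W. real (card (avail (proc s j w))))"
    using flt n_pos by (simp add: field_simps)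
  ultimately have "(\<Sum>w\<in>?W. real (card (proc s (Suc j) w))) \<ge> (\<Sum>w\<in>?W. real (card (proc s j w)))
      + s / real n ^ 2 * (\<Sum>w\<in>?W. real (card (avail (proc s j w)))) - 4 * real s ^ 2 / n * card ?W"
    using sum_collisions_chunk_le[OF assms] unfolding sum.distrib sum_subtractf by linarith
  then have "(\<Sum>w\<in>?W. real (card (proc s (Suc j) w))) / card ?W \<ge> ((\<Sum>w\<in>?W. real (card (proc s j w)))
      + s / real n ^ 2 * (\<Sum>w\<in>?W. real (card (avail (proc s j w)))) - 4 * real s ^ 2 / n * card ?W) / card ?W"
    by (intro divide_right_mono) auto
  moreover have "card ?W \<noteq> 0" using card_words_A_pos[of t] by linarith
  ultimately show ?thesis unfolding mean_size_def mean_def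
    by (simp only: add_divide_distrib diff_divide_distrib times_divide_eq_right nonzero_mult_div_cancel_right of_nat_eq_0_iff
        not_False_eq_True)
qed

end

section \<open>The typical run of the nibble\<close>

text \<open>One round in numbers: \<open>N\<close> uncovered lines of each type, \<open>H\<close> available elements, and \<open>m\<close> new
  elements.  The quantity \<open>c\<^sup>2 H / N\<^sup>4\<close> decreases only by \<open>z\<close>, since \<open>1 - 4 m / N\<close> and
  \<open>(1 - m / N)\<^sup>4\<close> agree to first order.\<close>

lemma quartic_step:
  fixes N m H H' x z a c :: real
  assumes N: "N > 0" and m: "0 \<le> m" "8 * m \<le> N" and x: "0 \<le> x" "x \<le> 1"
    and H: "c\<^sup>2 * H \<ge> (1 - x) * N ^ 4"
    and H': "H' \<ge> H * (1 - 4 * m / N) - 8 * a * m"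
    and z: "6 * m\<^sup>2 * N\<^sup>2 + 8 * a * m * c\<^sup>2 \<le> z * (N - m) ^ 4"
  shows "c\<^sup>2 * H' \<ge> (1 - x - z) * (N - m) ^ 4"
proof -
  define u where "u = m / N"
  have u: "0 \<le> u" "u \<le> 1 / 8" using N m by (auto simp: u_def field_simps)
  have mu: "m = u * N" using N by (simp add: u_def)
  have bern: "1 - 4 * u \<ge> (1 - u) ^ 4 - 6 * u\<^sup>2"
  proof -
    have "1 - 4 * u - ((1 - u) ^ 4 - 6 * u\<^sup>2) = u ^ 3 * (4 - u)"
      by (simp add: power2_eq_square power3_eq_cube power4_eq_xxxx algebra_simps)
    moreover have "u ^ 3 * (4 - u) \<ge> 0" using u by simp
    ultimately show ?thesis by linarith
  qed
  have "c\<^sup>2 * (H * (1 - 4 * u)) \<ge> (1 - x) * N ^ 4 * (1 - 4 * u)"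
    using mult_right_mono[OF H, of "1 - 4 * u"] u by (simp add: mult.assoc)
  moreover have "(1 - x) * N ^ 4 * (1 - 4 * u) \<ge> (1 - x) * N ^ 4 * ((1 - u) ^ 4 - 6 * u\<^sup>2)"
    using bern x by (intro mult_left_mono) auto
  moreover have "(1 - x) * N ^ 4 * ((1 - u) ^ 4 - 6 * u\<^sup>2) = (1 - x) * (N - m) ^ 4 - (1 - x) * (6 * m\<^sup>2 * N\<^sup>2)"
    by (simp add: mu power2_eq_square power4_eq_xxxx algebra_simps)
  moreover have "(1 - x) * (6 * m\<^sup>2 * N\<^sup>2) \<le> 1 * (6 * m\<^sup>2 * N\<^sup>2)"
    using x by (intro mult_right_mono) auto
  moreover have "c\<^sup>2 * H' \<ge> c\<^sup>2 * (H * (1 - 4 * u)) - 8 * a * m * c\<^sup>2"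
    using mult_left_mono[OF H', of "c\<^sup>2"] by (simp add: u_def algebra_simps)
  moreover have "(1 - x - z) * (N - m) ^ 4 = (1 - x) * (N - m) ^ 4 - z * (N - m) ^ 4"
    by (simp add: algebra_simps)
  ultimately show ?thesis using z by linarith
qed

text \<open>There are at most \<open>L\<close> rounds with \<open>s\<close> samples each.  The process is followed as long as more than
  about \<open>2 \<nu> n\<close> lines of each type are uncovered; \<open>\<delta> n\<close> is the deviation allowed in the concentration
  inequalities.  The last two assumptions say that the second order errors of all rounds add up to at
  most \<open>1 / 2\<close> and that the deviations are unlikely.\<close>

locale nibble = line_system +
  fixes s L :: nat and \<nu> \<delta> :: real
  assumes s_pos: "s > 0"
    and nu: "0 < \<nu>" "\<nu> \<le> 1 / 4"
    and dl: "0 < \<delta>" "\<delta> \<le> \<nu>"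
    and s_small: "32 * s \<le> \<nu> ^ 4 * n"
    and L_large: "8 * n \<le> L * s * \<nu> ^ 4"
    and error_small: "L * (16 * (6 * s\<^sup>2 / (\<nu>\<^sup>2 * n\<^sup>2) + 8 * \<delta> * s / (\<nu> ^ 4 * n))) \<le> 1 / 2"
    and tail_small: "16 * (L + 1) * (4 * n + 1) * exp (- ((\<delta> * n)\<^sup>2 / (4 * (L * s) * (12 * 5 ^ L)\<^sup>2))) \<le> 1"
begin

text \<open>The relative error of one round in the number of available elements.\<close>

definition \<xi> :: real where
  "\<xi> = 16 * (6 * s\<^sup>2 / (\<nu>\<^sup>2 * n\<^sup>2) + 8 * \<delta> * s / (\<nu> ^ 4 * n))"

definition regular :: "'a list \<Rightarrow> bool" where
  "regular w \<longleftrightarrow> (\<forall>j\<le>L.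
     (\<forall>k<4. \<forall>i\<in>{0..<int n}. \<bar>real (deg k i (proc s j w)) - mean_deg (L * s) s k j\<bar> < \<delta> * n) \<and>
     \<bar>real (card (proc s j w)) - mean_size (L * s) s j\<bar> < \<delta> * n)"

lemma L_pos: "L > 0"
proof (rule ccontr)
  assume "\<not> L > 0"
  then show False using L_large n_pos by simp
qed

lemma xi_nonneg: "\<xi> \<ge> 0"
  using nu dl by (simp add: \<xi>_def)

lemma L_xi: "L * \<xi> \<le> 1 / 2"
  using error_small by (simp add: \<xi>_def)

lemma s_le: "32 * real s \<le> \<nu> * n"
proof -
  have "\<nu> ^ 4 \<le> \<nu> ^ 1" using nu by (intro power_decreasing) auto
  then have "\<nu> ^ 4 * n \<le> \<nu> * n" by (simp add: mult_right_mono)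
  then show ?thesis using s_small by linarith
qed

lemma card_not_regular: "card {w \<in> words A (L * s). \<not> regular w} \<le> card (words A (L * s)) / 8"
proof -
  let ?W = "words A (L * s)" and ?a = "\<delta> * n"
  define E where "E = exp (- ((\<delta> * n)\<^sup>2 / (4 * real (L * s) * (12 * 5 ^ L)\<^sup>2)))"
  have Tpos: "L * s > 0" using L_pos s_pos by simp
  have a0: "?a \<ge> 0" using dl by simp
  have Ej: "exp (- (?a\<^sup>2 / (4 * real (L * s) * (12 * 5 ^ j)\<^sup>2))) \<le> E" if "j \<le> L" for j
  proof -
    have "(12 * 5 ^ j)\<^sup>2 \<le> (12 * 5 ^ L :: real)\<^sup>2"
      using that by (intro power_mono mult_left_mono power_increasing) auto
    then have "4 * real (L * s) * (12 * 5 ^ j)\<^sup>2 \<le> 4 * real (L * s) * (12 * 5 ^ L)\<^sup>2"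
      by (intro mult_left_mono) auto
    then show ?thesis unfolding E_def using Tpos
      by (auto intro!: divide_left_mono mult_pos_pos simp del: of_nat_mult)
  qed
  define B where "B = (\<lambda>(j, k, i). {w \<in> ?W. \<bar>real (deg k i (proc s j w)) - mean_deg (L * s) s k j\<bar> \<ge> ?a})"
  define C where "C j = {w \<in> ?W. \<bar>real (card (proc s j w)) - mean_size (L * s) s j\<bar> \<ge> ?a}" for j
  let ?I = "{..L} \<times> {..<4::nat} \<times> {0..<int n}"
  have fin: "finite ?W" by simp
  have sub: "{w \<in> ?W. \<not> regular w} \<subseteq> (\<Union>p\<in>?I. B p) \<union> (\<Union>j\<le>L. C j)"
  proof
    fix w assume w: "w \<in> {w \<in> ?W. \<not> regular w}"
    then obtain j where j: "j \<le> L"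
      and d: "\<not> ((\<forall>k<4. \<forall>i\<in>{0..<int n}. \<bar>real (deg k i (proc s j w)) - mean_deg (L * s) s k j\<bar> < ?a) \<and>
         \<bar>real (card (proc s j w)) - mean_size (L * s) s j\<bar> < ?a)"
      by (auto simp: regular_def)
    show "w \<in> (\<Union>p\<in>?I. B p) \<union> (\<Union>j\<le>L. C j)"
    proof (cases "\<bar>real (card (proc s j w)) - mean_size (L * s) s j\<bar> < ?a")
      case True
      then obtain k i where "k < 4" "i \<in> {0..<int n}" "\<not> \<bar>real (deg k i (proc s j w)) - mean_deg (L * s) s k j\<bar> < ?a"
        using d by blast
      then show ?thesis using w j by (intro UnI1 UN_I[of "(j, k, i)"]) (auto simp: B_def)
    next
      case False
      then show ?thesis using w j by (intro UnI2 UN_I[of j]) (auto simp: C_def)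
    qed
  qed
  have "card {w \<in> ?W. \<not> regular w} \<le> card ((\<Union>p\<in>?I. B p) \<union> (\<Union>j\<le>L. C j))"
    by (rule card_mono[OF _ sub]) (auto simp: B_def C_def)
  also have "\<dots> \<le> card (\<Union>p\<in>?I. B p) + card (\<Union>j\<le>L. C j)" by (rule card_Un_le)
  also have "\<dots> \<le> (\<Sum>p\<in>?I. card (B p)) + (\<Sum>j\<le>L. card (C j))"
    by (intro add_mono card_UN_le) auto
  finally have "real (card {w \<in> ?W. \<not> regular w}) \<le> real ((\<Sum>p\<in>?I. card (B p)) + (\<Sum>j\<le>L. card (C j)))"
    unfolding of_nat_le_iff .
  also have "\<dots> = (\<Sum>p\<in>?I. real (card (B p))) + (\<Sum>j\<le>L. real (card (C j)))" by simp
  also have "\<dots> \<le> (\<Sum>p\<in>?I. 2 * card ?W * E) + (\<Sum>j\<le>L. 2 * card ?W * E)"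
  proof (intro add_mono sum_mono)
    fix p assume "p \<in> ?I"
    then obtain j k i where p: "p = (j, k, i)" "j \<le> L" "k < 4" "i \<in> {0..<int n}" by auto
    have "real (card (B p)) \<le> 2 * card ?W * exp (- (?a\<^sup>2 / (4 * real (L * s) * (12 * 5 ^ j)\<^sup>2)))"
      using deg_tail[OF p(3,4) Tpos a0, of s j] by (simp add: B_def p(1))
    also have "\<dots> \<le> 2 * card ?W * E" using Ej[OF p(2)] by (intro mult_left_mono) auto
    finally show "real (card (B p)) \<le> 2 * card ?W * E" .
  next
    fix j assume j: "j \<in> {..L}"
    have "real (card (C j)) \<le> 2 * card ?W * exp (- (?a\<^sup>2 / (4 * real (L * s) * (12 * 5 ^ j)\<^sup>2)))"
      using size_tail[OF Tpos a0, of s j] by (simp add: C_def)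
    also have "\<dots> \<le> 2 * card ?W * E" using Ej[of j] j by (intro mult_left_mono) auto
    finally show "real (card (C j)) \<le> 2 * card ?W * E" .
  qed
  also have "\<dots> = card ?W / 8 * (16 * (L + 1) * (4 * n + 1) * E)"
    by (simp add: card_cartesian_product algebra_simps)
  also have "\<dots> \<le> card ?W / 8 * 1"
    using tail_small by (intro mult_left_mono) (auto simp: E_def)
  finally show ?thesis by simp
qed

lemma card_proc_Suc:
  assumes w: "w \<in> words A (L * s)"
  defines "M \<equiv> \<lambda>j. isolated (chunk s j w) \<inter> avail (proc s j w)"
  shows "card (proc s (Suc j) w) = card (proc s j w) + card (M j)" "card (M j) \<le> s"
    "finite (M j)" "M j \<subseteq> A" "proc s (Suc j) w = proc s j w \<union> M j"
proof -
  have wA: "set w \<subseteq> A" using w by (simp add: words_def)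
  show fin: "finite (M j)" and "M j \<subseteq> A" unfolding M_def using avail_subset by auto
  show eq: "proc s (Suc j) w = proc s j w \<union> M j" by (simp add: step_def M_def)
  have "proc s j w \<inter> M j = {}" by (auto simp: avail_def M_def)
  then show "card (proc s (Suc j) w) = card (proc s j w) + card (M j)"
    unfolding eq using matching_finite[OF matching_proc[OF wA]] fin by (simp add: card_Un_disjoint)
  have "card (M j) \<le> card (isolated (chunk s j w))"
    unfolding M_def isolated_eq by (intro card_mono) auto
  also have "\<dots> \<le> s" by (simp add: card_isolated chunk_def)
  finally show "card (M j) \<le> s" .
qed

text \<open>The availability of the random greedy process, without solving a differential equation: the
  crude union bound for the damage of one round agrees with the factor \<open>(1 - m / N)^4\<close> up to second
  order in the size of the round.\<close>

lemma avail_lower: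
  assumes w: "w \<in> words A (L * s)" "regular w"
    and K: "K \<le> L" "\<And>j. j < K \<Longrightarrow> n - mean_size (L * s) s j > 2 * \<nu> * n"
  shows "j \<le> K \<Longrightarrow> real n ^ 2 * card (avail (proc s j w)) \<ge> (1 - j * \<xi>) * (real n - card (proc s j w)) ^ 4"
    and "j < K \<Longrightarrow> real n - card (proc s j w) \<ge> \<nu> * n"
proof -
  have wA: "set w \<subseteq> A" using w by (simp add: words_def)
  have low: "real n - card (proc s j w) \<ge> \<nu> * n" if "j < K" for j
  proof -
    have "\<bar>real (card (proc s j w)) - mean_size (L * s) s j\<bar> < \<delta> * n"
      using w(2) K(1) that by (auto simp: regular_def)
    moreover have "\<delta> * n \<le> \<nu> * n" using dl by (simp add: mult_right_mono)
    ultimately show ?thesis using K(2)[OF that] by linarith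
  qed
  then show "j < K \<Longrightarrow> real n - card (proc s j w) \<ge> \<nu> * n" .
  show "j \<le> K \<Longrightarrow> real n ^ 2 * card (avail (proc s j w)) \<ge> (1 - j * \<xi>) * (real n - card (proc s j w)) ^ 4"
  proof (induction j)
    case 0
    have "avail {} = A" by (auto simp: avail_def)
    then show ?case by (simp add: card_A power2_eq_square power4_eq_xxxx)
  next
    case (Suc j)
    let ?Q = "proc s j w"
    define M where "M = isolated (chunk s j w) \<inter> avail ?Q"
    note M = card_proc_Suc[OF w(1), of j, folded M_def]
    define N m where "N = real n - card ?Q" and "m = real (card M)"
    have jK: "j < K" using Suc.prems by simp
    have N: "N \<ge> \<nu> * n" using low[OF jK] by (simp add: N_def)
    have vn: "\<nu> * n > 0" using nu n_pos by simp
    then have Npos: "N > 0" using N by linarith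
    then have ltn: "card ?Q < n" by (simp add: N_def)
    have m: "0 \<le> m" "m \<le> s" using M(2) by (auto simp: m_def)
    have m8: "8 * m \<le> N" using m s_le N by linarith
    have x: "0 \<le> j * \<xi>" "j * \<xi> \<le> 1"
    proof -
      show "0 \<le> j * \<xi>" using xi_nonneg by simp
      have "j * \<xi> \<le> L * \<xi>" using jK K(1) xi_nonneg by (intro mult_right_mono) auto
      then show "j * \<xi> \<le> 1" using L_xi by linarith
    qed
    have reg: "\<bar>real (deg k i ?Q) - mean_deg (L * s) s k j\<bar> \<le> \<delta> * n" if "k < 4" "i \<in> {0..<int n}" for k i
      using w(2) K(1) jK that unfolding regular_def by (meson less_imp_le less_le_trans)
    have H': "real (card (avail (?Q \<union> M))) \<ge> card (avail ?Q) * (1 - 4 * m / N) - 8 * (\<delta> * n) * m"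
      using card_avail_union_ge[OF matching_proc[OF wA] M(3) ltn _ reg M(4)] dl ltn
      by (simp add: m_def N_def of_nat_diff)
    have z: "6 * m\<^sup>2 * N\<^sup>2 + 8 * (\<delta> * n) * m * (real n)\<^sup>2 \<le> \<xi> * (N - m) ^ 4"
    proof -
      have nm: "N - m \<ge> N / 2" using m8 m Npos by linarith
      have N4: "N ^ 4 \<le> 16 * (N - m) ^ 4"
        using power_mono[OF nm, of 4] Npos by (simp add: power_divide)
      have q1: "N\<^sup>2 / (\<nu>\<^sup>2 * n\<^sup>2) \<ge> 1"
        using power_mono[OF N, of 2] vn nu n_pos by (simp add: power_mult_distrib field_simps)
      have q2: "N ^ 4 / (\<nu> ^ 4 * n ^ 4) \<ge> 1"
        using power_mono[OF N, of 4] vn nu n_pos by (simp add: power_mult_distrib field_simps)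
      have "6 * m\<^sup>2 * N\<^sup>2 * 1 \<le> 6 * s\<^sup>2 * N\<^sup>2 * (N\<^sup>2 / (\<nu>\<^sup>2 * n\<^sup>2))"
        using m q1 by (intro mult_mono) (auto simp: power_mono)
      also have "\<dots> = 6 * s\<^sup>2 / (\<nu>\<^sup>2 * n\<^sup>2) * N ^ 4" by (simp add: power2_eq_square power4_eq_xxxx)
      finally have t1: "6 * m\<^sup>2 * N\<^sup>2 \<le> 6 * s\<^sup>2 / (\<nu>\<^sup>2 * n\<^sup>2) * N ^ 4" by simp
      have "8 * (\<delta> * n) * m * (real n)\<^sup>2 * 1 \<le> 8 * (\<delta> * n) * s * (real n)\<^sup>2 * (N ^ 4 / (\<nu> ^ 4 * n ^ 4))"
        using m q2 dl by (intro mult_mono) auto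
      also have "\<dots> = 8 * \<delta> * s / (\<nu> ^ 4 * n) * N ^ 4"
        using n_pos nu by (simp add: field_simps power2_eq_square power4_eq_xxxx)
      finally have t2: "8 * (\<delta> * n) * m * (real n)\<^sup>2 \<le> 8 * \<delta> * s / (\<nu> ^ 4 * n) * N ^ 4" by simp
      have "6 * m\<^sup>2 * N\<^sup>2 + 8 * (\<delta> * n) * m * (real n)\<^sup>2
          \<le> (6 * s\<^sup>2 / (\<nu>\<^sup>2 * n\<^sup>2) + 8 * \<delta> * s / (\<nu> ^ 4 * n)) * N ^ 4"
        using t1 t2 by (simp add: distrib_right)
      also have "\<dots> \<le> (6 * s\<^sup>2 / (\<nu>\<^sup>2 * n\<^sup>2) + 8 * \<delta> * s / (\<nu> ^ 4 * n)) * (16 * (N - m) ^ 4)"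
        using N4 dl nu by (intro mult_left_mono) auto
      finally show ?thesis by (simp only: \<xi>_def mult_ac)
    qed
    have "(1 - j * \<xi> - \<xi>) * (N - m) ^ 4 \<le> (real n)\<^sup>2 * card (avail (?Q \<union> M))"
      using quartic_step[OF Npos m(1) m8 x _ H' z] Suc.IH jK by (simp add: N_def)
    moreover have "N - m = real n - card (proc s (Suc j) w)"
      using M(1) by (simp add: N_def m_def)
    ultimately show ?case using M(5) by (simp add: algebra_simps)
  qed
qed

text \<open>While many lines are uncovered, many elements are available on average, so every round adds a fixed
  fraction of its samples; hence \<open>L\<close> rounds are enough.  The stopping round is determined by the
  expected sizes and therefore does not depend on the run.\<close>

lemma exists_stopping_round:
  obtains K where "K \<le> L" "n - mean_size (L * s) s K \<le> 2 * \<nu> * n"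
    "\<And>j. j < K \<Longrightarrow> n - mean_size (L * s) s j > 2 * \<nu> * n"
proof -
  let ?W = "words A (L * s)" and ?P = "\<lambda>K. n - mean_size (L * s) s K \<le> 2 * \<nu> * n"
  have Wne: "?W \<noteq> {}" using card_words_A_pos[of "L * s"] by force
  have "\<exists>K\<le>L. ?P K"
  proof (rule ccontr)
    assume "\<not> ?thesis"
    then have big: "n - mean_size (L * s) s j > 2 * \<nu> * n" if "j \<le> L" for j
      using that by force
    have gain: "mean_size (L * s) s (Suc j) \<ge> mean_size (L * s) s j + s * \<nu> ^ 4 / 8" if j: "j < L" for j
    proof -
      let ?c = "\<nu> ^ 4 * real n ^ 2 / 2"
      have av: "real (card (avail (proc s j w))) \<ge> ?c" if w: "w \<in> {w \<in> ?W. regular w}" for w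
      proof -
        have w': "w \<in> ?W" "regular w" using w by auto
        note al = avail_lower[OF w' le_refl big]
        have "1 - j * \<xi> \<ge> 1 / 2"
        proof -
          have "j * \<xi> \<le> L * \<xi>" using j xi_nonneg by (intro mult_right_mono) auto
          then show ?thesis using L_xi by linarith
        qed
        moreover have "(real n - card (proc s j w)) ^ 4 \<ge> (\<nu> * n) ^ 4"
          using al(2)[of j] j nu by (intro power_mono) auto
        ultimately have "1 / 2 * (\<nu> * n) ^ 4 \<le> (1 - j * \<xi>) * (real n - card (proc s j w)) ^ 4"
          by (intro mult_mono) auto
        also have "\<dots> \<le> real n ^ 2 * card (avail (proc s j w))" using al(1)[of j] j by simp
        finally have "real n ^ 2 * ?c \<le> real n ^ 2 * card (avail (proc s j w))"
          by (simp add: power_mult_distrib power2_eq_square power4_eq_xxxx mult_ac)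
        then show ?thesis using n_pos by simp
      qed
      have "(\<Sum>w\<in>?W. real (card (avail (proc s j w)))) \<ge> (\<Sum>w\<in>{w \<in> ?W. regular w}. real (card (avail (proc s j w))))"
        by (intro sum_mono2) auto
      moreover have "(\<Sum>w\<in>{w \<in> ?W. regular w}. real (card (avail (proc s j w)))) \<ge> (\<Sum>w\<in>{w \<in> ?W. regular w}. ?c)"
        by (intro sum_mono av)
      moreover have "real (card {w \<in> ?W. regular w}) \<ge> card ?W / 2"
      proof -
        have "?W = {w \<in> ?W. regular w} \<union> {w \<in> ?W. \<not> regular w}" by blast
        then have "card ?W \<le> card {w \<in> ?W. regular w} + card {w \<in> ?W. \<not> regular w}"
          by (metis card_Un_le)
        then show ?thesis using card_not_regular by linarith
      qed
      then have "card {w \<in> ?W. regular w} * ?c \<ge> card ?W / 2 * ?c"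
        by (intro mult_right_mono) auto
      ultimately have "(\<Sum>w\<in>?W. real (card (avail (proc s j w)))) \<ge> card ?W / 2 * ?c"
        unfolding sum_constant by linarith
      then have m: "mean ?W (\<lambda>w. real (card (avail (proc s j w)))) \<ge> ?c / 2"
        using card_words_A_pos[of "L * s"] by (simp add: mean_def field_simps)
      have "s / real n ^ 2 * mean ?W (\<lambda>w. real (card (avail (proc s j w)))) \<ge> s / real n ^ 2 * (?c / 2)"
        using m by (intro mult_left_mono) auto
      also have "s / real n ^ 2 * (?c / 2) = s * \<nu> ^ 4 / 4" using n_pos by (simp add: field_simps)
      finally have "s / real n ^ 2 * mean ?W (\<lambda>w. real (card (avail (proc s j w)))) \<ge> s * \<nu> ^ 4 / 4" .
      moreover have "4 * real s ^ 2 / n \<le> s * \<nu> ^ 4 / 8"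
      proof -
        have "real s * (32 * s) \<le> real s * (\<nu> ^ 4 * n)" using s_small by (intro mult_left_mono) auto
        then show ?thesis using n_pos by (simp add: field_simps power2_eq_square)
      qed
      moreover have "Suc j * s \<le> L * s" using j by (intro mult_right_mono) auto
      ultimately show ?thesis using mean_size_Suc_ge[of j s "L * s"] by linarith
    qed
    have "j \<le> L \<Longrightarrow> mean_size (L * s) s j \<ge> j * (s * \<nu> ^ 4 / 8)" for j
    proof (induction j)
      case 0
      then show ?case by (simp add: mean_size_def mean_def)
    next
      case (Suc j)
      then show ?case using gain[of j] by (simp add: algebra_simps add_divide_distrib)
    qed
    from this[of L] have "mean_size (L * s) s L \<ge> n"
      using L_large by (simp add: field_simps)
    then show False using big[of L] nu n_pos by (smt (verit) le_refl mult_nonneg_nonneg of_nat_0_le_iff)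
  qed
  then obtain K where K: "K \<le> L" "?P K" by blast
  define K0 where "K0 = (LEAST K. ?P K)"
  have "?P K0" unfolding K0_def by (rule LeastI[of ?P, OF K(2)])
  moreover have "K0 \<le> L" using Least_le[of ?P, OF K(2)] K(1) by (simp add: K0_def)
  moreover have "\<not> ?P j" if "j < K0" for j using not_less_Least[of j ?P] that by (simp add: K0_def)
  ultimately show ?thesis using that[of K0] by force
qed

end

section \<open>How many runs end in a given matching\<close>

lemma fact_le_power_mult_fact: "m \<le> N \<Longrightarrow> fact N \<le> N ^ m * (fact (N - m) :: nat)"
proof (induction m)
  case (Suc m)
  then obtain d where d: "N - m = Suc d" "d = N - Suc m"
    by (metis Suc_diff_Suc Suc_le_lessD)
  have "fact (N - m) = Suc d * (fact d :: nat)" by (simp add: d(1))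
  also have "\<dots> \<le> N * (fact (N - Suc m) :: nat)"
    unfolding d(2)[symmetric] using d Suc.prems by (intro mult_right_mono) auto
  finally have le: "fact (N - m) \<le> N * (fact (N - Suc m) :: nat)" .
  have "fact N \<le> N ^ m * (fact (N - m) :: nat)" using Suc by simp
  also have "\<dots> \<le> N ^ m * (N * fact (N - Suc m))" using le by (rule mult_left_mono) simp
  also have "\<dots> = N ^ Suc m * fact (N - Suc m)" by simp
  finally show ?case .
qed simp

text \<open>There are \<open>card Q choose m\<close> subsets of size \<open>m\<close>, so each size contributes at most
  \<open>fact (card Q)\<close>.\<close>

lemma sum_fact_subsets_le:
  assumes "finite Q"
  shows "(\<Sum>M\<in>{M \<in> Pow Q. card M \<le> s}. fact (card Q - card M) * fact (card M)) \<le> (s + 1) * (fact (card Q) :: nat)"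
proof -
  let ?S = "{M \<in> Pow Q. card M \<le> s}"
  have "(\<Sum>M\<in>?S. fact (card Q - card M) * (fact (card M) :: nat))
      = (\<Sum>m\<in>{..s}. \<Sum>M\<in>{M \<in> ?S. card M = m}. fact (card Q - card M) * fact (card M))"
    using assms by (intro sum.group[symmetric]) auto
  also have "\<dots> \<le> (\<Sum>m\<in>{..s}. fact (card Q))"
  proof (rule sum_mono)
    fix m assume "m \<in> {..s}"
    then have "{M \<in> ?S. card M = m} = {M. M \<subseteq> Q \<and> card M = m}" by auto
    then have "(\<Sum>M\<in>{M \<in> ?S. card M = m}. fact (card Q - card M) * (fact (card M) :: nat))
        = (card Q choose m) * (fact (card Q - m) * fact m)"
      by (simp add: n_subsets[OF assms])
    also have "\<dots> \<le> fact (card Q)"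
    proof (cases "m \<le> card Q")
      case True
      then show ?thesis using binomial_fact_lemma[OF True] by (simp add: mult_ac)
    qed (simp add: binomial_eq_0)
    finally show "(\<Sum>M\<in>{M \<in> ?S. card M = m}. fact (card Q - card M) * (fact (card M) :: nat)) \<le> fact (card Q)" .
  qed
  finally show ?thesis by simp
qed

context line_system
begin

text \<open>Labels mark the samples that collide.  The unlabelled samples in \<open>H\<close> are then the elements that a
  round adds if \<open>H\<close> is the set of available elements.\<close>

definition kept :: "'e set \<Rightarrow> (bool \<times> 'e) list \<Rightarrow> 'e list" where
  "kept H z = filter (\<lambda>e. e \<in> H) (map snd (filter (\<lambda>p. \<not> fst p) z))"

definition flags :: "(bool \<times> 'e) list \<Rightarrow> nat" where
  "flags z = length (filter fst z)"

text \<open>Read a labelled word as a random experiment: a label costs the factor \<open>\<beta>\<close>, and producing the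
  next prescribed element of \<open>H\<close> is counted with weight \<open>card H\<close>, as if any element of \<open>H\<close> would
  do.  Then the weights of the three outcomes of one sample add up to \<open>(1 + \<beta>) * n\<^sup>2\<close>.\<close>

lemma sum_labelled_words:
  assumes H: "H \<subseteq> A" and b: "0 \<le> (\<beta>::real)"
  shows "(\<Sum>z\<in>words (UNIV \<times> A) t. if kept H z = \<sigma> then \<beta> ^ flags z else 0) * real (card H) ^ length \<sigma>
    \<le> ((1 + \<beta>) * real n ^ 2) ^ t"
proof (induction t arbitrary: \<sigma>)
  case 0
  then show ?case by (simp add: kept_def flags_def)
next
  case (Suc t)
  define G where "G \<sigma> = (\<Sum>z\<in>words (UNIV \<times> A) t. if kept H z = \<sigma> then \<beta> ^ flags z else 0)" for \<sigma>
  define X where "X = ((1 + \<beta>) * real n ^ 2) ^ t"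
  have IH: "G \<sigma> * real (card H) ^ length \<sigma> \<le> X" for \<sigma> using Suc.IH by (simp add: G_def X_def)
  have X0: "X \<ge> 0" using b by (simp add: X_def)
  have finH: "finite H" using H finite_A finite_subset by blast
  define F where "F p = (\<Sum>z\<in>words (UNIV \<times> A) t. if kept H (p # z) = \<sigma> then \<beta> ^ flags (p # z) else 0)" for p
  have FT: "F (True, e) = \<beta> * G \<sigma>" for e
    unfolding F_def G_def by (simp add: kept_def flags_def sum_distrib_left if_distrib cong: if_cong)
  have FF: "F (False, e) = G \<sigma>" if "e \<notin> H" for e
    unfolding F_def G_def using that by (simp add: kept_def flags_def cong: if_cong)
  have FH: "F (False, e) = (if \<sigma> \<noteq> [] \<and> hd \<sigma> = e then G (tl \<sigma>) else 0)" if "e \<in> H" for e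
  proof (cases \<sigma>)
    case Nil
    then show ?thesis unfolding F_def using that by (simp add: kept_def)
  next
    case (Cons a \<sigma>')
    then show ?thesis unfolding F_def G_def using that by (auto simp: kept_def flags_def cong: if_cong)
  qed
  have "(\<Sum>z\<in>words (UNIV \<times> A) (Suc t). if kept H z = \<sigma> then \<beta> ^ flags z else 0) = (\<Sum>p\<in>UNIV \<times> A. F p)"
    unfolding F_def by (subst sum_words_Suc) auto
  also have "\<dots> = (\<Sum>l\<in>(UNIV::bool set). \<Sum>e\<in>A. F (l, e))"
    by (simp add: sum.cartesian_product)
  also have "\<dots> = (\<Sum>e\<in>A. F (True, e)) + (\<Sum>e\<in>A. F (False, e))" by (simp add: UNIV_bool add.commute)
  also have "(\<Sum>e\<in>A. F (False, e)) = (\<Sum>e\<in>A - H. F (False, e)) + (\<Sum>e\<in>H. F (False, e))"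
    using H by (intro sum.subset_diff) auto
  also have "(\<Sum>e\<in>A - H. F (False, e)) = (real (card A) - card H) * G \<sigma>"
    using FF H finH card_mono[OF finite_A H] by (simp add: card_Diff_subset of_nat_diff)
  also have "(\<Sum>e\<in>A. F (True, e)) = card A * (\<beta> * G \<sigma>)" by (simp add: FT)
  finally have eq: "(\<Sum>z\<in>words (UNIV \<times> A) (Suc t). if kept H z = \<sigma> then \<beta> ^ flags z else 0)
      = (card A * \<beta> + (real (card A) - card H)) * G \<sigma> + (\<Sum>e\<in>H. F (False, e))"
    by (simp add: algebra_simps)
  have last: "(\<Sum>e\<in>H. F (False, e)) * real (card H) ^ length \<sigma> \<le> card H * X"
  proof (cases \<sigma>)
    case Nil
    then show ?thesis using FH X0 by simp
  next
    case (Cons a \<sigma>')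
    have "(\<Sum>e\<in>H. F (False, e)) = (\<Sum>e\<in>H. if a = e then G \<sigma>' else 0)"
      using FH Cons by (intro sum.cong) auto
    also have "\<dots> = (if a \<in> H then G \<sigma>' else 0)" using finH by (simp add: sum.delta')
    finally have "(\<Sum>e\<in>H. F (False, e)) * real (card H) ^ length \<sigma>
        = card H * ((if a \<in> H then G \<sigma>' else 0) * real (card H) ^ length \<sigma>')"
      using Cons by simp
    also have "\<dots> \<le> card H * X" using IH[of \<sigma>'] X0 by (intro mult_left_mono) auto
    finally show ?thesis .
  qed
  have "(card A * \<beta> + (real (card A) - card H)) * (G \<sigma> * real (card H) ^ length \<sigma>)
      \<le> (card A * \<beta> + (real (card A) - card H)) * X"
    using b card_mono[OF finite_A H] by (intro mult_left_mono IH) auto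
  then have "(\<Sum>z\<in>words (UNIV \<times> A) (Suc t). if kept H z = \<sigma> then \<beta> ^ flags z else 0) * real (card H) ^ length \<sigma>
     \<le> (card A * \<beta> + (real (card A) - card H)) * X + card H * X"
    unfolding eq using last by (simp add: algebra_simps)
  also have "\<dots> = ((1 + \<beta>) * real n ^ 2) ^ Suc t" by (simp add: X_def card_A algebra_simps)
  finally show ?case .
qed

definition label :: "'e list \<Rightarrow> (bool \<times> 'e) list" where
  "label r = map (\<lambda>i. (i \<notin> isolated_pos r, r ! i)) [0..<length r]"

lemma map_snd_label: "map snd (label r) = r"
  by (simp add: label_def comp_def map_nth)

lemma inj_on_label: "inj_on label R"
  by (metis inj_onI map_snd_label)

lemma label_words: "r \<in> words A t \<Longrightarrow> label r \<in> words (UNIV \<times> A) t"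
  by (auto simp: words_def label_def)

lemma flags_label: "flags (label r) = collisions r"
proof -
  have "flags (label r) = length (filter (\<lambda>i. i \<notin> isolated_pos r) [0..<length r])"
    by (simp add: flags_def label_def filter_map comp_def)
  also have "\<dots> = card (set (filter (\<lambda>i. i \<notin> isolated_pos r) [0..<length r]))"
    by (rule distinct_card[symmetric]) simp
  also have "set (filter (\<lambda>i. i \<notin> isolated_pos r) [0..<length r]) = {..<length r} - isolated_pos r" by auto
  finally show ?thesis by (simp add: collisions_def)
qed

lemma kept_label: "kept H (label r) \<in> permutations_of_set (isolated r \<inter> H)"
proof -
  have eq: "kept H (label r) = filter (\<lambda>e. e \<in> H) (map ((!) r) (filter (\<lambda>i. i \<in> isolated_pos r) [0..<length r]))"
    by (simp add: kept_def label_def filter_map comp_def)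
  have s: "set (filter (\<lambda>i. i \<in> isolated_pos r) [0..<length r]) = isolated_pos r"
    using isolated_pos_subset[of r] by auto
  have "distinct (map ((!) r) (filter (\<lambda>i. i \<in> isolated_pos r) [0..<length r]))"
    unfolding distinct_map s using inj_on_isolated_pos by simp
  moreover have "set (filter (\<lambda>e. e \<in> H) (map f xs)) = f ` set xs \<inter> H" for f :: "nat \<Rightarrow> 'e" and xs
    by auto
  ultimately show ?thesis
    unfolding eq permutations_of_set_def isolated_eq by (auto simp: s simp del: set_filter)
qed

text \<open>The added elements can appear in the word in \<open>fact (card M)\<close> orders.  For each order the labelled
  words are bounded by \<open>sum_labelled_words\<close>.\<close>

lemma sum_round_le:
  assumes H: "H \<subseteq> A" and b: "0 \<le> (\<beta>::real)" and M: "finite M"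
  shows "(\<Sum>r\<in>words A s. if isolated r \<inter> H = M then \<beta> ^ collisions r else 0) * real (card H) ^ card M
    \<le> fact (card M) * ((1 + \<beta>) * real n ^ 2) ^ s"
proof -
  let ?g = "\<lambda>\<sigma> z. if kept H z = \<sigma> then \<beta> ^ flags z else 0"
  have "(\<Sum>r\<in>words A s. if isolated r \<inter> H = M then \<beta> ^ collisions r else 0)
      \<le> (\<Sum>r\<in>words A s. \<Sum>\<sigma>\<in>permutations_of_set M. ?g \<sigma> (label r))"
  proof (rule sum_mono)
    fix r
    show "(if isolated r \<inter> H = M then \<beta> ^ collisions r else 0) \<le> (\<Sum>\<sigma>\<in>permutations_of_set M. ?g \<sigma> (label r))"
    proof (cases "isolated r \<inter> H = M")
      case True
      then have "kept H (label r) \<in> permutations_of_set M" using kept_label[of H r] by simp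
      then show ?thesis using True by (simp add: flags_label)
    qed (use b in \<open>auto intro!: sum_nonneg\<close>)
  qed
  also have "\<dots> = (\<Sum>\<sigma>\<in>permutations_of_set M. \<Sum>r\<in>words A s. ?g \<sigma> (label r))" by (rule sum.swap)
  also have "\<dots> \<le> (\<Sum>\<sigma>\<in>permutations_of_set M. \<Sum>z\<in>words (UNIV \<times> A) s. ?g \<sigma> z)"
  proof (rule sum_mono)
    fix \<sigma>
    have "(\<Sum>r\<in>words A s. ?g \<sigma> (label r)) = (\<Sum>z\<in>label ` words A s. ?g \<sigma> z)"
      by (simp add: sum.reindex[OF inj_on_label])
    also have "\<dots> \<le> (\<Sum>z\<in>words (UNIV \<times> A) s. ?g \<sigma> z)"
      using b label_words by (intro sum_mono2) auto
    finally show "(\<Sum>r\<in>words A s. ?g \<sigma> (label r)) \<le> (\<Sum>z\<in>words (UNIV \<times> A) s. ?g \<sigma> z)" .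
  qed
  finally have "(\<Sum>r\<in>words A s. if isolated r \<inter> H = M then \<beta> ^ collisions r else 0) * real (card H) ^ card M
      \<le> (\<Sum>\<sigma>\<in>permutations_of_set M. \<Sum>z\<in>words (UNIV \<times> A) s. ?g \<sigma> z) * real (card H) ^ card M"
    by (rule mult_right_mono) simp
  also have "\<dots> = (\<Sum>\<sigma>\<in>permutations_of_set M. (\<Sum>z\<in>words (UNIV \<times> A) s. ?g \<sigma> z) * real (card H) ^ length \<sigma>)"
    unfolding sum_distrib_right by (intro sum.cong refl) (simp add: length_finite_permutations_of_set)
  also have "\<dots> \<le> (\<Sum>\<sigma>\<in>permutations_of_set M. ((1 + \<beta>) * real n ^ 2) ^ s)"
    by (intro sum_mono sum_labelled_words H b)
  also have "\<dots> = fact (card M) * ((1 + \<beta>) * real n ^ 2) ^ s" using M by simp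
  finally show ?thesis .
qed

text \<open>For \<open>c = n\<^sup>2\<close> this is the number of available elements that independence of the lines would
  give.\<close>

definition rich :: "real \<Rightarrow> 'e set \<Rightarrow> bool" where
  "rich c Q \<longleftrightarrow> (real n - card Q) ^ 4 \<le> c * card (avail Q)"

text \<open>Runs are weighted rather than counted, so that the collisions of all rounds are bounded together
  only at the end, by Markov's inequality.\<close>

definition run_weight :: "real \<Rightarrow> real \<Rightarrow> nat \<Rightarrow> nat \<Rightarrow> 'e list \<Rightarrow> real" where
  "run_weight c \<beta> s j w =
     (if \<forall>i<j. rich c (proc s i w) then \<beta> ^ (\<Sum>i<j. collisions (chunk s i w)) else 0)"

lemma run_weight_nonneg: "\<beta> \<ge> 0 \<Longrightarrow> run_weight c \<beta> s j w \<ge> 0"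
  by (simp add: run_weight_def)

lemma run_weight_append:
  "length u = j * s \<Longrightarrow> run_weight c \<beta> s j (u @ v) = run_weight c \<beta> s j u"
proof -
  assume u: "length u = j * s"
  have p: "proc s i (u @ v) = proc s i u" if "i < j" for i
    using that by (intro proc_append) (simp add: u)
  have "chunk s i (u @ v) = chunk s i u" if "i < j" for i
    using that by (intro chunk_append) (simp add: u, metis Suc_leI mult_le_mono1 mult_Suc)
  then show ?thesis using p by (simp add: run_weight_def cong: if_cong)
qed

lemma run_weight_Suc:
  assumes "length u = j * s" "length r = s"
  shows "run_weight c \<beta> s (Suc j) (u @ r)
    = (if rich c (proc s j u) then run_weight c \<beta> s j u * \<beta> ^ collisions r else 0)"
proof -
  have p: "proc s i (u @ r) = proc s i u" if "i \<le> j" for i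
    using that assms by (intro proc_append) simp
  have c: "chunk s i (u @ r) = chunk s i u" if "i < j" for i
    using that by (intro chunk_append) (simp add: assms, metis Suc_leI mult_le_mono1 mult_Suc)
  have cj: "chunk s j (u @ r) = r" using chunk_middle[of u j s r "[]"] assms by simp
  have all: "(\<forall>i<Suc j. rich c (proc s i (u @ r))) \<longleftrightarrow> rich c (proc s j u) \<and> (\<forall>i<j. rich c (proc s i u))"
    using p by (auto simp: less_Suc_eq)
  have col: "(\<Sum>i<Suc j. collisions (chunk s i (u @ r))) = (\<Sum>i<j. collisions (chunk s i u)) + collisions r"
    using c cj by simp
  show ?thesis unfolding run_weight_def all col power_add by auto
qed

text \<open>By induction over the rounds.  The set \<open>M\<close> that the last round adds costs the factor
  \<open>fact (card M) / card (avail (Q - M)) ^ card M\<close>.  Since \<open>Q - M\<close> is rich and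
  \<open>N ^ m \<ge> fact N / fact (N - m)\<close> for the \<open>N\<close> uncovered lines, the denominators telescope to a
  quotient of factorials, and summing over \<open>M\<close> turns the factorials of the parts into that of the
  whole.\<close>

lemma sum_run_weight_le:
  assumes b: "0 \<le> \<beta>" and c: "c > 0" and Q: "matching Q"
  shows "(\<Sum>w\<in>words A (j * s). if proc s j w = Q then run_weight c \<beta> s j w else 0)
    \<le> ((1 + \<beta>) * real n ^ 2) ^ (j * s) * real (s + 1) ^ j * fact (card Q) * c ^ card Q
       * (fact (n - card Q) / fact n) ^ 4"
  using Q
proof (induction j arbitrary: Q)
  case 0
  show ?case using c by (auto simp: run_weight_def)
next
  case (Suc j)
  let ?X = "((1 + \<beta>) * real n ^ 2) ^ s"
  let ?Y = "((1 + \<beta>) * real n ^ 2) ^ (j * s) * real (s + 1) ^ j"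
  let ?I = "{M \<in> Pow Q. card M \<le> s}"
  define Wt where "Wt P = (\<Sum>u\<in>words A (j * s). if proc s j u = P then run_weight c \<beta> s j u else 0)" for P
  define R where "R H M = (\<Sum>r\<in>words A s. if isolated r \<inter> H = M then \<beta> ^ collisions r else 0)" for H M
  have Wt0: "Wt P \<ge> 0" for P unfolding Wt_def using run_weight_nonneg[OF b] by (auto intro: sum_nonneg)
  have R0: "R H M \<ge> 0" for H M unfolding R_def using b by (auto intro: sum_nonneg)
  have finQ: "finite Q" using Suc.prems matching_finite by blast
  have finI: "finite ?I" using finQ by simp
  let ?f = "\<lambda>u r M. (if proc s j u = Q - M then run_weight c \<beta> s j u else 0) *
      (if isolated r \<inter> avail (Q - M) = M then \<beta> ^ collisions r else 0)"
  have run_term: "(if proc s (Suc j) (u @ r) = Q then run_weight c \<beta> s (Suc j) (u @ r) else 0)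
      \<le> (\<Sum>M\<in>?I. if rich c (Q - M) then ?f u r M else 0)" (is "?l \<le> ?r")
    if u: "u \<in> words A (j * s)" and r: "r \<in> words A s" for u r
  proof -
    have len: "length u = j * s" "length r = s" using u r by (auto simp: words_def)
    have r0: "?r \<ge> 0" using b run_weight_nonneg[OF b] by (intro sum_nonneg) auto
    define P where "P = proc s j u"
    define M where "M = isolated r \<inter> avail P"
    have st: "proc s (Suc j) (u @ r) = P \<union> M"
      using chunk_middle[of u j s r "[]"] proc_append[of j s u r] len by (simp add: step_def P_def M_def)
    show ?thesis
    proof (cases "P \<union> M = Q \<and> rich c P")
      case True
      have "P \<inter> M = {}" by (auto simp: M_def avail_def)
      then have PM: "Q - M = P" using True by blast
      have "card M \<le> card (isolated r)" unfolding M_def isolated_eq by (intro card_mono) auto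
      then have "card M \<le> s" using len by (simp add: card_isolated)
      then have MI: "M \<in> ?I" using True by auto
      have "?l = (if rich c (Q - M) then ?f u r M else 0)"
        using True run_weight_Suc[OF len, of c \<beta>] st PM by (simp add: P_def[symmetric] M_def[symmetric])
      also have "\<dots> \<le> ?r"
        using b run_weight_nonneg[OF b]
        by (intro member_le_sum[OF MI, of "\<lambda>M. if rich c (Q - M) then ?f u r M else 0"] finI) auto
      finally show ?thesis .
    next
      case False
      then have "?l = 0" using run_weight_Suc[OF len, of c \<beta>] st by (auto simp: P_def)
      then show ?thesis using r0 by simp
    qed
  qed
  have one: "(if rich c (Q - M) then Wt (Q - M) * R (avail (Q - M)) M else 0)
      \<le> ?Y * ?X * c ^ card Q * (fact (n - card Q) / fact n) ^ 4 * real (fact (card Q - card M) * fact (card M))"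
    if M: "M \<in> ?I" for M
  proof (cases "rich c (Q - M)")
    case True
    define P where "P = Q - M"
    define N m where "N = n - card P" and "m = card M"
    let ?H = "real (card (avail P))"
    have P: "matching P" using Suc.prems matching_subset by (auto simp: P_def)
    have finM: "finite M" using M finQ finite_subset by auto
    have cQ: "card Q = card P + m" "m \<le> card Q"
      using M finQ finM card_mono[of Q M] by (auto simp: P_def m_def card_Diff_subset)
    have cP: "card P = card Q - m" using cQ by simp
    have Qn: "card Q \<le> n" by (rule card_matching_le[OF Suc.prems])
    have mN: "m \<le> N" "N - m = n - card Q" using cQ Qn by (auto simp: N_def)
    have Nr: "real N = real n - card P" using cQ Qn by (simp add: N_def of_nat_diff)
    define a where "a = c ^ m * (fact (N - m) / fact N) ^ 4"
    have a0: "a \<ge> 0" using c by (simp add: a_def)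
    have "real N ^ 4 \<le> c * ?H" using True Nr by (simp add: rich_def P_def)
    then have NH: "(real N ^ 4) ^ m \<le> (c * ?H) ^ m" by (rule power_mono) simp
    have "real (fact N) \<le> real (N ^ m * fact (N - m))"
      using fact_le_power_mult_fact[OF mN(1)] by (simp only: of_nat_le_iff)
    then have "1 \<le> real N ^ m * (fact (N - m) / fact N)" by (simp add: field_simps)
    then have "1 \<le> (real N ^ m * (fact (N - m) / fact N)) ^ 4" by (rule one_le_power)
    also have "\<dots> = (real N ^ 4) ^ m * (fact (N - m) / fact N) ^ 4"
      unfolding power_mult_distrib by (simp only: power_mult[symmetric] mult.commute)
    also have "\<dots> \<le> (c * ?H) ^ m * (fact (N - m) / fact N) ^ 4"
      using NH by (intro mult_right_mono) auto
    finally have aH: "1 \<le> ?H ^ m * a" by (simp add: a_def power_mult_distrib mult_ac)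
    have "R (avail P) M * 1 \<le> R (avail P) M * (?H ^ m * a)"
      using aH R0 by (rule mult_left_mono)
    also have "\<dots> = (R (avail P) M * ?H ^ m) * a" by simp
    also have "\<dots> \<le> (fact m * ?X) * a"
      using sum_round_le[OF avail_subset b finM] a0 unfolding R_def m_def by (intro mult_right_mono) auto
    finally have R: "R (avail P) M \<le> fact m * ?X * a" by simp
    have "Wt P * R (avail P) M \<le> (?Y * fact (card P) * c ^ card P * (fact (n - card P) / fact n) ^ 4) * (fact m * ?X * a)"
      using Suc.IH[OF P] R Wt0 R0 unfolding Wt_def[symmetric] by (intro mult_mono) (auto intro: order_trans)
    also have "\<dots> = ?Y * ?X * (c ^ card P * c ^ m) * ((fact N / fact n) * (fact (N - m) / fact N)) ^ 4 * (fact (card P) * fact m)"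
      by (simp only: a_def N_def[symmetric] power_mult_distrib mult_ac)
    also have "c ^ card P * c ^ m = c ^ card Q" using cQ by (simp add: power_add)
    also have "(fact N / fact n) * (fact (N - m) / fact N) = (fact (n - card Q) / fact n :: real)"
      using mN by simp
    finally show ?thesis using True by (simp add: P_def[symmetric] m_def[symmetric] cP)
  next
    case False
    then show ?thesis using b c by simp
  qed
  have "(\<Sum>w\<in>words A (Suc j * s). if proc s (Suc j) w = Q then run_weight c \<beta> s (Suc j) w else 0)
      = (\<Sum>u\<in>words A (j * s). \<Sum>r\<in>words A s. if proc s (Suc j) (u @ r) = Q then run_weight c \<beta> s (Suc j) (u @ r) else 0)"
    using sum_words_append[OF finite_A, of _ "j * s" s] by (simp add: add.commute)
  also have "\<dots> \<le> (\<Sum>u\<in>words A (j * s). \<Sum>r\<in>words A s. \<Sum>M\<in>?I. if rich c (Q - M) then ?f u r M else 0)"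
    by (intro sum_mono run_term)
  also have "\<dots> = (\<Sum>M\<in>?I. \<Sum>u\<in>words A (j * s). \<Sum>r\<in>words A s. if rich c (Q - M) then ?f u r M else 0)"
    by (subst (2) sum.swap) (subst sum.swap, rule refl)
  also have "\<dots> = (\<Sum>M\<in>?I. if rich c (Q - M) then Wt (Q - M) * R (avail (Q - M)) M else 0)"
    unfolding Wt_def R_def sum_product by (intro sum.cong refl) simp
  also have "\<dots> \<le> (\<Sum>M\<in>?I. ?Y * ?X * c ^ card Q * (fact (n - card Q) / fact n) ^ 4 * real (fact (card Q - card M) * fact (card M)))"
    by (intro sum_mono one)
  also have "\<dots> = ?Y * ?X * c ^ card Q * (fact (n - card Q) / fact n) ^ 4 * real (\<Sum>M\<in>?I. fact (card Q - card M) * fact (card M))"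
    by (simp add: sum_distrib_left)
  also have "\<dots> \<le> ?Y * ?X * c ^ card Q * (fact (n - card Q) / fact n) ^ 4 * real ((s + 1) * fact (card Q))"
    using b c sum_fact_subsets_le[OF finQ, of s] by (intro mult_left_mono) (simp_all only: of_nat_le_iff, auto)
  also have "\<dots> = ((1 + \<beta>) * real n ^ 2) ^ (Suc j * s) * real (s + 1) ^ Suc j * fact (card Q) * c ^ card Q
       * (fact (n - card Q) / fact n) ^ 4"
    by (simp only: mult_Suc power_add) (simp only: power_Suc of_nat_mult of_nat_fact mult_ac)
  finally show ?case .
qed

lemma card_runs_le:
  assumes b: "0 < \<beta>" "\<beta> \<le> 1" and c: "c > 0" and Q: "matching Q" and K: "K \<le> L"
    and G: "G \<subseteq> words A (L * s)"
    and run: "\<And>w. w \<in> G \<Longrightarrow> proc s K w = Q" "\<And>w i. w \<in> G \<Longrightarrow> i < K \<Longrightarrow> rich c (proc s i w)"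
    and col: "\<And>w. w \<in> G \<Longrightarrow> real (\<Sum>i<K. collisions (chunk s i w)) \<le> k"
  shows "card G * \<beta> powr k \<le> card (words A (L * s)) * ((1 + \<beta>) ^ (K * s) * real (s + 1) ^ K * fact (card Q) * c ^ card Q
       * (fact (n - card Q) / fact n) ^ 4)"
proof -
  let ?g = "\<lambda>w. if proc s K w = Q then run_weight c \<beta> s K w else 0"
  have LK: "L * s = K * s + (L - K) * s" using K by (simp flip: add_mult_distrib)
  have "card G * \<beta> powr k = (\<Sum>w\<in>G. \<beta> powr k)" by simp
  also have "\<dots> \<le> (\<Sum>w\<in>G. ?g w)"
  proof (rule sum_mono)
    fix w assume w: "w \<in> G"
    have "\<beta> powr k \<le> \<beta> powr real (\<Sum>i<K. collisions (chunk s i w))"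
      using b col[OF w] by (intro powr_mono') auto
    also have "\<dots> = ?g w" using b run w by (simp add: run_weight_def powr_realpow del: of_nat_sum)
    finally show "\<beta> powr k \<le> ?g w" .
  qed
  also have "\<dots> \<le> (\<Sum>w\<in>words A (L * s). ?g w)"
    using G b run_weight_nonneg[of \<beta>] by (intro sum_mono2) auto
  also have "\<dots> = (\<Sum>u\<in>words A (K * s). \<Sum>v\<in>words A ((L - K) * s). ?g (u @ v))"
    unfolding LK by (rule sum_words_append[OF finite_A])
  also have "\<dots> = (\<Sum>u\<in>words A (K * s). \<Sum>v\<in>words A ((L - K) * s). ?g u)"
    by (intro sum.cong refl) (simp add: words_def proc_append run_weight_append)
  also have "\<dots> = card (words A ((L - K) * s)) * (\<Sum>u\<in>words A (K * s). ?g u)"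
    by (simp add: sum_distrib_left)
  also have "\<dots> \<le> card (words A ((L - K) * s)) * (((1 + \<beta>) * real n ^ 2) ^ (K * s) * real (s + 1) ^ K * fact (card Q) * c ^ card Q
       * (fact (n - card Q) / fact n) ^ 4)"
    using b c Q by (intro mult_left_mono sum_run_weight_le) auto
  also have "card (words A ((L - K) * s)) * (((1 + \<beta>) * real n ^ 2) ^ (K * s) * real (s + 1) ^ K * fact (card Q) * c ^ card Q
       * (fact (n - card Q) / fact n) ^ 4)
    = (card (words A ((L - K) * s)) * (real n ^ 2) ^ (K * s)) * ((1 + \<beta>) ^ (K * s) * real (s + 1) ^ K * fact (card Q) * c ^ card Q
       * (fact (n - card Q) / fact n) ^ 4)"
    by (simp only: power_mult_distrib mult_ac)
  also have "card (words A ((L - K) * s)) * (real n ^ 2) ^ (K * s) = card (words A (L * s))"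
    unfolding LK by (simp add: card_words_A add_mult_distrib2 power_add mult.commute flip: power_mult)
  finally show ?thesis .
qed

end

section \<open>Many large matchings\<close>

context line_system
begin

lemma proc_mono: "i \<le> j \<Longrightarrow> proc s i w \<subseteq> proc s j w"
proof (induction j)
  case (Suc j)
  then show ?case by (cases "i = Suc j") (auto simp: step_def le_Suc_eq)
qed simp

lemma proc_subset_take: "proc s j w \<subseteq> set (take (j * s) w)"
proof (induction j)
  case (Suc j)
  have "set (chunk s j w) \<subseteq> set (take (Suc j * s) w)"
  proof -
    have "take (Suc j * s) w = take (j * s) w @ chunk s j w"
    proof -
      have "Suc j * s = j * s + s" by simp
      then show ?thesis by (simp only: take_add chunk_def)
    qed
    then show ?thesis by simp
  qed
  moreover have "set (take (j * s) w) \<subseteq> set (take (Suc j * s) w)"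
    by (rule set_take_subset_set_take) simp
  ultimately show ?case using Suc isolated_subset[of "chunk s j w"] by (auto simp: step_def)
qed simp

text \<open>A sample that meets no other sample of the first \<open>J\<close> rounds is isolated in its own round, and no
  earlier queen can have made it unavailable.  This gives control over a part of the final matching in
  terms of independent samples alone.\<close>

lemma isolated_prefix_subset_proc:
  assumes w: "length w \<ge> K * s" "set w \<subseteq> A" and J: "J \<le> K"
  shows "isolated (take (J * s) w) \<subseteq> proc s K w"
proof
  fix e assume "e \<in> isolated (take (J * s) w)"
  moreover have Jw: "J * s \<le> length w" using w(1) J by (meson le_trans mult_le_mono1)
  ultimately obtain i where i: "i < J * s" "e = w ! i"
    and iso: "\<And>i'. i' < J * s \<Longrightarrow> i' \<noteq> i \<Longrightarrow> \<not> meets (w ! i) (w ! i')"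
    by (auto simp: isolated_def min_absorb2)
  have s: "s > 0" using i(1) by (cases s) auto
  have eA: "e \<in> A" using w(2) i Jw by (auto simp: subset_iff)
  define j p where "j = i div s" and "p = i mod s"
  have ij: "i = j * s + p" "p < s" using s by (simp_all add: j_def p_def)
  have jJ: "j < J" using i(1) s by (simp add: j_def less_mult_imp_div_less)
  then have js: "j * s + s \<le> J * s" by (metis Suc_leI add.commute mult_Suc mult_le_mono1)
  have len: "length (chunk s j w) = s" using js Jw by (simp add: chunk_def)
  have nth: "chunk s j w ! q = w ! (j * s + q)" if "q < s" for q
    using that js Jw by (simp add: chunk_def)
  have "e \<in> isolated (chunk s j w)"
  proof -
    have "\<not> meets (chunk s j w ! p) (chunk s j w ! q)" if "q < s" "q \<noteq> p" for q
      using iso[of "j * s + q"] that nth ij js by simp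
    then have "chunk s j w ! p \<in> isolated (chunk s j w)"
      unfolding isolated_eq using ij(2) len by (intro imageI) (simp add: isolated_pos_def)
    then show ?thesis using nth[OF ij(2)] i(2) ij(1) by simp
  qed
  moreover have "e \<in> avail (proc s j w)"
  proof -
    have "\<not> meets q e" if "q \<in> proc s j w" for q
    proof -
      have "q \<in> set (take (j * s) w)" using that proc_subset_take by blast
      then obtain i' where i': "i' < j * s" "q = w ! i'" by (auto simp: in_set_conv_nth)
      then have "\<not> meets (w ! i) (w ! i')" using iso[of i'] ij js by simp
      then show ?thesis using i' i(2) by (simp add: meets_sym)
    qed
    then show ?thesis using eA by (simp add: avail_def)
  qed
  ultimately show "e \<in> proc s K w"
    using eA proc_mono[of "Suc j" K s w] jJ J by (auto simp: step_def)
qed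

end

context nibble
begin

text \<open>At least half of all runs are regular, have few collisions, and satisfy the additional property
  \<open>good\<close> of the samples of the first \<open>J\<close> rounds.  Many of them miss the same number \<open>u\<close> of queens, and
  since \<open>card_runs_le\<close> limits the number of runs to each matching, there are many matchings.\<close>

theorem many_matchings:
  fixes \<beta> :: real and good :: "'a set \<Rightarrow> bool"
  assumes b: "0 < \<beta>" "\<beta> \<le> 1" and J: "4 * J * s \<le> n"
    and good: "card {w \<in> words A (L * s). \<not> good (isolated (take (J * s) w))} \<le> card (words A (L * s)) / 8"
  defines "k \<equiv> 16 * L * (real s)\<^sup>2 / n" and "c \<equiv> (real n)\<^sup>2 / (1 - L * \<xi>)"
  obtains u S where "u \<le> n" "real u \<le> 3 * \<nu> * n"
    "\<And>Q. Q \<in> S \<Longrightarrow> matching Q \<and> card Q = n - u \<and> (\<exists>P\<subseteq>Q. good P)"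
    "\<beta> powr k \<le> card S * (2 * (n + 1) * (1 + \<beta>) ^ (L * s) * real (s + 1) ^ L * fact (n - u) * c ^ (n - u)
        * (fact u / fact n) ^ 4)"
proof -
  let ?W = "words A (L * s)"
  obtain K where K: "K \<le> L" "n - mean_size (L * s) s K \<le> 2 * \<nu> * n"
    "\<And>j. j < K \<Longrightarrow> n - mean_size (L * s) s j > 2 * \<nu> * n"
    using exists_stopping_round by metis
  define col where "col w = real (\<Sum>i<K. collisions (chunk s i w))" for w
  have c: "c > 0" using L_xi n_pos by (simp add: c_def)
  have colbad: "card {w \<in> ?W. col w > k} \<le> card ?W / 4"
  proof -
    have "(\<Sum>w\<in>?W. col w) = (\<Sum>i<K. \<Sum>w\<in>?W. real (collisions (chunk s i w)))"
      unfolding col_def of_nat_sum by (rule sum.swap)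
    also have "\<dots> \<le> (\<Sum>i<K. 4 * real s ^ 2 / n * card ?W)"
      using K(1) by (intro sum_mono sum_collisions_chunk_le mult_right_mono) auto
    also have "\<dots> = K * (4 * real s ^ 2 / n * card ?W)" by simp
    also have "\<dots> \<le> L * (4 * real s ^ 2 / n * card ?W)"
      using K(1) by (intro mult_right_mono) auto
    also have "\<dots> = k * (card ?W / 4)" by (simp add: k_def)
    finally have up: "(\<Sum>w\<in>?W. col w) \<le> k * (card ?W / 4)" .
    have "k > 0" using L_pos s_pos n_pos by (simp add: k_def)
    have "k * card {w \<in> ?W. col w > k} = (\<Sum>w\<in>{w \<in> ?W. col w > k}. k)" by simp
    also have "\<dots> \<le> (\<Sum>w\<in>{w \<in> ?W. col w > k}. col w)" by (intro sum_mono) auto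
    also have "\<dots> \<le> (\<Sum>w\<in>?W. col w)" by (intro sum_mono2) (auto simp: col_def intro!: sum_nonneg)
    finally show ?thesis using up \<open>k > 0\<close> by (meson mult_le_cancel_left_pos order_trans)
  qed
  define G where "G = {w \<in> ?W. regular w \<and> col w \<le> k \<and> good (isolated (take (J * s) w))}"
  have GW: "G \<subseteq> ?W" by (auto simp: G_def)
  have finG: "finite G" using GW by (rule finite_subset) simp
  have cardG: "card ?W / 2 \<le> card G"
  proof -
    have "?W \<subseteq> G \<union> {w \<in> ?W. \<not> regular w} \<union> {w \<in> ?W. col w > k} \<union> {w \<in> ?W. \<not> good (isolated (take (J * s) w))}"
      by (auto simp: G_def)
    then have "card ?W \<le> card (G \<union> {w \<in> ?W. \<not> regular w} \<union> {w \<in> ?W. col w > k} \<union> {w \<in> ?W. \<not> good (isolated (take (J * s) w))})"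
      using finG by (intro card_mono) auto
    also have "\<dots> \<le> card G + card {w \<in> ?W. \<not> regular w} + card {w \<in> ?W. col w > k}
        + card {w \<in> ?W. \<not> good (isolated (take (J * s) w))}"
      by (intro order_trans[OF card_Un_le] add_mono card_Un_le le_refl)
    finally show ?thesis using card_not_regular colbad good by linarith
  qed
  have size: "real n - card (proc s K w) \<le> 3 * \<nu> * n" if "w \<in> G" for w
  proof -
    have "\<bar>real (card (proc s K w)) - mean_size (L * s) s K\<bar> < \<delta> * n"
      using that K(1) by (auto simp: G_def regular_def)
    moreover have "\<delta> * n \<le> \<nu> * n" using dl by (simp add: mult_right_mono)
    ultimately show ?thesis using K(2) by (auto simp: abs_less_iff)
  qed
  have mat: "matching (proc s K w)" if "w \<in> G" for w
    using that GW by (intro matching_proc) (auto simp: words_def)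
  have JK: "J \<le> K"
  proof -
    have "G \<noteq> {}" using cardG card_words_A_pos[of "L * s"] by auto
    then obtain w where w: "w \<in> G" by blast
    have "card (proc s K w) \<le> card (set (take (K * s) w))"
      by (intro card_mono proc_subset_take) simp
    also have "\<dots> \<le> K * s" by (metis card_length le_trans length_take min.cobounded2)
    finally have "real (card (proc s K w)) \<le> K * s" by (simp only: of_nat_le_iff)
    moreover have "3 * \<nu> * n \<le> 3 / 4 * n" using nu by (intro mult_right_mono) auto
    ultimately have "real n / 4 \<le> real (K * s)" using size[OF w] by linarith
    moreover have "4 * real (J * s) \<le> n"
    proof -
      have "real (4 * (J * s)) \<le> real n" using J by (intro of_nat_mono) (simp add: mult.assoc)
      then show ?thesis by simp
    qed
    ultimately have "real (J * s) \<le> real (K * s)" by linarith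
    then show ?thesis using s_pos by simp
  qed
  have rich: "rich c (proc s i w)" if w: "w \<in> G" and i: "i < K" for w i
  proof -
    let ?N = "(real n - card (proc s i w)) ^ 4"
    have "(1 - L * \<xi>) * ?N \<le> (1 - i * \<xi>) * ?N"
    proof (rule mult_right_mono)
      have "i * \<xi> \<le> L * \<xi>" using i K(1) xi_nonneg by (intro mult_right_mono) auto
      then show "1 - L * \<xi> \<le> 1 - i * \<xi>" by simp
    qed simp
    also have "\<dots> \<le> real n ^ 2 * card (avail (proc s i w))"
      using w i by (intro avail_lower(1)[OF _ _ K(1,3)]) (auto simp: G_def)
    finally show ?thesis using L_xi by (simp add: rich_def c_def field_simps)
  qed
  \<comment> \<open>pigeonhole principle for the number of uncovered lines\<close>
  define B where "B u = {w \<in> G. card (proc s K w) = n - u}" for u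
  have "\<exists>u\<le>n. card G \<le> (n + 1) * card (B u) \<and> B u \<noteq> {}"
  proof (rule ccontr)
    assume neg: "\<not> ?thesis"
    have G0: "card G > 0" using cardG card_words_A_pos[of "L * s"] by linarith
    have lt': "(n + 1) * card (B u) < card G" if u: "u \<le> n" for u
    proof (cases "B u = {}")
      case True
      then show ?thesis using G0 by simp
    next
      case False
      then have "\<not> card G \<le> (n + 1) * card (B u)" using neg u by blast
      then show ?thesis by simp
    qed
    have "G = (\<Union>u\<le>n. B u)"
    proof (intro equalityI subsetI)
      fix w assume w: "w \<in> G"
      then have "w \<in> B (n - card (proc s K w))" using card_matching_le[OF mat[OF w]] by (simp add: B_def)
      then show "w \<in> (\<Union>u\<le>n. B u)" by auto
    qed (auto simp: B_def)
    then have "card G \<le> (\<Sum>u\<le>n. card (B u))" by (metis card_UN_le finite_atMost)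
    then have "(n + 1) * card G \<le> (\<Sum>u\<le>n. (n + 1) * card (B u))"
      unfolding sum_distrib_left[symmetric] by (rule mult_left_mono) simp
    also have "\<dots> < (\<Sum>u\<le>n. card G)" using lt' by (intro sum_strict_mono) auto
    finally show False by simp
  qed
  then obtain u where u: "u \<le> n" "card G \<le> (n + 1) * card (B u)" "B u \<noteq> {}" by blast
  define S where "S = proc s K ` B u"
  have finB: "finite (B u)" using finG by (simp add: B_def)
  have BG: "B u \<subseteq> G" by (auto simp: B_def)
  let ?F = "(1 + \<beta>) ^ (K * s) * real (s + 1) ^ K * fact (n - u) * c ^ (n - u) * (fact u / fact n) ^ 4"
  have fib: "card {w \<in> B u. proc s K w = Q} * \<beta> powr k \<le> card ?W * ?F" if Q: "Q \<in> S" for Q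
  proof -
    obtain w0 where w0: "w0 \<in> B u" "Q = proc s K w0" using Q by (auto simp: S_def)
    have cQ: "card Q = n - u" using w0 by (simp add: B_def)
    have mQ: "matching Q" using mat w0 BG by auto
    have "card {w \<in> B u. proc s K w = Q} * \<beta> powr k \<le> card ?W *
       ((1 + \<beta>) ^ (K * s) * real (s + 1) ^ K * fact (card Q) * c ^ card Q * (fact (n - card Q) / fact n) ^ 4)"
    proof (rule card_runs_le[OF b c mQ K(1)])
      show "{w \<in> B u. proc s K w = Q} \<subseteq> ?W" using BG GW by auto
      show "rich c (proc s i w)" if "w \<in> {w \<in> B u. proc s K w = Q}" "i < K" for w i
        using rich that BG by auto
      show "real (\<Sum>i<K. collisions (chunk s i w)) \<le> k" if "w \<in> {w \<in> B u. proc s K w = Q}" for w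
        using that BG by (auto simp: G_def col_def)
    qed auto
    then show ?thesis using cQ u(1) by simp
  qed
  have finS: "finite S" using finB by (simp add: S_def)
  have fibres: "(\<Union>Q\<in>S. {w \<in> B u. proc s K w = Q}) = B u" by (auto simp: S_def)
  have "card (B u) \<le> (\<Sum>Q\<in>S. card {w \<in> B u. proc s K w = Q})"
    using card_UN_le[OF finS, of "\<lambda>Q. {w \<in> B u. proc s K w = Q}"] unfolding fibres .
  then have "card (B u) * \<beta> powr k \<le> real (\<Sum>Q\<in>S. card {w \<in> B u. proc s K w = Q}) * \<beta> powr k"
    by (intro mult_right_mono) (simp_all only: of_nat_le_iff powr_ge_zero)
  also have "\<dots> = (\<Sum>Q\<in>S. card {w \<in> B u. proc s K w = Q} * \<beta> powr k)"
    by (simp add: sum_distrib_right)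
  also have "\<dots> \<le> (\<Sum>Q\<in>S. card ?W * ?F)" by (intro sum_mono fib)
  finally have BS: "card (B u) * \<beta> powr k \<le> card S * (card ?W * ?F)" by simp
  have FK: "?F \<le> (1 + \<beta>) ^ (L * s) * real (s + 1) ^ L * fact (n - u) * c ^ (n - u) * (fact u / fact n) ^ 4" (is "_ \<le> ?F'")
  proof -
    have "(1 + \<beta>) ^ (K * s) \<le> (1 + \<beta>) ^ (L * s)"
      using b K(1) by (intro power_increasing mult_right_mono) auto
    moreover have "real (s + 1) ^ K \<le> real (s + 1) ^ L" using K(1) by (intro power_increasing) auto
    ultimately show ?thesis using b c by (intro mult_right_mono mult_mono) auto
  qed
  have "card ?W / 2 * \<beta> powr k \<le> card G * \<beta> powr k" using cardG by (rule mult_right_mono) simp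
  also have "\<dots> \<le> real ((n + 1) * card (B u)) * \<beta> powr k"
    using u(2) by (intro mult_right_mono) (simp_all only: of_nat_le_iff powr_ge_zero)
  also have "\<dots> = (n + 1) * (card (B u) * \<beta> powr k)" by (simp add: algebra_simps)
  also have "\<dots> \<le> (n + 1) * (card S * (card ?W * ?F))" using BS by (intro mult_left_mono) auto
  also have "\<dots> \<le> (n + 1) * (card S * (card ?W * ?F'))" using FK by (intro mult_left_mono) auto
  finally have "card ?W * (\<beta> powr k) \<le> card ?W * (card S * (2 * (n + 1) * ?F'))"
    by (simp add: field_simps)
  then have main: "\<beta> powr k \<le> card S * (2 * (n + 1) * ?F')"
    using card_words_A_pos[of "L * s"] by (simp add: mult_le_cancel_left_pos)
  show ?thesis
  proof (rule that[of u S])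
    show "u \<le> n" by fact
    obtain w where "w \<in> B u" using u(3) by blast
    then show "real u \<le> 3 * \<nu> * n" using size[of w] BG u(1) by (auto simp: B_def of_nat_diff)
    show "matching Q \<and> card Q = n - u \<and> (\<exists>P\<subseteq>Q. good P)" if Q: "Q \<in> S" for Q
    proof -
      obtain w where w: "w \<in> B u" "Q = proc s K w" using Q by (auto simp: S_def)
      then have wG: "w \<in> G" using BG by blast
      then have "length w = L * s" "set w \<subseteq> A" using GW by (auto simp: words_def)
      then have "isolated (take (J * s) w) \<subseteq> Q"
        unfolding w(2) using K(1) by (intro isolated_prefix_subset_proc JK) simp
      then show ?thesis using w wG mat[OF wG] by (auto simp: B_def G_def)
    qed
    show "\<beta> powr k \<le> card S * (2 * (n + 1) * (1 + \<beta>) ^ (L * s) * real (s + 1) ^ L * fact (n - u) * c ^ (n - u)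
        * (fact u / fact n) ^ 4)"
      using main by (simp only: mult.assoc)
  qed
qed

end

section \<open>Completing a partial configuration by switches\<close>

definition nonattacking :: "nat \<Rightarrow> (int \<times> int) set \<Rightarrow> bool" where
  "nonattacking n Q \<longleftrightarrow> Q \<subseteq> board n \<and>
     (\<forall>p\<in>Q. \<forall>q\<in>Q. p \<noteq> q \<longrightarrow> fst p \<noteq> fst q \<and> snd p \<noteq> snd q \<and>
        fst p + snd p \<noteq> fst q + snd q \<and> fst p - snd p \<noteq> fst q - snd q)"

lemma card_le_one: "(\<And>p q. p \<in> X \<Longrightarrow> q \<in> X \<Longrightarrow> p = q) \<Longrightarrow> card X \<le> 1"
  by (cases "finite X") (simp_all add: card_le_Suc0_iff_eq)

lemma finite_board [simp]: "finite (board n)"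
  by (simp add: board_def)

lemma nonattacking_finite: "nonattacking n Q \<Longrightarrow> finite Q"
  unfolding nonattacking_def using finite_subset finite_board by blast

lemma nonattackingD:
  assumes "nonattacking n Q" "p \<in> Q" "q \<in> Q"
  shows "fst p = fst q \<Longrightarrow> p = q" "snd p = snd q \<Longrightarrow> p = q"
    "fst p + snd p = fst q + snd q \<Longrightarrow> p = q" "fst p - snd p = fst q - snd q \<Longrightarrow> p = q"
  using assms unfolding nonattacking_def by metis+

lemma nonattacking_card_line:
  assumes Q: "nonattacking n Q"
  shows "card {q \<in> Q. fst q = z} \<le> 1" "card {q \<in> Q. snd q = z} \<le> 1"
    "card {q \<in> Q. fst q + snd q = z} \<le> 1" "card {q \<in> Q. fst q - snd q = z} \<le> 1"
proof -
  show "card {q \<in> Q. fst q = z} \<le> 1"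
    by (rule card_le_one, rule nonattackingD(1)[OF Q]) simp_all
  show "card {q \<in> Q. snd q = z} \<le> 1"
    by (rule card_le_one, rule nonattackingD(2)[OF Q]) simp_all
  show "card {q \<in> Q. fst q + snd q = z} \<le> 1"
    by (rule card_le_one, rule nonattackingD(3)[OF Q]) simp_all
  show "card {q \<in> Q. fst q - snd q = z} \<le> 1"
    by (rule card_le_one, rule nonattackingD(4)[OF Q]) simp_all
qed

lemma nonattacking_partial:
  assumes Q: "nonattacking n Q"
  shows "partial_queens_config n Q"
  unfolding partial_queens_config_def
proof (intro conjI allI)
  show "Q \<subseteq> board n" using Q by (simp add: nonattacking_def)
  show "card {(x, y) \<in> Q. x = c} \<le> 1" for c by (rule card_le_one) (auto dest: nonattackingD(1)[OF Q])
  show "card {(x, y) \<in> Q. y = c} \<le> 1" for c by (rule card_le_one) (auto dest: nonattackingD(2)[OF Q])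
  show "card {(x, y) \<in> Q. x + y = c} \<le> 1" for c by (rule card_le_one) (auto dest: nonattackingD(3)[OF Q])
  show "card {(x, y) \<in> Q. x - y = c} \<le> 1" for c by (rule card_le_one) (auto dest: nonattackingD(4)[OF Q])
qed

definition free :: "(int \<times> int) set \<Rightarrow> int \<Rightarrow> int \<Rightarrow> bool" where
  "free Q x y \<longleftrightarrow> (\<forall>q\<in>Q. fst q + snd q \<noteq> x + y \<and> fst q - snd q \<noteq> x - y)"

text \<open>The queens \<open>(x, y)\<close> for which the diagonals of \<open>(x, c)\<close> and \<open>(r, y)\<close> are free.  Replacing such a
  queen by these two covers row \<open>r\<close> and column \<open>c\<close>, unless the new queens attack each other.\<close>

definition switches :: "(int \<times> int) set \<Rightarrow> int \<Rightarrow> int \<Rightarrow> (int \<times> int) set" where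
  "switches Q r c = {p \<in> Q. free Q (fst p) c \<and> free Q r (snd p)}"

definition switchable :: "nat \<Rightarrow> nat \<Rightarrow> nat \<Rightarrow> (int \<times> int) set set" where
  "switchable n k m = {Q. nonattacking n Q \<and> card Q = n - k \<and>
     (\<forall>r\<in>{1..int n}. \<forall>c\<in>{1..int n}. m \<le> card (switches Q r c))}"

definition switch :: "(int \<times> int) set \<Rightarrow> int \<Rightarrow> int \<Rightarrow> int \<times> int \<Rightarrow> (int \<times> int) set" where
  "switch Q r c p = insert (fst p, c) (insert (r, snd p) (Q - {p}))"

context
  fixes n Q r c p
  assumes Q: "nonattacking n Q" and rc: "r \<in> {1..int n} - fst ` Q" "c \<in> {1..int n} - snd ` Q"
    and p: "p \<in> switches Q r c" "fst p - snd p \<noteq> r - c" "fst p + snd p \<noteq> r + c"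
begin

lemma p_in: "p \<in> Q"
  using p by (simp add: switches_def)

lemma p_board: "fst p \<in> {1..int n}" "snd p \<in> {1..int n}"
  using Q p_in by (auto simp: nonattacking_def board_def)

lemma new_not_in: "(fst p, c) \<notin> Q" "(r, snd p) \<notin> Q" "(fst p, c) \<noteq> (r, snd p)"
  using rc p_in by force+

lemma nonattacking_switch: "nonattacking n (switch Q r c p)"
proof -
  let ?N = "{(fst p, c), (r, snd p)}"
  have sw: "switch Q r c p = ?N \<union> (Q - {p})" by (auto simp: switch_def)
  let ?R = "\<lambda>a b :: int \<times> int. fst a \<noteq> fst b \<and> snd a \<noteq> snd b \<and> fst a + snd a \<noteq> fst b + snd b \<and> fst a - snd a \<noteq> fst b - snd b"
  have frees: "free Q (fst p) c" "free Q r (snd p)" using p by (auto simp: switches_def)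
  have new_old: "?R a q" if "a \<in> ?N" "q \<in> Q - {p}" for a q
  proof -
    have q: "q \<in> Q" "fst q \<noteq> fst p" "snd q \<noteq> snd p"
      using that nonattackingD[OF Q _ p_in, of q] by auto
    have "fst q \<noteq> r" "snd q \<noteq> c" using q(1) rc by auto
    moreover have "fst q + snd q \<noteq> fst p + c" "fst q - snd q \<noteq> fst p - c"
      "fst q + snd q \<noteq> r + snd p" "fst q - snd q \<noteq> r - snd p"
      using frees q(1) by (auto simp: free_def)
    ultimately show ?thesis using that(1) q by auto
  qed
  have old: "?R a b" if "a \<in> Q - {p}" "b \<in> Q - {p}" "a \<noteq> b" for a b
    using Q that by (auto simp: nonattacking_def)
  have "fst p \<noteq> r" "snd p \<noteq> c" using rc p_in by auto
  then have new: "?R a b" if "a \<in> ?N" "b \<in> ?N" "a \<noteq> b" for a b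
    using that p(2,3) by auto
  have symR: "?R b a \<Longrightarrow> ?R a b" for a b by auto
  have "?R a b" if ab: "a \<in> ?N \<union> (Q - {p})" "b \<in> ?N \<union> (Q - {p})" "a \<noteq> b" for a b
  proof -
    consider "a \<in> ?N" "b \<in> ?N" | "a \<in> ?N" "b \<in> Q - {p}" | "b \<in> ?N" "a \<in> Q - {p}" | "a \<in> Q - {p}" "b \<in> Q - {p}"
      using ab(1,2) by (meson UnE)
    then show ?thesis
    proof cases
      case 1 then show ?thesis using new ab(3) by simp
    next
      case 2 then show ?thesis by (rule new_old)
    next
      case 3 then show ?thesis by (rule symR[OF new_old])
    next
      case 4 then show ?thesis using old ab(3) by simp
    qed
  qed
  moreover have "?N \<union> (Q - {p}) \<subseteq> board n"
    using Q p_board rc by (auto simp: nonattacking_def board_def)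
  ultimately show ?thesis unfolding nonattacking_def sw by simp
qed

lemma card_switch: "card (switch Q r c p) = card Q + 1"
proof -
  have "card (switch Q r c p) = Suc (Suc (card (Q - {p})))"
    unfolding switch_def using new_not_in nonattacking_finite[OF Q] by (simp add: card_insert_if)
  moreover have "Suc (card (Q - {p})) = card Q"
    using p_in nonattacking_finite[OF Q] by (rule card_Suc_Diff1[rotated])
  ultimately show ?thesis by simp
qed

text \<open>The removed queen is lost, and each of the four new diagonals disables one queen through
  the column and one through the row that are to be covered.\<close>

lemma card_switches_switch: "card (switches Q r' c') \<le> card (switches (switch Q r c p) r' c') + 9"
proof -
  let ?Q = "switch Q r c p" and ?N = "{(fst p, c), (r, snd p)}"
  define B where "B a = {q \<in> Q. fst q = fst a + snd a - c'} \<union> {q \<in> Q. fst q = fst a - snd a + c'}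
    \<union> {q \<in> Q. snd q = fst a + snd a - r'} \<union> {q \<in> Q. snd q = r' - (fst a - snd a)}" for a :: "int \<times> int"
  have finQ: "finite Q" "finite ?Q"
    using nonattacking_finite Q by (auto simp: switch_def)
  have cB: "card (B a) \<le> 4" for a
  proof -
    have "card (B a) \<le> card {q \<in> Q. fst q = fst a + snd a - c'} + card {q \<in> Q. fst q = fst a - snd a + c'}
      + card {q \<in> Q. snd q = fst a + snd a - r'} + card {q \<in> Q. snd q = r' - (fst a - snd a)}"
      unfolding B_def by (intro order_trans[OF card_Un_le] add_mono card_Un_le le_refl)
    also have "\<dots> \<le> 1 + 1 + 1 + 1" by (intro add_mono nonattacking_card_line[OF Q])
    finally show ?thesis by simp
  qed
  have "switches Q r' c' \<subseteq> switches ?Q r' c' \<union> {p} \<union> (B (fst p, c) \<union> B (r, snd p))"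
  proof
    fix q assume q: "q \<in> switches Q r' c'"
    show "q \<in> switches ?Q r' c' \<union> {p} \<union> (B (fst p, c) \<union> B (r, snd p))"
    proof (rule ccontr)
      assume neg: "\<not> ?thesis"
      have qQ: "q \<in> Q" "q \<noteq> p" and fr: "free Q (fst q) c'" "free Q r' (snd q)"
        using q neg by (auto simp: switches_def)
      have nB: "\<And>a. a \<in> ?N \<Longrightarrow> q \<notin> B a" using neg by auto
      have sub: "?Q \<subseteq> ?N \<union> Q" by (auto simp: switch_def)
      have N: "fst a + snd a \<noteq> fst q + c' \<and> fst a - snd a \<noteq> fst q - c' \<and>
          fst a + snd a \<noteq> r' + snd q \<and> fst a - snd a \<noteq> r' - snd q" if "a \<in> ?N" for a
        using nB[OF that] qQ(1) unfolding B_def by auto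
      have "free ?Q (fst q) c'" "free ?Q r' (snd q)"
        using fr N sub unfolding free_def by (meson UnE subsetD)+
      moreover have "q \<in> ?Q" using qQ by (simp add: switch_def)
      ultimately show False using neg by (simp add: switches_def)
    qed
  qed
  then have "card (switches Q r' c') \<le> card (switches ?Q r' c' \<union> {p} \<union> (B (fst p, c) \<union> B (r, snd p)))"
    using finQ by (intro card_mono) (auto simp: switches_def B_def)
  also have "\<dots> \<le> card (switches ?Q r' c') + card {p} + (card (B (fst p, c)) + card (B (r, snd p)))"
    by (intro order_trans[OF card_Un_le] add_mono card_Un_le le_refl)
  also have "\<dots> \<le> card (switches ?Q r' c') + 9"
    using cB[of "(fst p, c)"] cB[of "(r, snd p)"] by simp
  finally show ?thesis .
qed

lemma switch_inverse: "insert p (switch Q r c p - {(fst p, c), (r, snd p)}) = Q"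
  using new_not_in p_in by (auto simp: switch_def)

end

lemma finite_switchable: "finite (switchable n k m)"
proof -
  have "switchable n k m \<subseteq> Pow (board n)" by (auto simp: switchable_def nonattacking_def)
  then show ?thesis by (rule finite_subset) simp
qed

lemma card_Sigma_ge:
  assumes "finite X" "\<And>x. x \<in> X \<Longrightarrow> finite (Y x)" "\<And>x. x \<in> X \<Longrightarrow> m \<le> card (Y x)"
  shows "card X * m \<le> card (Sigma X Y)"
proof -
  have "card X * m = (\<Sum>x\<in>X. m)" by simp
  also have "\<dots> \<le> (\<Sum>x\<in>X. card (Y x))" using assms(3) by (rule sum_mono)
  also have "\<dots> = card (Sigma X Y)" using assms by simp
  finally show ?thesis .
qed

text \<open>Double counting of switches: a configuration with \<open>k + 1\<close> uncovered rows and columns has many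
  switches, and a switch can be undone once its two new queens are known.\<close>

lemma card_switchable_step:
  assumes "Suc k \<le> n"
  shows "card (switchable n (Suc k) (m + 9)) * ((k + 1)\<^sup>2 * m) \<le> card (switchable n k m) * n\<^sup>2"
proof -
  let ?F = "switchable n (Suc k) (m + 9)" and ?F' = "switchable n k m"
  define U where "U Q = ({1..int n} - fst ` Q) \<times> ({1..int n} - snd ` Q)" for Q :: "(int \<times> int) set"
  define P where "P Q u = {p \<in> switches Q (fst u) (snd u). fst p - snd p \<noteq> fst u - snd u \<and> fst p + snd p \<noteq> fst u + snd u}"
    for Q :: "(int \<times> int) set" and u
  define E where "E = Sigma ?F (\<lambda>Q. Sigma (U Q) (P Q))"
  define \<phi> where "\<phi> = (\<lambda>(Q, u, p). (switch Q (fst u) (snd u) p, (fst p, snd u), (fst u, snd p)))"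
  have Qn: "nonattacking n Q" "card Q = n - Suc k"
    "r \<in> {1..int n} \<Longrightarrow> c \<in> {1..int n} \<Longrightarrow> m + 9 \<le> card (switches Q r c)" if "Q \<in> ?F" for Q r c
    using that by (auto simp: switchable_def)
  have finP: "finite (P Q u)" if "Q \<in> ?F" for Q u
    using nonattacking_finite[OF Qn(1)[OF that]] by (simp add: P_def switches_def)
  have cU: "card (U Q) = (k + 1)\<^sup>2" if "Q \<in> ?F" for Q
  proof -
    note Q = Qn(1)[OF that]
    have "inj_on fst Q" "inj_on snd Q" using nonattackingD[OF Q] by (auto simp: inj_on_def)
    moreover have "fst ` Q \<subseteq> {1..int n}" "snd ` Q \<subseteq> {1..int n}"
      using Q by (auto simp: nonattacking_def board_def)
    ultimately have "card ({1..int n} - fst ` Q) = k + 1" "card ({1..int n} - snd ` Q) = k + 1"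
      using Qn(2)[OF that] nonattacking_finite[OF Q] assms by (auto simp: card_Diff_subset card_image)
    then show ?thesis by (simp add: U_def card_cartesian_product power2_eq_square)
  qed
  have cP: "m \<le> card (P Q u)" if Q: "Q \<in> ?F" and u: "u \<in> U Q" for Q u
  proof -
    have Q': "nonattacking n Q" by (rule Qn(1)[OF Q])
    let ?A = "{p \<in> Q. fst p - snd p = fst u - snd u}" and ?B = "{p \<in> Q. fst p + snd p = fst u + snd u}"
    have "card ?A \<le> 1" "card ?B \<le> 1" by (rule nonattacking_card_line[OF Q'])+
    moreover have "switches Q (fst u) (snd u) \<subseteq> P Q u \<union> (?A \<union> ?B)" by (auto simp: P_def switches_def)
    then have "card (switches Q (fst u) (snd u)) \<le> card (P Q u \<union> (?A \<union> ?B))"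
      using finP[OF Q] nonattacking_finite[OF Q'] by (intro card_mono) auto
    then have "card (switches Q (fst u) (snd u)) \<le> card (P Q u) + (card ?A + card ?B)"
      by (meson add_le_mono card_Un_le le_trans order_refl)
    moreover have "m + 9 \<le> card (switches Q (fst u) (snd u))" using u by (intro Qn(3)[OF Q]) (auto simp: U_def)
    ultimately show ?thesis by linarith
  qed
  have finU: "finite (U Q)" for Q by (simp add: U_def)
  have "card ?F * ((k + 1)\<^sup>2 * m) \<le> card E"
    unfolding E_def
  proof (rule card_Sigma_ge[OF finite_switchable])
    fix Q assume Q: "Q \<in> ?F"
    show "finite (Sigma (U Q) (P Q))" using finU finP[OF Q] by (intro finite_SigmaI) auto
    show "(k + 1)\<^sup>2 * m \<le> card (Sigma (U Q) (P Q))"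
      using card_Sigma_ge[where X = "U Q" and Y = "P Q" and m = m, OF finU finP[OF Q] cP[OF Q]] cU[OF Q] by simp
  qed
  also have "card E = card (\<phi> ` E)"
  proof (rule card_image[symmetric], rule inj_onI)
    fix e e' assume e: "e \<in> E" and e': "e' \<in> E" and eq: "\<phi> e = \<phi> e'"
    obtain Q r c p where e1: "e = (Q, (r, c), p)" by (metis surj_pair)
    obtain Q' r' c' p' where e2: "e' = (Q', (r', c'), p')" by (metis surj_pair)
    have "fst p = fst p'" "c = c'" "r = r'" "snd p = snd p'" and sw: "switch Q r c p = switch Q' r' c' p'"
      using eq by (auto simp: \<phi>_def e1 e2)
    then have pp: "p = p'" "c = c'" "r = r'" by (simp_all add: prod_eq_iff)
    have "Q = insert p (switch Q r c p - {(fst p, c), (r, snd p)})"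
      using e Qn(1)[of Q] by (intro switch_inverse[symmetric]) (auto simp: e1 E_def U_def P_def)
    moreover have "Q' = insert p' (switch Q' r' c' p' - {(fst p', c'), (r', snd p')})"
      using e' Qn(1)[of Q'] by (intro switch_inverse[symmetric]) (auto simp: e2 E_def U_def P_def)
    ultimately show "e = e'" using sw pp by (simp add: e1 e2)
  qed
  also have "\<dots> \<le> card (Sigma ?F' (\<lambda>Q. Q \<times> Q))"
  proof (rule card_mono)
    show "finite (Sigma ?F' (\<lambda>Q. Q \<times> Q))"
      using finite_switchable nonattacking_finite by (intro finite_SigmaI) (auto simp: switchable_def)
    show "\<phi> ` E \<subseteq> Sigma ?F' (\<lambda>Q. Q \<times> Q)"
    proof
      fix z assume "z \<in> \<phi> ` E"
      then obtain Q r c p where Q: "Q \<in> ?F" and u: "(r, c) \<in> U Q" and p: "p \<in> P Q (r, c)"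
        and z: "z = (switch Q r c p, (fst p, c), (r, snd p))"
        by (auto simp: E_def \<phi>_def)
      have h: "nonattacking n Q" "r \<in> {1..int n} - fst ` Q" "c \<in> {1..int n} - snd ` Q"
        "p \<in> switches Q r c" "fst p - snd p \<noteq> r - c" "fst p + snd p \<noteq> r + c"
        using Qn(1)[OF Q] u p by (auto simp: U_def P_def)
      have "m \<le> card (switches (switch Q r c p) r' c')" if "r' \<in> {1..int n}" "c' \<in> {1..int n}" for r' c'
        using card_switches_switch[OF h, of r' c'] Qn(3)[OF Q that] by linarith
      then have "switch Q r c p \<in> ?F'"
        using nonattacking_switch[OF h] card_switch[OF h] Qn(2)[OF Q] assms by (auto simp: switchable_def)
      then show "z \<in> Sigma ?F' (\<lambda>Q. Q \<times> Q)" by (auto simp: z switch_def)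
    qed
  qed
  also have "\<dots> = (\<Sum>Q\<in>?F'. card (Q \<times> Q))"
    using finite_switchable nonattacking_finite by (intro card_SigmaI) (auto simp: switchable_def)
  also have "\<dots> \<le> (\<Sum>Q\<in>?F'. n\<^sup>2)"
  proof (rule sum_mono)
    fix Q assume "Q \<in> ?F'"
    then have "card Q \<le> n" by (simp add: switchable_def)
    then show "card (Q \<times> Q) \<le> n\<^sup>2" by (simp add: card_cartesian_product power2_eq_square mult_mono)
  qed
  finally show ?thesis by simp
qed

text \<open>Every step of the completion may lose nine possible switches, hence the summand \<open>9 * k\<close>.\<close>

theorem card_switchable_le_queens_count:
  assumes "k \<le> n"
  shows "card (switchable n k (m + 9 * k)) * ((fact k)\<^sup>2 * m ^ k) \<le> queens_count n * (n\<^sup>2) ^ k"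
  using assms
proof (induction k)
  case 0
  have "switchable n 0 m \<subseteq> {Q. queens_config n Q}"
    using nonattacking_partial by (auto simp: switchable_def queens_config_def)
  moreover have "finite {Q. queens_config n Q}"
  proof (rule finite_subset)
    show "{Q. queens_config n Q} \<subseteq> Pow (board n)"
      by (auto simp: queens_config_def partial_queens_config_def)
  qed simp
  ultimately show ?case by (simp add: queens_count_def card_mono)
next
  case (Suc k)
  have "card (switchable n (Suc k) (m + 9 * Suc k)) * ((fact (Suc k))\<^sup>2 * m ^ Suc k)
     = card (switchable n (Suc k) (m + 9 * k + 9)) * ((k + 1)\<^sup>2 * m) * ((fact k)\<^sup>2 * m ^ k)"
    by (simp add: power_mult_distrib algebra_simps power2_eq_square)
  also have "\<dots> \<le> card (switchable n (Suc k) (m + 9 * k + 9)) * ((k + 1)\<^sup>2 * (m + 9 * k)) * ((fact k)\<^sup>2 * m ^ k)"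
    by (intro mult_right_mono mult_left_mono) auto
  also have "\<dots> \<le> card (switchable n k (m + 9 * k)) * n\<^sup>2 * ((fact k)\<^sup>2 * m ^ k)"
    by (intro mult_right_mono card_switchable_step Suc.prems) auto
  also have "\<dots> = card (switchable n k (m + 9 * k)) * ((fact k)\<^sup>2 * m ^ k) * n\<^sup>2" by simp
  also have "\<dots> \<le> queens_count n * (n\<^sup>2) ^ k * n\<^sup>2"
    using Suc by (intro mult_right_mono) auto
  finally show ?case by (simp add: mult_ac)
qed

section \<open>Planted patterns of isolated samples\<close>

text \<open>If the elements of \<open>B\<close> are disjoint from each other and from those of \<open>A'\<close>, then every element of the
  pattern \<open>B\<close> is an isolated sample of such a word.\<close>

definition planted :: "'a set \<Rightarrow> 'a set \<Rightarrow> nat \<Rightarrow> 'a list set" where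
  "planted A' B t = {w. length w = t \<and> set w \<subseteq> A' \<union> B \<and> B \<subseteq> set w \<and>
     (\<forall>i<t. \<forall>j<t. i \<noteq> j \<longrightarrow> w ! i \<in> B \<longrightarrow> w ! i \<noteq> w ! j)}"

lemma finite_planted: "finite A' \<Longrightarrow> finite B \<Longrightarrow> finite (planted A' B t)"
  by (rule finite_subset[OF _ finite_words[of "A' \<union> B" t]]) (auto simp: planted_def words_def)

lemma planted_Cons:
  assumes "A' \<inter> B = {}" "x \<in> A'" "w \<in> planted A' B t"
  shows "x # w \<in> planted A' B (Suc t)"
proof -
  have w: "length w = t" "set w \<subseteq> A' \<union> B" "B \<subseteq> set w"
    "\<And>i j. i < t \<Longrightarrow> j < t \<Longrightarrow> i \<noteq> j \<Longrightarrow> w ! i \<in> B \<Longrightarrow> w ! i \<noteq> w ! j"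
    using assms(3) by (auto simp: planted_def)
  have x: "x \<notin> B" using assms by blast
  have "(x # w) ! i \<noteq> (x # w) ! j" if "i < Suc t" "j < Suc t" "i \<noteq> j" "(x # w) ! i \<in> B" for i j
    using that w(4) x by (cases i; cases j) auto
  then show ?thesis unfolding planted_def using w assms(2) by auto
qed

lemma planted_Cons_new:
  assumes "A' \<inter> B = {}" "x \<in> B" "w \<in> planted A' (B - {x}) t"
  shows "x # w \<in> planted A' B (Suc t)"
proof -
  have w: "length w = t" "set w \<subseteq> A' \<union> (B - {x})" "B - {x} \<subseteq> set w"
    "\<And>i j. i < t \<Longrightarrow> j < t \<Longrightarrow> i \<noteq> j \<Longrightarrow> w ! i \<in> B - {x} \<Longrightarrow> w ! i \<noteq> w ! j"
    using assms(3) by (auto simp: planted_def)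
  have x: "w ! i \<noteq> x" if "i < t" for i
    using that w(1,2) assms(1,2) nth_mem[of i w] by blast
  have "(x # w) ! i \<noteq> (x # w) ! j" if "i < Suc t" "j < Suc t" "i \<noteq> j" "(x # w) ! i \<in> B" for i j
    using that w(4) x by (cases i; cases j) (auto; metis)+
  then show ?thesis unfolding planted_def using w assms(2) by auto
qed

text \<open>By the recursion over the first letter, which mirrors Pascal's rule: it is a letter of \<open>A'\<close>, or an
  element of the pattern, which must not be used again.\<close>

lemma card_planted_ge:
  assumes A': "finite A'"
  shows "finite B \<Longrightarrow> A' \<inter> B = {} \<Longrightarrow>
    (t choose card B) * fact (card B) * card A' ^ t \<le> card (planted A' B t) * card A' ^ card B"
proof (induction t arbitrary: B)
  case 0
  show ?case
  proof (cases "B = {}")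
    case True
    then have "planted A' B 0 = {[]}" by (auto simp: planted_def)
    then show ?thesis using True by simp
  next
    case False
    then obtain k where "card B = Suc k" using 0 by (cases "card B") auto
    then show ?thesis by simp
  qed
next
  case (Suc t)
  let ?P = "\<lambda>x. if x \<in> A' then planted A' B t else planted A' (B - {x}) t"
  let ?a = "card A'"
  have "card (Sigma (A' \<union> B) ?P) = card ((\<lambda>(x, w). x # w) ` Sigma (A' \<union> B) ?P)"
    by (rule card_image[symmetric]) (auto simp: inj_on_def)
  also have "\<dots> \<le> card (planted A' B (Suc t))"
  proof (rule card_mono[OF finite_planted[OF A' Suc.prems(1)]])
    show "(\<lambda>(x, w). x # w) ` Sigma (A' \<union> B) ?P \<subseteq> planted A' B (Suc t)"
    proof
      fix v assume "v \<in> (\<lambda>(x, w). x # w) ` Sigma (A' \<union> B) ?P"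
      then obtain x w where v: "v = x # w" "x \<in> A' \<union> B" "w \<in> ?P x" by auto
      show "v \<in> planted A' B (Suc t)"
      proof (cases "x \<in> A'")
        case True
        then show ?thesis using v planted_Cons[OF Suc.prems(2)] by simp
      next
        case False
        then show ?thesis using v planted_Cons_new[OF Suc.prems(2)] by simp
      qed
    qed
  qed
  finally have "card (Sigma (A' \<union> B) ?P) \<le> card (planted A' B (Suc t))" .
  moreover have "card (Sigma (A' \<union> B) ?P) = (\<Sum>x\<in>A' \<union> B. card (?P x))"
    using A' Suc.prems(1) finite_planted by (intro card_SigmaI) auto
  moreover have "(\<Sum>x\<in>A' \<union> B. card (?P x)) = (\<Sum>x\<in>A'. card (?P x)) + (\<Sum>x\<in>B. card (?P x))"
    using A' Suc.prems by (intro sum.union_disjoint) auto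
  moreover have "(\<Sum>x\<in>A'. card (?P x)) = ?a * card (planted A' B t)" by simp
  moreover have "(\<Sum>x\<in>B. card (?P x)) = (\<Sum>x\<in>B. card (planted A' (B - {x}) t))"
    using Suc.prems(2) by (intro sum.cong) auto
  ultimately have ge: "card (planted A' B (Suc t)) \<ge> ?a * card (planted A' B t) + (\<Sum>x\<in>B. card (planted A' (B - {x}) t))"
    by linarith
  have step: "(\<Sum>x\<in>B. card (planted A' (B - {x}) t)) * ?a ^ card B
      \<ge> (t choose (card B - 1)) * fact (card B) * ?a ^ Suc t" if "B \<noteq> {}"
  proof -
    obtain k where k: "card B = Suc k"
      using \<open>B \<noteq> {}\<close> Suc.prems(1) by (cases "card B") auto
    have "(\<Sum>x\<in>B. (t choose k) * fact k * ?a ^ t) \<le> (\<Sum>x\<in>B. card (planted A' (B - {x}) t) * ?a ^ k)"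
    proof (rule sum_mono)
      fix x assume x: "x \<in> B"
      have "card (B - {x}) = k" using x k Suc.prems(1) by simp
      then show "(t choose k) * fact k * ?a ^ t \<le> card (planted A' (B - {x}) t) * ?a ^ k"
        using Suc.IH[of "B - {x}"] Suc.prems by auto
    qed
    then have "card B * ((t choose k) * fact k * ?a ^ t) * ?a \<le> (\<Sum>x\<in>B. card (planted A' (B - {x}) t)) * ?a ^ k * ?a"
      by (intro mult_right_mono) (simp_all add: sum_distrib_right)
    then show ?thesis by (simp add: k algebra_simps)
  qed
  show ?case
  proof (cases "B = {}")
    case True
    have "?a ^ t \<le> card (planted A' {} t)" using Suc.IH[of "{}"] by simp
    then have "?a * ?a ^ t \<le> ?a * card (planted A' {} t)" by (rule mult_le_mono2)
    also have "?a * card (planted A' {} t) \<le> card (planted A' {} (Suc t))" using ge True by simp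
    finally have "?a * ?a ^ t \<le> card (planted A' {} (Suc t))" .
    then show ?thesis using True by simp
  next
    case False
    then obtain k where k: "card B = Suc k"
      using Suc.prems(1) by (cases "card B") auto
    have "(Suc t choose card B) * fact (card B) * ?a ^ Suc t
      = ?a * ((t choose card B) * fact (card B) * ?a ^ t) + (t choose (card B - 1)) * fact (card B) * ?a ^ Suc t"
      by (simp add: k algebra_simps)
    also have "\<dots> \<le> ?a * (card (planted A' B t) * ?a ^ card B) + (\<Sum>x\<in>B. card (planted A' (B - {x}) t)) * ?a ^ card B"
      by (intro add_mono mult_left_mono Suc.IH Suc.prems step False) simp
    also have "\<dots> = (?a * card (planted A' B t) + (\<Sum>x\<in>B. card (planted A' (B - {x}) t))) * ?a ^ card B"
      by (simp add: algebra_simps)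
    also have "\<dots> \<le> card (planted A' B (Suc t)) * ?a ^ card B"
      using ge by (rule mult_right_mono) simp
    finally show ?thesis .
  qed
qed

context line_system
begin

lemma planted_subset_isolated:
  assumes B: "matching B" and A': "\<And>e b. e \<in> A' \<Longrightarrow> b \<in> B \<Longrightarrow> \<not> meets b e" and w: "w \<in> planted A' B t"
  shows "B \<subseteq> isolated w"
proof
  fix b assume b: "b \<in> B"
  have wt: "length w = t" "set w \<subseteq> A' \<union> B" "B \<subseteq> set w"
    "\<And>i j. i < t \<Longrightarrow> j < t \<Longrightarrow> i \<noteq> j \<Longrightarrow> w ! i \<in> B \<Longrightarrow> w ! i \<noteq> w ! j"
    using w by (auto simp: planted_def)
  obtain i where i: "i < t" "w ! i = b" using b wt(1,3) by (metis in_mono in_set_conv_nth)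
  have "\<not> meets (w ! i) (w ! j)" if j: "j < t" "j \<noteq> i" for j
  proof (cases "w ! j \<in> B")
    case True
    then show ?thesis using B i b wt(4)[of i j] j by (auto simp: matching_def)
  next
    case False
    then have "w ! j \<in> A'" using wt(1,2) j nth_mem[of j w] by blast
    then show ?thesis using A' b i by simp
  qed
  then have "i \<in> isolated_pos w" using i wt(1) by (auto simp: isolated_pos_def)
  then show "b \<in> isolated w" unfolding isolated_eq using i(2) by blast
qed

lemma card_words_isolated_ge:
  assumes B: "matching B" "card B = m" and m: "4 * m < n"
  shows "real (card {w \<in> words A t. B \<subseteq> isolated w})
    \<ge> real (t choose m) * fact m * (1 - 4 * real m / real n) ^ t / real n ^ (2 * m) * card (words A t)"
proof -
  let ?A' = "{e \<in> A. \<forall>b\<in>B. \<not> meets b e}"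
  have finB: "finite B" and BA: "B \<subseteq> A" using B matching_finite by (auto simp: matching_def)
  have sub: "planted ?A' B t \<subseteq> {w \<in> words A t. B \<subseteq> isolated w}"
  proof
    fix w assume w: "w \<in> planted ?A' B t"
    have "B \<subseteq> isolated w" by (rule planted_subset_isolated[OF B(1) _ w]) auto
    then show "w \<in> {w \<in> words A t. B \<subseteq> isolated w}" using w BA by (auto simp: planted_def words_def)
  qed
  have disj: "?A' \<inter> B = {}" using meets_refl by blast
  have "card (A - ?A') \<le> card (\<Union>b\<in>B. {e \<in> A. meets e b})"
    using finB by (intro card_mono) (auto simp: meets_sym)
  also have "\<dots> \<le> (\<Sum>b\<in>B. card {e \<in> A. meets e b})" using finB by (rule card_UN_le)
  also have "\<dots> \<le> (\<Sum>b\<in>B. 4 * n)" using BA by (intro sum_mono card_meets_le) auto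
  finally have "card (A - ?A') \<le> m * (4 * n)" using B(2) by simp
  moreover have "card A = card ?A' + card (A - ?A')"
    by (subst card_Un_disjoint[symmetric]) (auto intro: arg_cong[where f = card])
  ultimately have "n\<^sup>2 \<le> card ?A' + m * (4 * n)" using card_A by linarith
  then have "real (n\<^sup>2) \<le> real (card ?A' + m * (4 * n))" by (simp only: of_nat_le_iff)
  then have "real n ^ 2 \<le> card ?A' + 4 * m * real n" by simp
  moreover have "(1 - 4 * real m / real n) * real n ^ 2 = real n ^ 2 - 4 * m * real n"
    using n_pos by (simp add: field_simps power2_eq_square)
  ultimately have a_ge: "real (card ?A') \<ge> (1 - 4 * real m / real n) * real n ^ 2" by linarith
  have pos: "1 - 4 * real m / real n > 0" using m by simp
  then have a_pos: "real (card ?A') > 0" using a_ge n_pos by (smt (verit) mult_pos_pos of_nat_0_less_iff zero_less_power)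
  have "card ?A' \<le> n\<^sup>2" unfolding card_A[symmetric] by (rule card_mono) auto
  then have "real (card ?A') \<le> real (n\<^sup>2)" by (simp only: of_nat_le_iff)
  then have a_le: "real (card ?A') \<le> real n ^ 2" by simp
  have "real ((t choose m) * fact m * card ?A' ^ t) \<le> real (card (planted ?A' B t) * card ?A' ^ m)"
    using card_planted_ge[OF _ finB disj, of t] B(2) by (simp only: of_nat_le_iff) simp
  also have "\<dots> \<le> card {w \<in> words A t. B \<subseteq> isolated w} * (real n ^ 2) ^ m"
    unfolding of_nat_mult of_nat_power using card_mono[OF _ sub] a_le by (intro mult_mono power_mono) auto
  finally have "real (t choose m) * fact m * real (card ?A') ^ t
      \<le> card {w \<in> words A t. B \<subseteq> isolated w} * real n ^ (2 * m)"
    by (simp add: power_mult)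
  moreover have "real (t choose m) * fact m * ((1 - 4 * real m / real n) * real n ^ 2) ^ t
      \<le> real (t choose m) * fact m * real (card ?A') ^ t"
    using a_ge pos by (intro mult_left_mono power_mono) auto
  ultimately have "real (t choose m) * fact m * ((1 - 4 * real m / real n) ^ t * card (words A t))
      \<le> card {w \<in> words A t. B \<subseteq> isolated w} * real n ^ (2 * m)"
    by (simp add: card_words_A power_mult_distrib power_mult)
  then show ?thesis using n_pos by (simp add: field_simps)
qed

lemma mean_patterns_ge:
  assumes T: "finite T" "\<And>g. g \<in> T \<Longrightarrow> matching (els g) \<and> card (els g) = m" and m: "4 * m < n"
  shows "mean (words A t) (\<lambda>w. real (card {g \<in> T. els g \<subseteq> isolated w}))
    \<ge> card T * (real (t choose m) * fact m * (1 - 4 * real m / real n) ^ t / real n ^ (2 * m))"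
proof -
  let ?W = "words A t" and ?c = "real (t choose m) * fact m * (1 - 4 * real m / real n) ^ t / real n ^ (2 * m)"
  have "(\<Sum>w\<in>?W. real (card {g \<in> T. els g \<subseteq> isolated w})) = (\<Sum>w\<in>?W. \<Sum>g\<in>T. if els g \<subseteq> isolated w then 1 else 0)"
    using T(1) by (simp add: sum.If_cases Int_def)
  also have "\<dots> = (\<Sum>g\<in>T. \<Sum>w\<in>?W. if els g \<subseteq> isolated w then 1 else 0)" by (rule sum.swap)
  also have "\<dots> = (\<Sum>g\<in>T. real (card {w \<in> ?W. els g \<subseteq> isolated w}))" by (simp add: sum.If_cases Int_def)
  also have "\<dots> \<ge> (\<Sum>g\<in>T. ?c * card ?W)"
  proof (rule sum_mono)
    fix g assume "g \<in> T"
    then show "?c * card ?W \<le> real (card {w \<in> ?W. els g \<subseteq> isolated w})"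
      using T(2)[of g] by (intro card_words_isolated_ge m) auto
  qed
  finally have "(\<Sum>w\<in>?W. real (card {g \<in> T. els g \<subseteq> isolated w})) \<ge> card T * ?c * card ?W" by simp
  then show ?thesis unfolding mean_def
    by (subst pos_le_divide_eq) (use card_words_A_pos in auto)
qed

text \<open>Lines of different type share at most two elements.  So every element to be avoided excludes at
  most six elements of \<open>S\<close>, and every line to be avoided at most two.\<close>

lemma card_choose_avoiding:
  assumes S: "S \<subseteq> A" "\<And>e. e \<in> S \<Longrightarrow> ln k e = i" and k: "k < 4" and P: "finite P" "\<And>p. p \<in> P \<Longrightarrow> ln k p \<noteq> i"
    and F: "finite F" "\<And>l j. (l, j) \<in> F \<Longrightarrow> l < 4 \<and> l \<noteq> k"
  shows "card S \<le> card {e \<in> S. (\<forall>p\<in>P. \<not> meets p e) \<and> (\<forall>(l, j)\<in>F. ln l e \<noteq> j)} + (6 * card P + 2 * card F)"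
proof -
  let ?G = "{e \<in> S. (\<forall>p\<in>P. \<not> meets p e) \<and> (\<forall>(l, j)\<in>F. ln l e \<noteq> j)}"
  let ?L = "(\<lambda>(p, l). (l, ln l p)) ` (P \<times> ({..<4} - {k})) \<union> F"
  have finL: "finite ?L" using P(1) F(1) by simp
  have "S \<subseteq> ?G \<union> (\<Union>(l, j)\<in>?L. {e \<in> A. ln k e = i \<and> ln l e = j})"
  proof
    fix e assume e: "e \<in> S"
    show "e \<in> ?G \<union> (\<Union>(l, j)\<in>?L. {e \<in> A. ln k e = i \<and> ln l e = j})"
    proof (cases "\<exists>(l, j)\<in>?L. ln l e = j")
      case True
      then show ?thesis using e S by fastforce
    next
      case False
      have "\<not> meets p e" if p: "p \<in> P" for p
      proof
        assume "meets p e"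
        then obtain l where l: "l < 4" "ln l p = ln l e" by (auto simp: meets_def)
        have "l \<noteq> k" using l P(2)[OF p] S(2)[OF e] by auto
        then have "(l, ln l p) \<in> ?L"
          using p l(1) by (intro UnI1 image_eqI[of _ _ "(p, l)"]) auto
        then show False using False l(2) by force
      qed
      then show ?thesis using e False by blast
    qed
  qed
  moreover have "finite S" using S(1) finite_A by (rule finite_subset)
  moreover have "finite (\<Union>(l, j)\<in>?L. {e \<in> A. ln k e = i \<and> ln l e = j})"
    using finL by (intro finite_UN_I) (auto simp: case_prod_unfold)
  ultimately have "card S \<le> card (?G \<union> (\<Union>(l, j)\<in>?L. {e \<in> A. ln k e = i \<and> ln l e = j}))"
    by (intro card_mono finite_UnI) auto
  also have "\<dots> \<le> card ?G + card (\<Union>(l, j)\<in>?L. {e \<in> A. ln k e = i \<and> ln l e = j})" by (rule card_Un_le)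
  also have "card (\<Union>(l, j)\<in>?L. {e \<in> A. ln k e = i \<and> ln l e = j}) \<le> (\<Sum>(l, j)\<in>?L. card {e \<in> A. ln k e = i \<and> ln l e = j})"
    using finL by (intro order_trans[OF card_UN_le]) (auto simp: case_prod_unfold)
  also have "\<dots> \<le> (\<Sum>q\<in>?L. 2)"
    using k F(2) by (intro sum_mono) (force simp: case_prod_unfold intro!: card_two_lines)
  also have "\<dots> = 2 * card ?L" by simp
  also have "\<dots> \<le> 2 * (card ((\<lambda>(p, l). (l, ln l p)) ` (P \<times> ({..<4} - {k}))) + card F)"
    by (intro mult_left_mono card_Un_le) simp
  also have "card ((\<lambda>(p, l). (l, ln l p)) ` (P \<times> ({..<4} - {k}))) \<le> card (P \<times> ({..<4} - {k}))"
    using P(1) by (intro card_image_le) auto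
  also have "card (P \<times> ({..<4} - {k})) = card P * 3" using k by (simp add: card_cartesian_product)
  finally show ?thesis by simp
qed

end

section \<open>The toroidal board\<close>

definition line :: "nat \<Rightarrow> nat \<Rightarrow> int \<times> int \<Rightarrow> int" where
  "line n k p = (if k = 0 then fst p else if k = 1 then snd p
     else if k = 2 then fst p + snd p else fst p - snd p) mod int n"

definition rep :: "nat \<Rightarrow> int \<Rightarrow> int" where
  "rep n z = (z - 1) mod int n + 1"

lemma rep_range: "n > 0 \<Longrightarrow> rep n z \<in> {1..int n}"
proof -
  assume "n > 0"
  then have "0 \<le> (z - 1) mod int n" "(z - 1) mod int n < int n" by simp_all
  then show ?thesis by (simp add: rep_def)
qed

lemma rep_mod: "rep n z mod int n = z mod int n"
  by (simp add: rep_def mod_add_left_eq)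

lemma rep_unique: "n > 0 \<Longrightarrow> x \<in> {1..int n} \<Longrightarrow> x mod int n = z mod int n \<longleftrightarrow> x = rep n z"
proof
  assume n: "n > 0" and x: "x \<in> {1..int n}" and eq: "x mod int n = z mod int n"
  have "(x - 1) mod int n = (z - 1) mod int n" using eq by (metis mod_diff_left_eq)
  moreover have "(x - 1) mod int n = x - 1" using x by simp
  ultimately show "x = rep n z" by (simp add: rep_def)
qed (simp add: rep_mod)

lemma residues_inj: "n > 0 \<Longrightarrow> x \<in> {1..int n} \<Longrightarrow> y \<in> {1..int n} \<Longrightarrow> x mod int n = y mod int n \<Longrightarrow> x = y"
  using rep_unique by metis

text \<open>Two numbers of the interval whose doubles agree modulo \<open>n\<close> are equal or differ by \<open>n / 2\<close>.\<close>

lemma card_two_doubles: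
  assumes X: "X \<subseteq> {1..int n}" and d: "\<And>x y. x \<in> X \<Longrightarrow> y \<in> X \<Longrightarrow> int n dvd 2 * (x - y)"
  shows "card X \<le> 2"
proof (cases "X = {}")
  case False
  have fin: "finite X" using X finite_subset by blast
  define a where "a = Min X"
  have a: "a \<in> X" "\<And>x. x \<in> X \<Longrightarrow> a \<le> x" using fin False by (auto simp: a_def)
  have "X \<subseteq> {a, a + int n div 2}"
  proof
    fix x assume x: "x \<in> X"
    obtain k where k: "2 * (x - a) = int n * k" using d[OF x a(1)] by (auto simp: dvd_def)
    have "x \<in> {1..int n}" "a \<in> {1..int n}" using a(1) x X by blast+
    then have "0 \<le> x - a" "x - a < int n" using a(2)[OF x] by auto
    then have "int n > 0" by linarith
    moreover have "0 \<le> int n * k" unfolding k[symmetric] using \<open>0 \<le> x - a\<close> by simp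
    moreover have "int n * k < int n * 2" unfolding k[symmetric] using \<open>x - a < int n\<close> by simp
    ultimately have "int n > 0" "0 \<le> int n * k" "int n * k < int n * 2" by blast+
    then have "0 \<le> k" by (auto simp: zero_le_mult_iff)
    moreover have "k < 2"
    proof (rule ccontr)
      assume "\<not> k < 2"
      then have "int n * 2 \<le> int n * k" by (intro mult_left_mono) auto
      then show False using \<open>int n * k < int n * 2\<close> by linarith
    qed
    ultimately have "0 \<le> k" "k < 2" by blast+
    then have "k = 0 \<or> k = 1" by linarith
    then show "x \<in> {a, a + int n div 2}" using k by auto
  qed
  then have "card X \<le> card {a, a + int n div 2}" by (intro card_mono) auto
  also have "\<dots> \<le> 2" by (simp add: card_insert_if)
  finally show ?thesis .
qed simp

lemma card_graph:
  "card ((\<lambda>x. (x, f x)) ` {1..int n}) = n" "card ((\<lambda>y. (f' y, y)) ` {1..int n}) = n"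
  by (subst card_image; force intro: inj_onI)+

locale torus =
  fixes n :: nat
  assumes n_pos: "n > 0"
begin

lemma card_line_torus:
  assumes "k < 4" "i \<in> {0..<int n}"
  shows "card {e \<in> board n. line n k e = i} = n"
proof -
  have i: "i mod int n = i" using assms by simp
  have key: "x mod int n = i \<longleftrightarrow> x = rep n i" if "x \<in> {1..int n}" for x
    using rep_unique[OF n_pos that, of i] i by simp
  consider "k = 0" | "k = 1" | "k = 2" | "k = 3" using assms by linarith
  then show ?thesis
  proof cases
    case 1
    have "e \<in> {e \<in> board n. line n k e = i} \<longleftrightarrow> e \<in> (\<lambda>y. (rep n i, y)) ` {1..int n}" for e
    proof (cases e)
      case (Pair a b)
      show ?thesis
        unfolding Pair by (simp add: board_def line_def 1 image_iff del: atLeastAtMost_iff)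
          (metis key rep_range n_pos)
    qed
    then have "{e \<in> board n. line n k e = i} = (\<lambda>y. (rep n i, y)) ` {1..int n}" by (rule set_eqI)
    then show ?thesis by (simp only: card_graph(2))
  next
    case 2
    have "e \<in> {e \<in> board n. line n k e = i} \<longleftrightarrow> e \<in> (\<lambda>x. (x, rep n i)) ` {1..int n}" for e
    proof (cases e)
      case (Pair a b)
      show ?thesis
        unfolding Pair by (simp add: board_def line_def 2 image_iff del: atLeastAtMost_iff)
          (metis key rep_range n_pos)
    qed
    then have "{e \<in> board n. line n k e = i} = (\<lambda>x. (x, rep n i)) ` {1..int n}" by (rule set_eqI)
    then show ?thesis by (simp only: card_graph(1))
  next
    case 3
    have eq: "(x + y) mod int n = i \<longleftrightarrow> y = rep n (i - x)" if "y \<in> {1..int n}" for x y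
    proof -
      have "(x + y) mod int n = i mod int n \<longleftrightarrow> y mod int n = (i - x) mod int n"
        unfolding mod_eq_dvd_iff by (simp add: algebra_simps)
      then show ?thesis using rep_unique[OF n_pos that] i by simp
    qed
    have "e \<in> {e \<in> board n. line n k e = i} \<longleftrightarrow> e \<in> (\<lambda>x. (x, rep n (i - x))) ` {1..int n}" for e
    proof (cases e)
      case (Pair a b)
      show ?thesis
        unfolding Pair by (simp add: board_def line_def 3 image_iff del: atLeastAtMost_iff)
          (metis eq rep_range n_pos)
    qed
    then have "{e \<in> board n. line n k e = i} = (\<lambda>x. (x, rep n (i - x))) ` {1..int n}" by (rule set_eqI)
    then show ?thesis by (simp only: card_graph(1))
  next
    case 4
    have eq: "(x - y) mod int n = i \<longleftrightarrow> y = rep n (x - i)" if "y \<in> {1..int n}" for x y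
    proof -
      have "(x - y) mod int n = i mod int n \<longleftrightarrow> (x - i) mod int n = y mod int n"
        unfolding mod_eq_dvd_iff by (simp add: algebra_simps)
      then show ?thesis using rep_unique[OF n_pos that, of "x - i"] i by metis
    qed
    have "e \<in> {e \<in> board n. line n k e = i} \<longleftrightarrow> e \<in> (\<lambda>x. (x, rep n (x - i))) ` {1..int n}" for e
    proof (cases e)
      case (Pair a b)
      show ?thesis
        unfolding Pair by (simp add: board_def line_def 4 image_iff del: atLeastAtMost_iff)
          (metis eq rep_range n_pos)
    qed
    then have "{e \<in> board n. line n k e = i} = (\<lambda>x. (x, rep n (x - i))) ` {1..int n}" by (rule set_eqI)
    then show ?thesis by (simp only: card_graph(1))
  qed
qed

end

context torus
begin

lemma line_eq_iff:
  "line n k e = line n k f \<longleftrightarrow> int n dvd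
     (if k = 0 then fst e - fst f else if k = 1 then snd e - snd f
      else if k = 2 then (fst e - fst f) + (snd e - snd f) else (fst e - fst f) - (snd e - snd f))"
  by (simp add: line_def mod_eq_dvd_iff algebra_simps)

text \<open>If two squares lie on two common lines of different type, then \<open>n\<close> divides twice the difference of
  their rows; the factor two is needed for the two kinds of diagonals only, and for even \<open>n\<close>.  The
  row determines the column.\<close>

lemma card_two_lines_torus:
  assumes "k < 4" "l < 4" "k \<noteq> l"
  shows "card {e \<in> board n. line n k e = i \<and> line n l e = i'} \<le> 2"
proof -
  let ?S = "{e \<in> board n. line n k e = i \<and> line n l e = i'}"
  have rel: "int n dvd 2 * (fst e - fst f) \<and> (int n dvd fst e - fst f \<longrightarrow> int n dvd snd e - snd f)"
    if "e \<in> ?S" "f \<in> ?S" for e f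
  proof -
    define a b where "a = fst e - fst f" and "b = snd e - snd f"
    define L where "L k = (if k = 0 then a else if k = 1 then b else if k = 2 then a + b else a - b)" for k :: nat
    have L: "int n dvd L k" "int n dvd L l"
    proof -
      have "line n k e = line n k f" "line n l e = line n l f" using that by auto
      then show "int n dvd L k" "int n dvd L l"
        unfolding line_eq_iff L_def a_def b_def by blast+
    qed
    have "\<exists>u v. 2 * a = u * L k + v * L l \<and> (\<exists>u v w. b = u * L k + v * L l + w * a)"
    proof -
      have eqs: "(k = 0 \<or> k = 1 \<or> k = 2 \<or> k = 3) \<and> (l = 0 \<or> l = 1 \<or> l = 2 \<or> l = 3)" using assms by linarith
      have A: "\<exists>u v. 2 * a = u * L k + v * L l"
      proof (cases "k = 0 \<or> l = 0")
        case True
        then show ?thesis by (elim disjE) (rule exI[of _ 2], rule exI[of _ 0], simp add: L_def,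
            rule exI[of _ 0], rule exI[of _ 2], simp add: L_def)
      next
        case False
        then consider "k = 1" "l = 2" | "k = 1" "l = 3" | "k = 2" "l = 1" | "k = 2" "l = 3" | "k = 3" "l = 1" | "k = 3" "l = 2"
          using eqs assms by auto
        then show ?thesis
        proof cases
          case 1 then show ?thesis by (intro exI[of _ "-2"] exI[of _ 2]) (simp add: L_def)
        next
          case 2 then show ?thesis by (intro exI[of _ 2] exI[of _ 2]) (simp add: L_def)
        next
          case 3 then show ?thesis by (intro exI[of _ 2] exI[of _ "-2"]) (simp add: L_def)
        next
          case 4 then show ?thesis by (intro exI[of _ 1] exI[of _ 1]) (simp add: L_def)
        next
          case 5 then show ?thesis by (intro exI[of _ 2] exI[of _ 2]) (simp add: L_def)
        next
          case 6 then show ?thesis by (intro exI[of _ 1] exI[of _ 1]) (simp add: L_def)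
        qed
      qed
      have B: "\<exists>u v w. b = u * L k + v * L l + w * a"
      proof (cases "k = 0")
        case True
        then consider "l = 1" | "l = 2" | "l = 3" using eqs assms by auto
        then show ?thesis
        proof cases
          case 1 then show ?thesis by (intro exI[of _ 0] exI[of _ 1] exI[of _ 0]) (simp add: L_def)
        next
          case 2 then show ?thesis by (intro exI[of _ 0] exI[of _ 1] exI[of _ "-1"]) (simp add: L_def)
        next
          case 3 then show ?thesis by (intro exI[of _ 0] exI[of _ "-1"] exI[of _ 1]) (simp add: L_def)
        qed
      next
        case False
        then consider "k = 1" | "k = 2" | "k = 3" using eqs by auto
        then show ?thesis
        proof cases
          case 1 then show ?thesis by (intro exI[of _ 1] exI[of _ 0] exI[of _ 0]) (simp add: L_def)
        next
          case 2 then show ?thesis by (intro exI[of _ 1] exI[of _ 0] exI[of _ "-1"]) (simp add: L_def)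
        next
          case 3 then show ?thesis by (intro exI[of _ "-1"] exI[of _ 0] exI[of _ 1]) (simp add: L_def)
        qed
      qed
      show ?thesis using A B by blast
    qed
    then show ?thesis using L unfolding a_def[symmetric] b_def[symmetric]
      by (metis dvd_add dvd_mult)
  qed
  have inB: "fst e \<in> {1..int n}" "snd e \<in> {1..int n}" if "e \<in> ?S" for e
    using that by (auto simp: board_def)
  have "inj_on fst ?S"
  proof (rule inj_onI)
    fix e f assume ef: "e \<in> ?S" "f \<in> ?S" "fst e = fst f"
    then have "int n dvd snd e - snd f" using rel[OF ef(1,2)] by simp
    then have "snd e = snd f"
      using residues_inj[OF n_pos inB(2)[OF ef(1)] inB(2)[OF ef(2)]] by (simp add: mod_eq_dvd_iff)
    then show "e = f" using ef(3) by (simp add: prod_eq_iff)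
  qed
  then have "card ?S = card (fst ` ?S)" by (rule card_image[symmetric])
  also have "\<dots> \<le> 2"
  proof (rule card_two_doubles)
    show "fst ` ?S \<subseteq> {1..int n}" using inB(1) by blast
    show "int n dvd 2 * (x - y)" if "x \<in> fst ` ?S" "y \<in> fst ` ?S" for x y
    proof -
      obtain e f where "e \<in> ?S" "f \<in> ?S" "x = fst e" "y = fst f" using \<open>x \<in> _\<close> \<open>y \<in> _\<close> by blast
      then show ?thesis using rel by blast
    qed
  qed
  finally show ?thesis .
qed

definition translate :: "int \<Rightarrow> int \<Rightarrow> int \<times> int \<Rightarrow> int \<times> int" where
  "translate a b p = (rep n (fst p + a), rep n (snd p + b))"

definition shift :: "nat \<Rightarrow> int \<Rightarrow> int \<Rightarrow> int" where
  "shift k a b = (if k = 0 then a else if k = 1 then b else if k = 2 then a + b else a - b)"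

lemma line_translate: "line n k (translate a b p) = (line n k p + shift k a b) mod int n"
proof -
  have r: "(rep n x + rep n y) mod int n = (x + y) mod int n" "(rep n x - rep n y) mod int n = (x - y) mod int n" for x y
    by (metis mod_add_eq rep_mod) (metis mod_diff_eq rep_mod)
  then show ?thesis
    by (auto simp: line_def translate_def shift_def rep_mod mod_add_left_eq r intro!: arg_cong[where f = "\<lambda>z. z mod int n"])
qed

lemma translate_inverse: "p \<in> board n \<Longrightarrow> translate (- a) (- b) (translate a b p) = p"
proof -
  assume p: "p \<in> board n"
  have "rep n (rep n (x + d) + - d) = x" if "x \<in> {1..int n}" for x d
  proof -
    have "(rep n (x + d) + - d) mod int n = (x + d + - d) mod int n" by (metis mod_add_left_eq rep_mod)
    then show ?thesis using rep_unique[OF n_pos that, of "rep n (x + d) + - d"] by simp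
  qed
  then show ?thesis using p by (auto simp: translate_def board_def)
qed

lemma translate_board: "translate a b p \<in> board n"
  using rep_range[OF n_pos] by (simp add: translate_def board_def del: atLeastAtMost_iff)

lemma line_range: "line n k e \<in> {0..<int n}"
  using n_pos by (simp add: line_def)

lemma line_symmetry_torus:
  assumes "k < 4" "i \<in> {0..<int n}" "i' \<in> {0..<int n}"
  shows "\<exists>\<tau>. bij_betw \<tau> (board n) (board n) \<and>
          (\<forall>e\<in>board n. \<forall>f\<in>board n. \<forall>l<4. line n l (\<tau> e) = line n l (\<tau> f) \<longleftrightarrow> line n l e = line n l f) \<and>
          (\<forall>e\<in>board n. line n k (\<tau> e) = i' \<longleftrightarrow> line n k e = i)"
proof -
  define a b where "a = (if k = 1 then 0 else i' - i)" and "b = (if k = 1 then i' - i else 0)"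
  have sh: "shift k a b = i' - i" using assms(1) by (auto simp: shift_def a_def b_def)
  have small: "u = v" if "u \<in> {0..<int n}" "v \<in> {0..<int n}" "u mod int n = v mod int n" for u v
    using that by simp
  have "bij_betw (translate a b) (board n) (board n)"
    by (rule bij_betw_byWitness[where f' = "translate (- a) (- b)"])
       (use translate_inverse[of _ a b] translate_inverse[of _ "- a" "- b"] translate_board in auto)
  moreover have "line n l (translate a b e) = line n l (translate a b f) \<longleftrightarrow> line n l e = line n l f" for l e f
  proof -
    have "(u + s) mod int n = (v + s) mod int n \<longleftrightarrow> u mod int n = v mod int n" for u v s
      by (simp add: mod_eq_dvd_iff)
    then show ?thesis unfolding line_translate using small[OF line_range line_range, of l e l f] by auto
  qed
  moreover have "line n k (translate a b e) = i' \<longleftrightarrow> line n k e = i" for e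
  proof -
    have "(line n k e + (i' - i)) mod int n = i' mod int n \<longleftrightarrow> line n k e mod int n = i mod int n"
      by (simp add: mod_eq_dvd_iff)
    then show ?thesis unfolding line_translate sh using small[OF line_range assms(2), of k e] assms(3) by auto
  qed
  ultimately show ?thesis by blast
qed

sublocale line_system "board n" "line n" n
proof
  show "0 < n" by (rule n_pos)
  show "finite (board n)" by simp
  show "line n k e \<in> {0..<int n}" for e k by (rule line_range)
qed (use card_line_torus card_two_lines_torus line_symmetry_torus in blast)+

section \<open>Absorbers\<close>

text \<open>A diagonal of the board is blocked if its residue class, which consists of at most two
  diagonals, is used by a queen on the other one.  Then no toroidal configuration that contains
  the queen can ever use the diagonal.\<close>

definition blocked :: "nat \<Rightarrow> (int \<times> int) set \<Rightarrow> int \<Rightarrow> bool" where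
  "blocked k P z \<longleftrightarrow> (\<exists>q\<in>P. line n k q = z mod int n \<and> (if k = 2 then fst q + snd q else fst q - snd q) \<noteq> z)"

text \<open>The queens that can be switched for row \<open>r\<close> and column \<open>c\<close> because the four diagonals concerned are
  blocked.  In contrast to \<open>switches\<close>, this property is preserved when a toroidal configuration
  is extended.\<close>

definition absorbers :: "(int \<times> int) set \<Rightarrow> int \<Rightarrow> int \<Rightarrow> (int \<times> int) set" where
  "absorbers P r c = {p \<in> P. blocked 2 P (fst p + c) \<and> blocked 3 P (fst p - c) \<and>
     blocked 2 P (r + snd p) \<and> blocked 3 P (r - snd p)}"

lemma matching_nonattacking:
  assumes "matching Q"
  shows "nonattacking n Q"
  unfolding nonattacking_def
proof (intro conjI ballI impI)
  show "Q \<subseteq> board n" using assms by (simp add: matching_def)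
  fix p q assume pq: "p \<in> Q" "q \<in> Q" "p \<noteq> q"
  have ne: "line n k p \<noteq> line n k q" if "k < 4" for k
    using matching_line_unique[OF assms pq(1,2) that] pq(3) by blast
  show "fst p \<noteq> fst q" using ne[of 0] by (auto simp: line_def)
  show "snd p \<noteq> snd q" using ne[of 1] by (auto simp: line_def)
  show "fst p + snd p \<noteq> fst q + snd q" using ne[of 2] by (auto simp: line_def)
  show "fst p - snd p \<noteq> fst q - snd q" using ne[of 3] by (auto simp: line_def)
qed

lemma blocked_unused:
  assumes Q: "matching Q" and P: "P \<subseteq> Q" and q: "q \<in> Q"
  shows "blocked 2 P z \<Longrightarrow> fst q + snd q \<noteq> z" "blocked 3 P z \<Longrightarrow> fst q - snd q \<noteq> z"
proof -
  assume "blocked 2 P z"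
  then obtain p where p: "p \<in> Q" "line n 2 p = z mod int n" "fst p + snd p \<noteq> z" using P by (auto simp: blocked_def)
  show "fst q + snd q \<noteq> z"
  proof
    assume "fst q + snd q = z"
    then have "line n 2 p = line n 2 q" using p by (simp add: line_def)
    then have "p = q" using matching_line_unique[OF Q p(1) q, of 2] by simp
    then show False using p \<open>fst q + snd q = z\<close> by simp
  qed
next
  assume "blocked 3 P z"
  then obtain p where p: "p \<in> Q" "line n 3 p = z mod int n" "fst p - snd p \<noteq> z" using P by (auto simp: blocked_def)
  show "fst q - snd q \<noteq> z"
  proof
    assume "fst q - snd q = z"
    then have "line n 3 p = line n 3 q" using p by (simp add: line_def)
    then have "p = q" using matching_line_unique[OF Q p(1) q, of 3] by simp
    then show False using p \<open>fst q - snd q = z\<close> by simp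
  qed
qed

lemma absorbers_subset_switches:
  assumes Q: "matching Q" and P: "P \<subseteq> Q"
  shows "absorbers P r c \<subseteq> switches Q r c"
  using P blocked_unused[OF Q P] by (auto simp: absorbers_def switches_def free_def)

text \<open>A queen that is removed from \<open>P\<close> may be an absorber itself, and it unblocks residue classes
  on which at most four absorbers depend, as there is only one queen in each row and column.\<close>

lemma card_absorbers_le:
  assumes P: "matching P" "matching P'"
  shows "card (absorbers P r c) \<le> card (absorbers P' r c) + 5 * card (P - P')"
proof -
  define B where "B q = {p \<in> P. line n 0 p = (line n 2 q - c) mod int n} \<union> {p \<in> P. line n 0 p = (line n 3 q + c) mod int n}
    \<union> {p \<in> P. line n 1 p = (line n 2 q - r) mod int n} \<union> {p \<in> P. line n 1 p = (r - line n 3 q) mod int n}" for q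
  have fin: "finite P" "finite P'" using P matching_finite by auto
  have cB: "card (B q) \<le> 4" for q
  proof -
    have "card (B q) \<le> card {p \<in> P. line n 0 p = (line n 2 q - c) mod int n} + card {p \<in> P. line n 0 p = (line n 3 q + c) mod int n}
      + card {p \<in> P. line n 1 p = (line n 2 q - r) mod int n} + card {p \<in> P. line n 1 p = (r - line n 3 q) mod int n}"
      unfolding B_def by (intro order_trans[OF card_Un_le] add_mono card_Un_le le_refl)
    also have "\<dots> \<le> 1 + 1 + 1 + 1" by (intro add_mono card_matching_line[OF P(1)]) auto
    finally show ?thesis by simp
  qed
  have lost: "\<exists>q\<in>P - P'. line n k q = z mod int n" if "blocked k P z" "\<not> blocked k P' z" for k z
    using that by (auto simp: blocked_def)
  have "absorbers P r c \<subseteq> absorbers P' r c \<union> (P - P') \<union> (\<Union>q\<in>P - P'. B q)"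
  proof
    fix p assume p: "p \<in> absorbers P r c"
    show "p \<in> absorbers P' r c \<union> (P - P') \<union> (\<Union>q\<in>P - P'. B q)"
    proof (cases "p \<in> absorbers P' r c \<or> p \<notin> P'")
      case True
      then show ?thesis using p by (auto simp: absorbers_def)
    next
      case False
      then consider "\<not> blocked 2 P' (fst p + c)" | "\<not> blocked 3 P' (fst p - c)" | "\<not> blocked 2 P' (r + snd p)" | "\<not> blocked 3 P' (r - snd p)"
        by (auto simp: absorbers_def)
      then have "\<exists>q\<in>P - P'. p \<in> B q"
      proof cases
        case 1
        then obtain q where q: "q \<in> P - P'" "line n 2 q = (fst p + c) mod int n"
          using lost[of 2 "fst p + c"] p unfolding absorbers_def by blast
        have "line n 0 p = (line n 2 q - c) mod int n" unfolding q(2) by (simp add: line_def mod_diff_left_eq)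
        then show ?thesis using p q(1) by (intro bexI[of _ q]) (auto simp: absorbers_def B_def)
      next
        case 2
        then obtain q where q: "q \<in> P - P'" "line n 3 q = (fst p - c) mod int n"
          using lost[of 3 "fst p - c"] p unfolding absorbers_def by blast
        have "line n 0 p = (line n 3 q + c) mod int n" unfolding q(2) by (simp add: line_def mod_add_left_eq)
        then show ?thesis using p q(1) by (intro bexI[of _ q]) (auto simp: absorbers_def B_def)
      next
        case 3
        then obtain q where q: "q \<in> P - P'" "line n 2 q = (r + snd p) mod int n"
          using lost[of 2 "r + snd p"] p unfolding absorbers_def by blast
        have "line n 1 p = (line n 2 q - r) mod int n" unfolding q(2) by (simp add: line_def mod_diff_left_eq)
        then show ?thesis using p q(1) by (intro bexI[of _ q]) (auto simp: absorbers_def B_def)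
      next
        case 4
        then obtain q where q: "q \<in> P - P'" "line n 3 q = (r - snd p) mod int n"
          using lost[of 3 "r - snd p"] p unfolding absorbers_def by blast
        have "line n 1 p = (r - line n 3 q) mod int n" unfolding q(2) by (simp add: line_def mod_diff_right_eq)
        then show ?thesis using p q(1) by (intro bexI[of _ q]) (auto simp: absorbers_def B_def)
      qed
      then show ?thesis by blast
    qed
  qed
  then have "card (absorbers P r c) \<le> card (absorbers P' r c \<union> (P - P') \<union> (\<Union>q\<in>P - P'. B q))"
    using fin by (intro card_mono) (auto simp: absorbers_def B_def)
  also have "\<dots> \<le> card (absorbers P' r c) + card (P - P') + card (\<Union>q\<in>P - P'. B q)"
    by (intro order_trans[OF card_Un_le] add_mono card_Un_le le_refl)
  also have "card (\<Union>q\<in>P - P'. B q) \<le> (\<Sum>q\<in>P - P'. card (B q))" using fin by (intro card_UN_le) auto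
  also have "\<dots> \<le> (\<Sum>q\<in>P - P'. 4)" by (intro sum_mono cB)
  finally show ?thesis by simp
qed

lemma absorbers_isolated_update:
  assumes w: "set w \<subseteq> board n" "x \<in> board n"
  shows "\<bar>real (card (absorbers (isolated (w[p := x])) r c)) - card (absorbers (isolated w) r c)\<bar> \<le> 25"
proof -
  have w': "set (w[p := x]) \<subseteq> board n" using w set_update_subset_insert[of w p x] by auto
  note m = matching_isolated[OF w(1)] matching_isolated[OF w']
  have "card (absorbers (isolated (w[p := x])) r c) \<le> card (absorbers (isolated w) r c) + 25"
    "card (absorbers (isolated w) r c) \<le> card (absorbers (isolated (w[p := x])) r c) + 25"
    using card_absorbers_le[OF m(2,1), of r c] card_absorbers_le[OF m(1,2), of r c]
      card_isolated_update'[OF w, of p] card_isolated_update[OF w(1), of p x] by linarith+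
  then show ?thesis by linarith
qed

end

context torus
begin

definition other :: "nat \<Rightarrow> int \<Rightarrow> (int \<times> int) set" where
  "other k z = {q \<in> board n. line n k q = z mod int n \<and> (if k = 2 then fst q + snd q else fst q - snd q) \<noteq> z}"

lemma finite_other [simp]: "finite (other k z)"
  by (simp add: other_def)

text \<open>The diagonal of \<open>z\<close> itself has \<open>n - \<bar>z - n - 1\<bar>\<close> squares for sums and \<open>n - \<bar>z\<bar>\<close> squares for
  differences, and its residue class has \<open>n\<close>.\<close>

lemma card_diagonal_le:
  assumes "k = 2 \<or> k = 3" and D: "int D \<le> (if k = 2 then \<bar>z - int n - 1\<bar> else \<bar>z\<bar>)" "D \<le> n"
  shows "D \<le> card (other k z)"
proof -
  let ?v = "\<lambda>q :: int \<times> int. if k = 2 then fst q + snd q else fst q - snd q"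
  let ?E = "{q \<in> board n. ?v q = z}"
  define lo hi where "lo = (if k = 2 then max 1 (z - int n) else max 1 (1 + z))"
    and "hi = (if k = 2 then min (int n) (z - 1) else min (int n) (int n + z))"
  have "inj_on fst ?E" by (auto simp: inj_on_def split: if_splits)
  then have "card ?E = card (fst ` ?E)" by (rule card_image[symmetric])
  also have "\<dots> \<le> card {lo..hi}"
    by (rule card_mono) (auto simp: lo_def hi_def board_def split: if_splits)
  also have "\<dots> = nat (hi - lo + 1)" by simp
  finally have E: "card ?E \<le> nat (hi - lo + 1)" .
  have "card {q \<in> board n. line n k q = z mod int n} = n"
    using assms(1) n_pos by (intro card_line_torus) auto
  moreover have "{q \<in> board n. line n k q = z mod int n} \<subseteq> other k z \<union> ?E" by (auto simp: other_def)
  then have "card {q \<in> board n. line n k q = z mod int n} \<le> card (other k z \<union> ?E)"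
    by (intro card_mono) auto
  then have "card {q \<in> board n. line n k q = z mod int n} \<le> card (other k z) + card ?E"
    using card_Un_le order_trans by blast
  ultimately have "int n \<le> int (card (other k z)) + int (nat (hi - lo + 1))" using E by linarith
  moreover have "int (nat (hi - lo + 1)) + int D \<le> int n"
    using D n_pos by (auto simp: lo_def hi_def split: if_splits)
  ultimately show ?thesis by linarith
qed


lemma card_near: "card {x \<in> {1..int n}. \<bar>x - u\<bar> < int D} \<le> 2 * D"
proof -
  have "card {x \<in> {1..int n}. \<bar>x - u\<bar> < int D} \<le> card {u - int D + 1..u + int D - 1}"
    by (intro card_mono) auto
  then show ?thesis by simp
qed

lemma card_residue: "card {x \<in> {1..int n}. x mod int n = z mod int n} \<le> 1"
  by (rule card_le_one, rule residues_inj[OF n_pos]) auto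

text \<open>The possible blockers of the diagonal \<open>z\<close>.  A blocker has to avoid the queens \<open>P\<close> that have been
  chosen before, and also the residue classes \<open>F\<close> that are reserved for blockers to be chosen later.\<close>

definition choices :: "nat \<Rightarrow> int \<Rightarrow> (int \<times> int) set \<Rightarrow> (nat \<times> int) set \<Rightarrow> (int \<times> int) set" where
  "choices k z P F = {e \<in> other k z. (\<forall>p\<in>P. \<not> meets p e) \<and> (\<forall>(l, j)\<in>F. line n l e \<noteq> j)}"

lemma finite_choices [simp]: "finite (choices k z P F)"
  by (simp add: choices_def)

lemma card_choices:
  assumes "k = 2 \<or> k = 3" "int D \<le> (if k = 2 then \<bar>z - int n - 1\<bar> else \<bar>z\<bar>)" "D \<le> n"
    and P: "finite P" "\<And>p. p \<in> P \<Longrightarrow> line n k p \<noteq> z mod int n"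
    and F: "finite F" "\<And>l j. (l, j) \<in> F \<Longrightarrow> l < 4 \<and> l \<noteq> k"
    and le: "6 * card P + 2 * card F \<le> 32"
  shows "D - 32 \<le> card (choices k z P F)"
proof -
  have "card (other k z) \<le> card (choices k z P F) + (6 * card P + 2 * card F)"
    unfolding choices_def
    by (rule card_choose_avoiding[where k = k and i = "z mod int n"]) (use assms in \<open>auto simp: other_def\<close>)
  then show ?thesis using card_diagonal_le[OF assms(1-3)] le by linarith
qed

lemma matching_insert:
  assumes "matching M" "e \<in> board n" "\<And>p. p \<in> M \<Longrightarrow> \<not> meets p e"
  shows "matching (insert e M)" "e \<notin> M"
proof -
  have "\<not> meets e p" if "p \<in> M" for p using assms(3)[OF that] by (simp add: meets_sym)
  then show "matching (insert e M)" using assms by (auto simp: matching_def)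
  show "e \<notin> M" using assms(3)[of e] by auto
qed

text \<open>Rows and columns for which the four diagonals are so far from the long diagonals of the board that
  the other diagonals of their residue classes have at least \<open>D\<close> squares each.  The remaining conditions
  keep the four residue classes and the classes of the queen apart.\<close>

definition far_rows :: "nat \<Rightarrow> int \<Rightarrow> int \<Rightarrow> int set" where
  "far_rows D r c = {x \<in> {1..int n}. x \<noteq> r \<and> int D \<le> \<bar>x + c - int n - 1\<bar> \<and> int D \<le> \<bar>x - c\<bar>}"

definition far_cols :: "nat \<Rightarrow> int \<Rightarrow> int \<Rightarrow> int \<Rightarrow> int set" where
  "far_cols D r c x = {y \<in> {1..int n}. y \<noteq> c \<and> int D \<le> \<bar>r + y - int n - 1\<bar> \<and> int D \<le> \<bar>r - y\<bar> \<and>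
     (x + c) mod int n \<noteq> (r + y) mod int n \<and> (x - c) mod int n \<noteq> (r - y) mod int n}"

lemma finite_interval_filter: "finite {x \<in> {1..int n}. P x}"
  by (rule finite_subset[of _ "{1..int n}"]) auto

lemma finite_far [simp]: "finite (far_rows D r c)" "finite (far_cols D r c x)"
  unfolding far_rows_def far_cols_def by (rule finite_interval_filter)+

lemma card_far_rows:
  shows "n \<le> card (far_rows D r c) + 4 * D + 1"
proof -
  have "{1..int n} \<subseteq> far_rows D r c \<union> {r} \<union> {x \<in> {1..int n}. \<bar>x - (int n + 1 - c)\<bar> < int D} \<union> {x \<in> {1..int n}. \<bar>x - c\<bar> < int D}"
    by (auto simp: far_rows_def)
  then have "card {1..int n} \<le> card (far_rows D r c \<union> {r} \<union> {x \<in> {1..int n}. \<bar>x - (int n + 1 - c)\<bar> < int D} \<union> {x \<in> {1..int n}. \<bar>x - c\<bar> < int D})"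
    by (intro card_mono finite_UnI finite_far finite_interval_filter) simp_all
  also have "\<dots> \<le> card (far_rows D r c) + card {r} + 2 * D + 2 * D"
    by (intro order_trans[OF card_Un_le] add_mono card_near card_Un_le le_refl)
  finally show ?thesis by simp
qed

lemma card_far_cols: "n \<le> card (far_cols D r c x) + 4 * D + 3"
proof -
  let ?A = "{y \<in> {1..int n}. \<bar>y - (int n + 1 - r)\<bar> < int D}" and ?B = "{y \<in> {1..int n}. \<bar>y - r\<bar> < int D}"
  let ?C = "{y \<in> {1..int n}. y mod int n = (x + c - r) mod int n}"
  let ?D = "{y \<in> {1..int n}. y mod int n = (r - x + c) mod int n}"
  have e: "(x + c) mod int n = (r + y) mod int n \<Longrightarrow> y mod int n = (x + c - r) mod int n"
    "(x - c) mod int n = (r - y) mod int n \<Longrightarrow> y mod int n = (r - x + c) mod int n" for y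
    unfolding mod_eq_dvd_iff by (simp_all add: algebra_simps dvd_diff_commute)
  have "{1..int n} \<subseteq> far_cols D r c x \<union> {c} \<union> ?A \<union> ?B \<union> ?C \<union> ?D"
  proof
    fix y assume y: "y \<in> {1..int n}"
    show "y \<in> far_cols D r c x \<union> {c} \<union> ?A \<union> ?B \<union> ?C \<union> ?D"
    proof (rule ccontr)
      assume "\<not> ?thesis"
      then have n: "y \<notin> far_cols D r c x" "y \<noteq> c" "\<not> \<bar>y - (int n + 1 - r)\<bar> < int D" "\<not> \<bar>y - r\<bar> < int D"
        "y mod int n \<noteq> (x + c - r) mod int n" "y mod int n \<noteq> (r - x + c) mod int n"
        using y by blast+
      have "int D \<le> \<bar>r + y - int n - 1\<bar>" "int D \<le> \<bar>r - y\<bar>" using n(3,4) by linarith+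
      then have "y \<in> far_cols D r c x" unfolding far_cols_def using y n(2,5,6) e by blast
      then show False using n(1) by simp
    qed
  qed
  then have "card {1..int n} \<le> card (far_cols D r c x \<union> {c} \<union> ?A \<union> ?B \<union> ?C \<union> ?D)"
    by (intro card_mono finite_UnI finite_far finite_interval_filter) simp_all
  also have "\<dots> \<le> card (far_cols D r c x) + card {c} + 2 * D + 2 * D + 1 + 1"
    by (intro order_trans[OF card_Un_le] add_mono card_near card_residue card_Un_le le_refl)
  finally show ?thesis by simp
qed

abbreviation "choices1 r c x y \<equiv> choices 2 (x + c) {(x, y)} {(3, (x - c) mod int n), (3, (r - y) mod int n)}"
abbreviation "choices2 r c x y q1 \<equiv> choices 3 (x - c) {(x, y), q1} {(2, (r + y) mod int n)}"
abbreviation "choices3 r c x y q1 q2 \<equiv> choices 2 (r + y) {(x, y), q1, q2} {(3, (r - y) mod int n)}"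
abbreviation "choices4 r c x y q1 q2 q3 \<equiv> choices 3 (r - y) {(x, y), q1, q2, q3} {}"

text \<open>An absorber \<open>(x, y)\<close> together with the queens that block its four diagonals, chosen one after the
  other.\<close>

definition patterns :: "nat \<Rightarrow> int \<Rightarrow> int \<Rightarrow> (int \<times> int \<times> (int \<times> int) \<times> (int \<times> int) \<times> (int \<times> int) \<times> (int \<times> int)) set" where
  "patterns D r c = (SIGMA x:far_rows D r c. SIGMA y:far_cols D r c x. SIGMA q1:choices1 r c x y.
     SIGMA q2:choices2 r c x y q1. SIGMA q3:choices3 r c x y q1 q2. choices4 r c x y q1 q2 q3)"

definition queens_of :: "int \<times> int \<times> (int \<times> int) \<times> (int \<times> int) \<times> (int \<times> int) \<times> (int \<times> int) \<Rightarrow> (int \<times> int) set" where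
  "queens_of = (\<lambda>(x, y, q1, q2, q3, q4). {q4, q3, q2, q1, (x, y)})"

lemma finite_patterns [simp]: "finite (patterns D r c)"
  unfolding patterns_def by (intro finite_SigmaI) simp_all

lemma other_line: "q \<in> choices k z P F \<Longrightarrow> line n k q = z mod int n"
  by (simp add: choices_def other_def)

context
  fixes D :: nat and r c x y :: int
  assumes D: "D \<le> n" and rc: "r \<in> {1..int n}" "c \<in> {1..int n}"
    and x: "x \<in> far_rows D r c" and y: "y \<in> far_cols D r c x"
begin

lemma xy_lines:
  "line n 2 (x, y) \<noteq> (x + c) mod int n" "line n 2 (x, y) \<noteq> (r + y) mod int n"
  "line n 3 (x, y) \<noteq> (x - c) mod int n" "line n 3 (x, y) \<noteq> (r - y) mod int n"
proof -
  have xR: "x \<in> {1..int n}" "x \<noteq> r" and yR: "y \<in> {1..int n}" "y \<noteq> c"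
    using x y by (auto simp: far_rows_def far_cols_def)
  have xr: "x mod int n \<noteq> r mod int n" using residues_inj[OF n_pos xR(1) rc(1)] xR(2) by blast
  have yc: "y mod int n \<noteq> c mod int n" using residues_inj[OF n_pos yR(1) rc(2)] yR(2) by blast
  show "line n 2 (x, y) \<noteq> (x + c) mod int n" "line n 3 (x, y) \<noteq> (x - c) mod int n"
    using yc by (auto simp: line_def mod_eq_dvd_iff dvd_diff_commute)
  show "line n 2 (x, y) \<noteq> (r + y) mod int n" "line n 3 (x, y) \<noteq> (r - y) mod int n"
    using xr by (auto simp: line_def mod_eq_dvd_iff)
qed

lemma classes_differ: "(x + c) mod int n \<noteq> (r + y) mod int n" "(x - c) mod int n \<noteq> (r - y) mod int n"
  using y by (auto simp: far_cols_def)

lemma dist: "int D \<le> \<bar>x + c - int n - 1\<bar>" "int D \<le> \<bar>x - c\<bar>" "int D \<le> \<bar>r + y - int n - 1\<bar>" "int D \<le> \<bar>r - y\<bar>"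
  using x y by (auto simp: far_rows_def far_cols_def)

lemma card_choices1: "D - 32 \<le> card (choices1 r c x y)"
  by (rule card_choices[OF _ _ D]) (use xy_lines dist in \<open>auto simp: card_insert_if\<close>)

lemma card_choices2:
  assumes "q1 \<in> choices1 r c x y"
  shows "D - 32 \<le> card (choices2 r c x y q1)"
  using assms by (intro card_choices[OF _ _ D]) (use xy_lines dist in \<open>auto simp: card_insert_if choices_def\<close>)

lemma card_choices3:
  assumes "q1 \<in> choices1 r c x y" "q2 \<in> choices2 r c x y q1"
  shows "D - 32 \<le> card (choices3 r c x y q1 q2)"
proof -
  have "line n 2 q1 \<noteq> (r + y) mod int n" using other_line[OF assms(1)] classes_differ by simp
  moreover have "line n 2 q2 \<noteq> (r + y) mod int n" using assms(2) by (auto simp: choices_def)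
  ultimately show ?thesis
    by (intro card_choices[OF _ _ D]) (use xy_lines dist in \<open>auto simp: card_insert_if\<close>)
qed

lemma card_choices4:
  assumes "q1 \<in> choices1 r c x y" "q2 \<in> choices2 r c x y q1" "q3 \<in> choices3 r c x y q1 q2"
  shows "D - 32 \<le> card (choices4 r c x y q1 q2 q3)"
proof -
  have "line n 3 q2 \<noteq> (r - y) mod int n" using other_line[OF assms(2)] classes_differ by simp
  moreover have "line n 3 q1 \<noteq> (r - y) mod int n" "line n 3 q3 \<noteq> (r - y) mod int n"
    using assms(1,3) by (auto simp: choices_def)
  ultimately show ?thesis
    by (intro card_choices[OF _ _ D]) (use xy_lines dist in \<open>auto simp: card_insert_if\<close>)
qed

lemma pattern_matching:
  assumes q: "q1 \<in> choices1 r c x y" "q2 \<in> choices2 r c x y q1" "q3 \<in> choices3 r c x y q1 q2" "q4 \<in> choices4 r c x y q1 q2 q3"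
  shows "matching {q4, q3, q2, q1, (x, y)}" "card {q4, q3, q2, q1, (x, y)} = 5"
proof -
  have "(x, y) \<in> board n" using x y by (simp add: far_rows_def far_cols_def board_def)
  then have m0: "matching {(x, y)}" by (simp add: matching_def)
  have b: "q1 \<in> board n" "q2 \<in> board n" "q3 \<in> board n" "q4 \<in> board n"
    using q by (auto simp: choices_def other_def)
  have m1: "matching {q1, (x, y)}" "q1 \<notin> {(x, y)}"
    using q(1) by (intro matching_insert[OF m0 b(1)]; auto simp: choices_def)+
  have m2: "matching {q2, q1, (x, y)}" "q2 \<notin> {q1, (x, y)}"
    using q(2) by (intro matching_insert[OF m1(1) b(2)]; auto simp: choices_def)+
  have m3: "matching {q3, q2, q1, (x, y)}" "q3 \<notin> {q2, q1, (x, y)}"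
    using q(3) by (intro matching_insert[OF m2(1) b(3)]; auto simp: choices_def)+
  have m4: "matching {q4, q3, q2, q1, (x, y)}" "q4 \<notin> {q3, q2, q1, (x, y)}"
    using q(4) by (intro matching_insert[OF m3(1) b(4)]; auto simp: choices_def)+
  show "matching {q4, q3, q2, q1, (x, y)}" by (rule m4(1))
  show "card {q4, q3, q2, q1, (x, y)} = 5"
    using m1(2) m2(2) m3(2) m4(2) by simp
qed

lemma pattern_absorber:
  assumes q: "q1 \<in> choices1 r c x y" "q2 \<in> choices2 r c x y q1" "q3 \<in> choices3 r c x y q1 q2" "q4 \<in> choices4 r c x y q1 q2 q3"
    and P: "{q4, q3, q2, q1, (x, y)} \<subseteq> P"
  shows "(x, y) \<in> absorbers P r c"
proof -
  have "q1 \<in> other 2 (x + c)" "q2 \<in> other 3 (x - c)" "q3 \<in> other 2 (r + y)" "q4 \<in> other 3 (r - y)"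
    using q by (auto simp: choices_def)
  then have "blocked 2 P (x + c)" "blocked 3 P (x - c)" "blocked 2 P (r + y)" "blocked 3 P (r - y)"
    using P unfolding blocked_def other_def by (intro bexI[of _ q1] bexI[of _ q2] bexI[of _ q3] bexI[of _ q4]; simp)+
  then show ?thesis using P by (simp add: absorbers_def)
qed

end

lemma card_patterns:
  assumes r: "r \<in> {1..int n}" and c: "c \<in> {1..int n}" and D: "D \<le> n"
  shows "(n - (4 * D + 1)) * ((n - (4 * D + 3)) * ((D - 32) * ((D - 32) * ((D - 32) * (D - 32))))) \<le> card (patterns D r c)"
proof -
  let ?m = "D - 32"
  note [simp] = finite_SigmaI
  have 4: "?m * ?m \<le> card (SIGMA q3:choices3 r c x y q1 q2. choices4 r c x y q1 q2 q3)"
    if "x \<in> far_rows D r c" "y \<in> far_cols D r c x" "q1 \<in> choices1 r c x y" "q2 \<in> choices2 r c x y q1" for x y q1 q2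
    using card_Sigma_ge[where X = "choices3 r c x y q1 q2" and Y = "choices4 r c x y q1 q2" and m = ?m]
      card_choices4[OF D r c that] card_choices3[OF D r c that] by (meson finite_choices mult_le_mono1 order_trans)
  have 3: "?m * (?m * ?m) \<le> card (SIGMA q2:choices2 r c x y q1. SIGMA q3:choices3 r c x y q1 q2. choices4 r c x y q1 q2 q3)"
    if "x \<in> far_rows D r c" "y \<in> far_cols D r c x" "q1 \<in> choices1 r c x y" for x y q1
  proof -
    have "card (choices2 r c x y q1) * (?m * ?m) \<le> card (SIGMA q2:choices2 r c x y q1. SIGMA q3:choices3 r c x y q1 q2. choices4 r c x y q1 q2 q3)"
      by (rule card_Sigma_ge) (use 4[OF that] in simp_all)
    then show ?thesis using card_choices2[OF D r c that] by (meson mult_le_mono1 order_trans)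
  qed
  have 2: "?m * (?m * (?m * ?m)) \<le> card (SIGMA q1:choices1 r c x y. SIGMA q2:choices2 r c x y q1. SIGMA q3:choices3 r c x y q1 q2. choices4 r c x y q1 q2 q3)"
    if "x \<in> far_rows D r c" "y \<in> far_cols D r c x" for x y
  proof -
    have "card (choices1 r c x y) * (?m * (?m * ?m)) \<le> card (SIGMA q1:choices1 r c x y. SIGMA q2:choices2 r c x y q1. SIGMA q3:choices3 r c x y q1 q2. choices4 r c x y q1 q2 q3)"
      by (rule card_Sigma_ge) (use 3[OF that] in simp_all)
    then show ?thesis using card_choices1[OF D r c that] by (meson mult_le_mono1 order_trans)
  qed
  have 1: "(n - (4 * D + 3)) * (?m * (?m * (?m * ?m))) \<le> card (SIGMA y:far_cols D r c x. SIGMA q1:choices1 r c x y. SIGMA q2:choices2 r c x y q1. SIGMA q3:choices3 r c x y q1 q2. choices4 r c x y q1 q2 q3)"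
    if "x \<in> far_rows D r c" for x
  proof -
    have "card (far_cols D r c x) * (?m * (?m * (?m * ?m))) \<le> card (SIGMA y:far_cols D r c x. SIGMA q1:choices1 r c x y. SIGMA q2:choices2 r c x y q1. SIGMA q3:choices3 r c x y q1 q2. choices4 r c x y q1 q2 q3)"
      by (rule card_Sigma_ge) (use 2[OF that] in simp_all)
    moreover have "n - (4 * D + 3) \<le> card (far_cols D r c x)" using card_far_cols[of D r c x] by linarith
    ultimately show ?thesis by (meson mult_le_mono1 order_trans)
  qed
  have "card (far_rows D r c) * ((n - (4 * D + 3)) * (?m * (?m * (?m * ?m)))) \<le> card (patterns D r c)"
    unfolding patterns_def by (rule card_Sigma_ge) (use 1 in simp_all)
  moreover have "n - (4 * D + 1) \<le> card (far_rows D r c)" using card_far_rows[of D r c] by linarith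
  ultimately show ?thesis by (meson mult_le_mono1 order_trans)
qed

text \<open>Two patterns with the same first queen agree: the other queens lie on prescribed lines, on
  which isolated samples are unique.\<close>

lemma card_patterns_le_absorbers:
  assumes r: "r \<in> {1..int n}" and c: "c \<in> {1..int n}" and D: "D \<le> n" and P: "matching P"
  shows "card {g \<in> patterns D r c. queens_of g \<subseteq> P} \<le> card (absorbers P r c)"
proof (rule card_inj_on_le[where f = "\<lambda>(x, y, _). (x, y)"])
  let ?G = "{g \<in> patterns D r c. queens_of g \<subseteq> P}"
  have dest: "x \<in> far_rows D r c" "y \<in> far_cols D r c x" "q1 \<in> choices1 r c x y" "q2 \<in> choices2 r c x y q1"
    "q3 \<in> choices3 r c x y q1 q2" "q4 \<in> choices4 r c x y q1 q2 q3" "{q4, q3, q2, q1, (x, y)} \<subseteq> P"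
    if "(x, y, q1, q2, q3, q4) \<in> ?G" for x y q1 q2 q3 q4
    using that by (auto simp: patterns_def queens_of_def)
  show "(\<lambda>(x, y, _). (x, y)) ` ?G \<subseteq> absorbers P r c"
  proof
    fix p assume "p \<in> (\<lambda>(x, y, _). (x, y)) ` ?G"
    then obtain x y q1 q2 q3 q4 where g: "(x, y, q1, q2, q3, q4) \<in> ?G" and p: "p = (x, y)" by auto
    show "p \<in> absorbers P r c" unfolding p by (rule pattern_absorber[OF D r c dest[OF g]])
  qed
  show "inj_on (\<lambda>(x, y, _). (x, y)) ?G"
  proof (rule inj_onI)
    fix g g' assume gg: "g \<in> ?G" "g' \<in> ?G" and eq: "(\<lambda>(x, y, _). (x, y)) g = (\<lambda>(x, y, _). (x, y)) g'"
    obtain x y q1 q2 q3 q4 where g: "g = (x, y, q1, q2, q3, q4)" by (metis surj_pair)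
    obtain x' y' p1 p2 p3 p4 where g': "g' = (x', y', p1, p2, p3, p4)" by (metis surj_pair)
    have xy: "x' = x" "y' = y" using eq by (simp_all add: g g')
    note d = dest[OF gg(1)[unfolded g]] and d' = dest[OF gg(2)[unfolded g' xy]]
    have in_P: "q1 \<in> P" "q2 \<in> P" "q3 \<in> P" "q4 \<in> P" "p1 \<in> P" "p2 \<in> P" "p3 \<in> P" "p4 \<in> P"
      using d(7) d'(7) by auto
    have "q1 = p1"
      by (rule matching_line_unique[OF P in_P(1,5), of 2]) (simp_all add: other_line[OF d(3)] other_line[OF d'(3)])
    moreover have "q2 = p2"
      by (rule matching_line_unique[OF P in_P(2,6), of 3]) (simp_all add: other_line[OF d(4)] other_line[OF d'(4)])
    moreover have "q3 = p3"
      by (rule matching_line_unique[OF P in_P(3,7), of 2]) (simp_all add: other_line[OF d(5)] other_line[OF d'(5)])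
    moreover have "q4 = p4"
      by (rule matching_line_unique[OF P in_P(4,8), of 3]) (simp_all add: other_line[OF d(6)] other_line[OF d'(6)])
    ultimately show "g = g'" by (simp add: g g' xy)
  qed
  show "finite (absorbers P r c)" using matching_finite[OF P] by (simp add: absorbers_def)
qed

lemma mean_absorbers_ge_patterns:
  assumes r: "r \<in> {1..int n}" and c: "c \<in> {1..int n}" and D: "D \<le> n" and n: "20 < n"
  shows "mean (words (board n) t) (\<lambda>w. real (card (absorbers (isolated w) r c)))
    \<ge> card (patterns D r c) * (real (t choose 5) * fact 5 * (1 - 20 / real n) ^ t / real n ^ 10)"
proof -
  have "card (patterns D r c) * (real (t choose 5) * fact 5 * (1 - 4 * real 5 / real n) ^ t / real n ^ (2 * 5))
    \<le> mean (words (board n) t) (\<lambda>w. real (card {g \<in> patterns D r c. queens_of g \<subseteq> isolated w}))"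
  proof (rule mean_patterns_ge)
    fix g assume "g \<in> patterns D r c"
    then obtain x y q1 q2 q3 q4 where g: "g = (x, y, q1, q2, q3, q4)" and d: "x \<in> far_rows D r c" "y \<in> far_cols D r c x"
      "q1 \<in> choices1 r c x y" "q2 \<in> choices2 r c x y q1" "q3 \<in> choices3 r c x y q1 q2" "q4 \<in> choices4 r c x y q1 q2 q3"
      by (auto simp: patterns_def)
    show "matching (queens_of g) \<and> card (queens_of g) = 5"
      unfolding g queens_of_def prod.case using pattern_matching[OF D r c d] by blast
  qed (use n in simp_all)
  also have "\<dots> \<le> mean (words (board n) t) (\<lambda>w. real (card (absorbers (isolated w) r c)))"
    unfolding mean_def
  proof (intro divide_right_mono sum_mono)
    fix w assume "w \<in> words (board n) t"
    then have "matching (isolated w)" by (intro matching_isolated) (simp add: words_def)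
    then show "real (card {g \<in> patterns D r c. queens_of g \<subseteq> isolated w}) \<le> real (card (absorbers (isolated w) r c))"
      using card_patterns_le_absorbers[OF r c D] by simp
  qed simp
  finally show ?thesis by simp
qed

end

text \<open>There are at least \<open>n ^ 6 / 2 ^ 20\<close> patterns, and each of them is isolated with probability at least
  \<open>(n / 160) ^ 5 / (2 * n ^ 10)\<close> among \<open>n / 80\<close> to \<open>n / 40\<close> samples.  This constant is half of the
  resulting lower bound for the expected number of absorbers, divided by \<open>n\<close>.\<close>

definition absorb_const :: real where
  "absorb_const = 1 / (2 ^ 22 * 160 ^ 5)"

lemma absorb_const_pos: "absorb_const > 0"
  by (simp add: absorb_const_def)

text \<open>The product is the falling factorial of \<open>t\<close> of length five, whose factors are at least \<open>t - 4\<close>.\<close>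

lemma falling_factorial_5_ge:
  assumes "t \<ge> 8"
  shows "(real t / 2) ^ 5 \<le> real (t choose 5) * fact 5"
proof -
  have "5 \<le> t" using assms by simp
  then obtain d where "t = 5 + d" by (rule le_Suc_ex[THEN exE])
  then have d: "t = d + 5" by simp
  have t5: "t = Suc (Suc (Suc (Suc (Suc d))))" using d by simp
  have "fact 5 * fact d * (t choose 5) = (fact t :: nat)"
    using binomial_fact_lemma[of 5 t] d by simp
  then have "real (fact 5 * fact d * (t choose 5)) = real (fact t)" by (rule arg_cong)
  then have "real (t choose 5) * fact 5 * fact d = fact t" by (simp only: of_nat_mult of_nat_fact mult_ac)
  also have "fact t = (real d + 5) * ((real d + 4) * ((real d + 3) * ((real d + 2) * ((real d + 1) * fact d))))"
    unfolding t5 fact_Suc by (intro arg_cong2[where f = "(*)"] refl) simp_all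
  finally have "(real (t choose 5) * fact 5) * fact d
      = ((real d + 5) * (real d + 4) * (real d + 3) * (real d + 2) * (real d + 1)) * fact d"
    by (simp only: mult.assoc)
  then have eq: "real (t choose 5) * fact 5 = (real d + 5) * (real d + 4) * (real d + 3) * (real d + 2) * (real d + 1)"
    by (simp only: mult_cancel_right fact_nonzero simp_thms)
  have "real t / 2 \<le> real d + 1" using d assms by simp
  then have "(real t / 2) ^ 5 \<le> (real d + 1) ^ 5" by (intro power_mono) auto
  also have "\<dots> = (real d + 1) * (real d + 1) * (real d + 1) * (real d + 1) * (real d + 1)" by (simp add: eval_nat_numeral)
  also have "\<dots> \<le> (real d + 5) * (real d + 4) * (real d + 3) * (real d + 2) * (real d + 1)"
    by (intro mult_mono) auto
  finally show ?thesis using eq by simp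
qed

context torus
begin

lemma mean_absorbers_ge:
  assumes r: "r \<in> {1..int n}" and c: "c \<in> {1..int n}" and n: "1024 \<le> n" and t: "n \<le> 80 * t" "40 * t \<le> n"
  shows "mean (words (board n) t) (\<lambda>w. real (card (absorbers (isolated w) r c))) \<ge> 2 * absorb_const * n"
proof -
  define D where "D = n div 8"
  have D: "D \<le> n" "real D \<ge> real n / 8 - 1" "8 * real D \<le> real n" by (auto simp: D_def)
  have nr: "real n \<ge> 1024" using n by simp
  have D32: "real (D - 32) \<ge> real n / 16" using D nr by linarith
  have a: "real (n - (4 * D + 3)) \<ge> real n / 4" "real (n - (4 * D + 1)) \<ge> real n / 4" using D nr by linarith+
  have "real n ^ 6 / 2 ^ 20 = real n / 4 * (real n / 4 * (real n / 16 * (real n / 16 * (real n / 16 * (real n / 16)))))"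
    by (simp add: eval_nat_numeral)
  also have "\<dots> \<le> real (n - (4 * D + 1)) * (real (n - (4 * D + 3)) * (real (D - 32) * (real (D - 32) * (real (D - 32) * real (D - 32)))))"
    using a D32 by (intro mult_mono) auto
  also have "\<dots> = real ((n - (4 * D + 1)) * ((n - (4 * D + 3)) * ((D - 32) * ((D - 32) * ((D - 32) * (D - 32))))))"
    by (simp only: of_nat_mult)
  also have "\<dots> \<le> real (card (patterns D r c))"
    using card_patterns[OF r c D(1)] by (simp only: of_nat_le_iff)
  finally have pat: "real n ^ 6 / 2 ^ 20 \<le> real (card (patterns D r c))" .
  have t8: "t \<ge> 8" using n t by linarith
  have "real n / 160 \<le> real t / 2" using t(1) by linarith
  then have "(real n / 160) ^ 5 \<le> (real t / 2) ^ 5" by (intro power_mono) auto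
  then have choose: "(real n / 160) ^ 5 \<le> real (t choose 5) * fact 5" using falling_factorial_5_ge[OF t8] by linarith
  have "1 / 2 \<le> 1 + real t * (- 20 / real n)"
  proof -
    have "40 * real t \<le> real n" using t(2) by linarith
    then show ?thesis using nr by (simp add: field_simps)
  qed
  also have "\<dots> \<le> (1 + (- 20 / real n)) ^ t" using nr by (intro Bernoulli_inequality) (simp add: field_simps)
  finally have half: "1 / 2 \<le> (1 - 20 / real n) ^ t" by simp
  have "2 * absorb_const * n = real n ^ 6 / 2 ^ 20 * ((real n / 160) ^ 5 * (1 / 2) / real n ^ 10)"
  proof -
    have "real n ^ 6 * real n ^ 5 = real n * real n ^ 10" by (simp flip: power_add power_Suc)
    then have "real n ^ 6 * real n ^ 5 / real n ^ 10 = real n" using nr by simp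
    then have "real n = real n ^ 6 * real n ^ 5 / real n ^ 10" by (rule sym)
    then have "2 * absorb_const * n = 2 * absorb_const * (real n ^ 6 * real n ^ 5 / real n ^ 10)" by (rule arg_cong)
    then show ?thesis by (simp add: absorb_const_def power_divide)
  qed
  also have "\<dots> \<le> card (patterns D r c) * (real (t choose 5) * fact 5 * (1 - 20 / real n) ^ t / real n ^ 10)"
    using pat choose half by (intro mult_mono divide_right_mono) auto
  also have "\<dots> \<le> mean (words (board n) t) (\<lambda>w. real (card (absorbers (isolated w) r c)))"
    using n by (intro mean_absorbers_ge_patterns r c D(1)) simp
  finally show ?thesis .
qed

definition absorbing :: "(int \<times> int) set \<Rightarrow> bool" where
  "absorbing P \<longleftrightarrow> (\<forall>r\<in>{1..int n}. \<forall>c\<in>{1..int n}. absorb_const * n \<le> card (absorbers P r c))"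

lemma card_not_absorbing:
  assumes n: "1024 \<le> n" and t: "n \<le> 80 * t" "40 * t \<le> n"
  shows "card {w \<in> words (board n) t. \<not> absorbing (isolated w)}
    \<le> 2 * real n ^ 2 * card (words (board n) t) * exp (- ((absorb_const * n)\<^sup>2 / (4 * real t * 25\<^sup>2)))"
proof -
  let ?W = "words (board n) t" and ?a = "absorb_const * n"
  define f where "f = (\<lambda>(r, c) w. real (card (absorbers (isolated w) r c)))"
  let ?I = "{1..int n} \<times> {1..int n}"
  let ?B = "\<lambda>i. {w \<in> ?W. \<bar>f i w - mean ?W (f i)\<bar> \<ge> ?a}"
  have t0: "t > 0" using n t by linarith
  have a0: "?a \<ge> 0" using absorb_const_pos by simp
  have "{w \<in> ?W. \<not> absorbing (isolated w)} \<subseteq> (\<Union>i\<in>?I. ?B i)"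
  proof
    fix w assume w: "w \<in> {w \<in> ?W. \<not> absorbing (isolated w)}"
    then obtain r c where rc: "r \<in> {1..int n}" "c \<in> {1..int n}" "\<not> ?a \<le> card (absorbers (isolated w) r c)"
      by (auto simp: absorbing_def)
    then have "f (r, c) w < ?a" by (simp add: f_def)
    moreover have "mean ?W (f (r, c)) \<ge> 2 * absorb_const * n"
      using mean_absorbers_ge[OF rc(1,2) n t] by (simp add: f_def)
    ultimately have "\<bar>f (r, c) w - mean ?W (f (r, c))\<bar> \<ge> ?a" by linarith
    then show "w \<in> (\<Union>i\<in>?I. ?B i)" using w rc(1,2) by (intro UN_I[of "(r, c)"]) auto
  qed
  then have "card {w \<in> ?W. \<not> absorbing (isolated w)} \<le> card (\<Union>i\<in>?I. ?B i)"
    by (intro card_mono) auto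
  also have "\<dots> \<le> (\<Sum>i\<in>?I. card (?B i))" by (rule card_UN_le) auto
  finally have "real (card {w \<in> ?W. \<not> absorbing (isolated w)}) \<le> real (\<Sum>i\<in>?I. card (?B i))"
    by (simp only: of_nat_le_iff)
  also have "\<dots> = (\<Sum>i\<in>?I. real (card (?B i)))" by (rule of_nat_sum)
  also have "\<dots> \<le> (\<Sum>i\<in>?I. 2 * card ?W * exp (- (?a\<^sup>2 / (4 * real t * 25\<^sup>2))))"
  proof (rule sum_mono)
    fix i
    show "real (card (?B i)) \<le> 2 * card ?W * exp (- (?a\<^sup>2 / (4 * real t * 25\<^sup>2)))"
    proof (rule bounded_differences_tail[OF finite_A A_nonempty _ _ t0 a0])
      fix w p x assume "w \<in> ?W" "p < t" "x \<in> board n"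
      then show "\<bar>f i (w[p := x]) - f i w\<bar> \<le> 25"
        using absorbers_isolated_update[of w x p "fst i" "snd i"] by (simp add: f_def words_def case_prod_unfold)
    qed simp
  qed
  finally show ?thesis by (simp add: card_cartesian_product power2_eq_square mult_ac)
qed

lemma card_words_prefix:
  assumes "t \<le> T"
  shows "card {w \<in> words (board n) T. P (take t w)} = card {w \<in> words (board n) t. P w} * card (words (board n) (T - t))"
proof -
  have "card {w \<in> words (board n) T. P (take t w)} = (\<Sum>w\<in>words (board n) T. if P (take t w) then 1 else 0)"
    by (simp add: sum.If_cases Int_def)
  also have "\<dots> = (\<Sum>u\<in>words (board n) t. \<Sum>v\<in>words (board n) (T - t). if P (take t (u @ v)) then 1 else 0)"
    using sum_words_append[OF finite_A, of "\<lambda>w. if P (take t w) then 1 else (0::nat)" t "T - t"] assms by simp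
  also have "\<dots> = (\<Sum>u\<in>words (board n) t. \<Sum>v\<in>words (board n) (T - t). if P u then 1 else 0)"
    by (intro sum.cong refl) (simp add: words_def)
  also have "\<dots> = (\<Sum>u\<in>words (board n) t. (if P u then 1 else 0) * card (words (board n) (T - t)))"
    by (intro sum.cong refl) simp
  also have "\<dots> = (\<Sum>u\<in>words (board n) t. if P u then 1 else 0) * card (words (board n) (T - t))"
    by (simp add: sum_distrib_right)
  also have "(\<Sum>u\<in>words (board n) t. if P u then 1 else 0) = card {w \<in> words (board n) t. P w}"
    by (simp add: sum.If_cases Int_def)
  finally show ?thesis .
qed

end

section \<open>The explicit lower bound\<close>

text \<open>By induction, from \<open>(1 + 1 / n) ^ n \<le> exp 1\<close>.\<close>

lemma fact_ge_power_div_exp: "(real n / exp 1) ^ n \<le> fact n"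
proof (induction n)
  case (Suc n)
  show ?case
  proof (cases "n = 0")
    case False
    have "(1 + 1 / real n) ^ n \<le> exp 1" using False by (intro exp_ge_one_plus_x_over_n_power_n) auto
    moreover have "1 + 1 / real n = real (Suc n) / real n" using False by (simp add: field_simps)
    ultimately have "real (Suc n) ^ n \<le> exp 1 * real n ^ n" using False by (simp add: power_divide field_simps)
    then have "real (Suc n) * real (Suc n) ^ n / (exp 1 * exp 1 ^ n) \<le> real (Suc n) * (exp 1 * real n ^ n) / (exp 1 * exp 1 ^ n)"
      by (intro divide_right_mono mult_left_mono) auto
    then have "(real (Suc n) / exp 1) ^ Suc n \<le> real (Suc n) * (real n / exp 1) ^ n"
      by (simp only: power_divide power_Suc) simp
    also have "\<dots> \<le> real (Suc n) * fact n" by (intro mult_left_mono Suc) simp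
    finally show ?thesis by simp
  qed simp
qed simp

text \<open>Up to the factors \<open>h ^ n\<close>, \<open>(m / n) ^ u\<close>, \<open>b\<close> and \<open>Z\<close>, the number of matchings with \<open>n - u\<close> queens
  times the number of their completions is
  \<open>(fact n / fact u) ^ 4 * (fact u)\<^sup>2 * n ^ u / (fact (n - u) * n ^ (2 * n))\<close>.  By \<open>fact (n - u) * fact u \<le> fact n\<close>
  and \<open>fact u \<le> n ^ u\<close> this is at least \<open>fact n ^ 3 / n ^ (2 * n)\<close>.\<close>

lemma counting_arithmetic:
  fixes h Z m :: real
  assumes u: "u \<le> n" and n: "n > 0" and h: "0 < h" "h \<le> 1" and Z: "Z > 0" and m: "m \<ge> 0"
    and S: "b \<le> S * (Z * fact (n - u) * ((real n)\<^sup>2 / h) ^ (n - u) * (fact u / fact n) ^ 4)"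
    and Q: "S * ((fact u)\<^sup>2 * m ^ u) \<le> Q * (real n ^ 2) ^ u" and b: "b \<ge> 0"
  shows "Q \<ge> (n * exp (- 3)) ^ n * (h ^ n * (m / n) ^ u * b / Z)"
proof -
  let ?n = "real n"
  have np: "?n > 0" using n by simp
  define E where "E = fact (n - u) * (?n\<^sup>2 / h) ^ (n - u) * (fact u / fact n) ^ 4"
  have E0: "E > 0" using h np by (simp add: E_def)
  have "b \<le> S * (Z * E)" using S by (simp add: E_def mult.assoc)
  then have "b * ((fact u)\<^sup>2 * m ^ u) \<le> S * (Z * E) * ((fact u)\<^sup>2 * m ^ u)"
    using m by (intro mult_right_mono) auto
  also have "\<dots> = (Z * E) * (S * ((fact u)\<^sup>2 * m ^ u))" by simp
  also have "\<dots> \<le> (Z * E) * (Q * (?n ^ 2) ^ u)" using Q Z E0 by (intro mult_left_mono) auto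
  finally have main: "b * m ^ u * (fact u)\<^sup>2 \<le> Q * Z * (E * (?n ^ 2) ^ u)" by (simp add: mult_ac)
  have key: "(?n * exp (- 3)) ^ n * h ^ n * (E * (?n ^ 2) ^ u) \<le> ?n ^ u * (fact u)\<^sup>2"
  proof -
    have hE: "h ^ n * (?n\<^sup>2 / h) ^ (n - u) \<le> (?n\<^sup>2) ^ (n - u)"
    proof -
      have "h ^ n = h ^ (n - u) * h ^ u" using u by (simp flip: power_add)
      then have "h ^ n * (?n\<^sup>2 / h) ^ (n - u) = h ^ u * (?n\<^sup>2) ^ (n - u)" using h by (simp add: power_divide)
      also have "\<dots> \<le> 1 * (?n\<^sup>2) ^ (n - u)" using h by (intro mult_right_mono power_le_one) auto
      finally show ?thesis by simp
    qed
    have ff: "fact (n - u) * fact u \<le> (fact n :: real)"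
    proof -
      have "fact u * fact (n - u) * (n choose u) = (fact n :: nat)" by (rule binomial_fact_lemma[OF u])
      moreover have "(n choose u) \<ge> 1" using u by (simp add: Suc_leI zero_less_binomial)
      ultimately have "fact u * fact (n - u) * 1 \<le> (fact n :: nat)" by (metis mult_le_mono2)
      then have "real (fact u * fact (n - u)) \<le> real (fact n)" by (simp only: of_nat_le_iff mult_1_right)
      then show ?thesis by (simp add: mult.commute)
    qed
    have fu: "(fact u :: real) \<le> ?n ^ u"
    proof -
      have "(fact u :: real) \<le> real (u ^ u)" by (rule fact_le_power)
      also have "\<dots> \<le> ?n ^ u" using u by (simp add: power_mono)
      finally show ?thesis .
    qed
    have e3: "(?n * exp (- 3)) ^ n * (?n\<^sup>2) ^ n \<le> fact n ^ 3"
    proof -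
      have "exp (- 3) = (1 / exp 1 :: real) ^ 3" by (simp add: exp_minus field_simps flip: exp_of_nat_mult)
      then have "?n * exp (- 3) * ?n\<^sup>2 = (?n / exp 1) ^ 3" by (simp add: power_divide power2_eq_square power3_eq_cube)
      then have "(?n * exp (- 3)) ^ n * (?n\<^sup>2) ^ n = ((?n / exp 1) ^ 3) ^ n" by (simp only: power_mult_distrib[symmetric])
      also have "\<dots> = ((?n / exp 1) ^ n) ^ 3" by (simp only: power_mult[symmetric] mult.commute)
      also have "\<dots> \<le> fact n ^ 3" by (intro power_mono fact_ge_power_div_exp) simp
      finally show ?thesis .
    qed
    have "(?n * exp (- 3)) ^ n * h ^ n * (E * (?n ^ 2) ^ u)
        = (?n * exp (- 3)) ^ n * (fact (n - u) * (fact u / fact n) ^ 4) * ((h ^ n * (?n\<^sup>2 / h) ^ (n - u)) * (?n ^ 2) ^ u)"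
      by (simp add: E_def mult_ac)
    also have "\<dots> \<le> (?n * exp (- 3)) ^ n * (fact (n - u) * (fact u / fact n) ^ 4) * ((?n\<^sup>2) ^ (n - u) * (?n ^ 2) ^ u)"
      using hE by (intro mult_left_mono mult_right_mono) auto
    also have "(?n\<^sup>2) ^ (n - u) * (?n ^ 2) ^ u = (?n\<^sup>2) ^ n" using u by (simp flip: power_add)
    also have "(?n * exp (- 3)) ^ n * (fact (n - u) * (fact u / fact n) ^ 4) * (?n\<^sup>2) ^ n
        = ((?n * exp (- 3)) ^ n * (?n\<^sup>2) ^ n) * (fact (n - u) * (fact u / fact n) ^ 4)" by simp
    also have "\<dots> \<le> fact n ^ 3 * (fact (n - u) * (fact u / fact n) ^ 4)"
      using e3 by (intro mult_right_mono) auto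
    also have "\<dots> = (fact (n - u) * fact u) / fact n * fact u ^ 3"
      by (simp add: power_divide eval_nat_numeral)
    also have "\<dots> \<le> 1 * fact u ^ 3" using ff by (intro mult_right_mono) (auto simp: field_simps)
    also have "\<dots> = fact u * (fact u)\<^sup>2" by (simp add: eval_nat_numeral)
    also have "\<dots> \<le> ?n ^ u * (fact u)\<^sup>2" using fu by (intro mult_right_mono) auto
    finally show ?thesis .
  qed
  have G0: "E * (?n ^ 2) ^ u > 0" using E0 np by simp
  have "((n * exp (- 3)) ^ n * (h ^ n * (m / n) ^ u * b / Z)) * (Z * (E * (?n ^ 2) ^ u))
     = ((?n * exp (- 3)) ^ n * h ^ n * (E * (?n ^ 2) ^ u)) * (m ^ u * b) / ?n ^ u"
    using Z np by (simp add: power_divide)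
  also have "\<dots> \<le> (?n ^ u * (fact u)\<^sup>2) * (m ^ u * b) / ?n ^ u"
    using key m b by (intro divide_right_mono mult_right_mono) auto
  also have "\<dots> = b * m ^ u * (fact u)\<^sup>2" using np by simp
  also have "\<dots> \<le> Q * (Z * (E * (?n ^ 2) ^ u))" using main by (simp add: mult_ac)
  finally show ?thesis by (rule mult_right_le_imp_le) (use Z G0 in simp)
qed

text \<open>The matchings of \<open>many_matchings\<close> contain an absorbing set and are completed by switches.  At most
  \<open>3 * \<nu> * n\<close> switches are made, which use up at most half of the absorbers.\<close>

theorem (in torus) queens_count_ge:
  fixes \<beta> \<nu> \<delta> :: real and s L J m :: nat
  assumes nib: "nibble (board n) (line n) n s L \<nu> \<delta>"
    and b: "0 < \<beta>" "\<beta> \<le> 1" and J: "n \<le> 80 * (J * s)" "40 * (J * s) \<le> n" "J \<le> L" and n: "1024 \<le> n"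
    and nu: "27 * \<nu> \<le> absorb_const / 2"
    and tail: "16 * real n ^ 2 * exp (- ((absorb_const * n)\<^sup>2 / (4 * real (J * s) * 25\<^sup>2))) \<le> 1"
    and m: "real m \<le> absorb_const * n / 2"
  defines "h \<equiv> 1 - L * (16 * (6 * s\<^sup>2 / (\<nu>\<^sup>2 * n\<^sup>2) + 8 * \<delta> * s / (\<nu> ^ 4 * n)))"
  shows "\<exists>u\<le>n. real u \<le> 3 * \<nu> * n \<and>
    queens_count n \<ge> (n * exp (- 3)) ^ n *
     (h ^ n * (m / n) ^ u * \<beta> powr (16 * L * (real s)\<^sup>2 / n) / (2 * (n + 1) * (1 + \<beta>) ^ (L * s) * real (s + 1) ^ L))"
proof -
  interpret nib: nibble "board n" "line n" n s L \<nu> \<delta> by (rule nib)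
  let ?W = "words (board n) (L * s)" and ?t = "J * s"
  have h: "h = 1 - L * nib.\<xi>" by (simp add: h_def nib.\<xi>_def)
  have hpos: "0 < h" "h \<le> 1" using nib.L_xi nib.xi_nonneg h by auto
  have tT: "?t \<le> L * s" using J(3) by simp
  have J4: "4 * J * s \<le> n" using J(2) by simp
  have good: "card {w \<in> ?W. \<not> absorbing (isolated (take ?t w))} \<le> card ?W / 8"
  proof -
    have "real (card {w \<in> ?W. \<not> absorbing (isolated (take ?t w))})
        = card {w \<in> words (board n) ?t. \<not> absorbing (isolated w)} * real (card (words (board n) (L * s - ?t)))"
      using card_words_prefix[OF tT, of "\<lambda>w. \<not> absorbing (isolated w)"] by simp
    also have "\<dots> \<le> (2 * real n ^ 2 * card (words (board n) ?t) * exp (- ((absorb_const * n)\<^sup>2 / (4 * real ?t * 25\<^sup>2))))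
        * real (card (words (board n) (L * s - ?t)))"
      using card_not_absorbing[OF n J(1,2)] by (intro mult_right_mono) auto
    also have "\<dots> = (16 * real n ^ 2 * exp (- ((absorb_const * n)\<^sup>2 / (4 * real ?t * 25\<^sup>2))))
        * (real (card (words (board n) ?t)) * real (card (words (board n) (L * s - ?t)))) / 8"
      by simp
    also have "\<dots> \<le> 1 * (real (card (words (board n) ?t)) * real (card (words (board n) (L * s - ?t)))) / 8"
      using tail by (intro divide_right_mono mult_right_mono) auto
    also have "real (card (words (board n) ?t)) * real (card (words (board n) (L * s - ?t))) = card ?W"
    proof -
      have "2 * ?t + 2 * (L * s - ?t) = 2 * (L * s)" using tT by linarith
      then show ?thesis by (simp only: card_words_A of_nat_power power_add[symmetric])
    qed
    finally show ?thesis by simp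
  qed
  obtain u S where u: "u \<le> n" "real u \<le> 3 * \<nu> * n"
    and S: "\<And>Q. Q \<in> S \<Longrightarrow> matching Q \<and> card Q = n - u \<and> (\<exists>P\<subseteq>Q. absorbing P)"
    and cS: "\<beta> powr (16 * L * (real s)\<^sup>2 / n) \<le> card S * (2 * (n + 1) * (1 + \<beta>) ^ (L * s) * real (s + 1) ^ L
        * fact (n - u) * ((real n)\<^sup>2 / h) ^ (n - u) * (fact u / fact n) ^ 4)"
    using nib.many_matchings[OF b J4 good] unfolding h by blast
  have "S \<subseteq> switchable n u (m + 9 * u)"
  proof
    fix Q assume Q: "Q \<in> S"
    obtain P where P: "P \<subseteq> Q" "absorbing P" and mQ: "matching Q" "card Q = n - u" using S[OF Q] by blast
    have "m + 9 * u \<le> card (switches Q r c)" if "r \<in> {1..int n}" "c \<in> {1..int n}" for r c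
    proof -
      have "9 * real u \<le> 27 * \<nu> * n" using u(2) by simp
      also have "\<dots> \<le> absorb_const / 2 * n" using nu by (rule mult_right_mono) simp
      finally have "real (m + 9 * u) \<le> absorb_const * n" using m by simp
      also have "\<dots> \<le> card (absorbers P r c)" using P(2) that by (simp add: absorbing_def)
      also have "\<dots> \<le> card (switches Q r c)"
        using card_mono[OF _ absorbers_subset_switches[OF mQ(1) P(1), of r c]] matching_finite[OF mQ(1)]
        by (simp add: switches_def)
      finally show ?thesis by (simp only: of_nat_le_iff)
    qed
    then show "Q \<in> switchable n u (m + 9 * u)"
      using matching_nonattacking[OF mQ(1)] mQ(2) by (simp add: switchable_def)
  qed
  then have "card S \<le> card (switchable n u (m + 9 * u))" by (intro card_mono finite_switchable)
  then have "card S * ((fact u)\<^sup>2 * m ^ u) \<le> card (switchable n u (m + 9 * u)) * ((fact u)\<^sup>2 * m ^ u)"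
    by (rule mult_right_mono) simp
  also have "\<dots> \<le> queens_count n * (n\<^sup>2) ^ u" by (rule card_switchable_le_queens_count[OF u(1)])
  finally have "real (card S * ((fact u)\<^sup>2 * m ^ u)) \<le> real (queens_count n * (n\<^sup>2) ^ u)"
    by (simp only: of_nat_le_iff)
  then have QS: "real (card S) * ((fact u)\<^sup>2 * real m ^ u) \<le> real (queens_count n) * (real n ^ 2) ^ u" by simp
  have "real (queens_count n) \<ge> (n * exp (- 3)) ^ n *
     (h ^ n * (m / n) ^ u * \<beta> powr (16 * L * (real s)\<^sup>2 / n) / (2 * (n + 1) * (1 + \<beta>) ^ (L * s) * real (s + 1) ^ L))"
    by (rule counting_arithmetic[OF u(1) n_pos hpos _ _ cS QS]) (use b in auto)
  then show ?thesis using u by blast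
qed

section \<open>Choice of the parameters\<close>

text \<open>The number of rounds does not depend on \<open>n\<close>, so all union bounds and numbers of cases are polynomial
  in \<open>n\<close>, and exponentially small probabilities outweigh them.\<close>

lemma eventually_power_le_exp:
  fixes c C :: real
  assumes c: "c > 0" and C: "C > 0"
  shows "eventually (\<lambda>n. C * (real n + 1) ^ k \<le> exp (c * real n)) sequentially"
proof -
  have "filterlim (\<lambda>n. c * real n) at_top sequentially"
    by (rule filterlim_tendsto_pos_mult_at_top[OF tendsto_const c filterlim_real_sequentially])
  then have "filterlim (\<lambda>n. c * (real n + 1)) at_top sequentially"
    by (rule filterlim_at_top_mono) (use c in simp)
  then have "((\<lambda>n. (c * (real n + 1)) ^ k / exp (c * (real n + 1))) \<longlongrightarrow> 0) sequentially"
    by (rule filterlim_compose[OF tendsto_power_div_exp_0])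
  moreover have "c ^ k / (C * exp c) > 0" using c C by simp
  ultimately have "eventually (\<lambda>n. (c * (real n + 1)) ^ k / exp (c * (real n + 1)) < c ^ k / (C * exp c)) sequentially"
    by (rule order_tendstoD)
  then show ?thesis
  proof eventually_elim
    case (elim n)
    define x E where "x = (real n + 1) ^ k" and "E = exp (c * real n)"
    have "exp (c * (real n + 1)) = E * exp c" by (simp add: E_def distrib_left exp_add)
    then have "c ^ k * x / (E * exp c) < c ^ k / (C * exp c)"
      using elim by (simp add: x_def power_mult_distrib)
    then have "c ^ k * x / (E * exp c) * (E * exp c * C) < c ^ k / (C * exp c) * (E * exp c * C)"
      using C by (intro mult_strict_right_mono) (auto simp: E_def)
    then have "c ^ k * (C * x) < c ^ k * E" using C by (simp add: E_def mult_ac)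
    then have "C * x < E" using c by simp
    then show ?case by (simp add: x_def E_def)
  qed
qed

lemma exp_le_one_minus:
  fixes x :: real
  assumes "0 \<le> x" "x \<le> 1 / 2"
  shows "exp (- 2 * x) \<le> 1 - x"
proof -
  have "- x - 2 * x\<^sup>2 \<le> ln (1 - x)" using assms by (rule ln_one_minus_pos_lower_bound)
  moreover have "2 * x\<^sup>2 \<le> x" using assms mult_right_mono[of "2 * x" 1 x] by (simp add: power2_eq_square)
  ultimately have "exp (- 2 * x) \<le> exp (ln (1 - x))" by simp
  then show ?thesis using assms by simp
qed

lemma (in torus) nibbleI:
  fixes s L :: nat and \<nu> \<delta> :: real
  assumes "s > 0" "0 < \<nu>" "\<nu> \<le> 1 / 4" "0 < \<delta>" "\<delta> \<le> \<nu>"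
    and "32 * real s \<le> \<nu> ^ 4 * real n" "8 * real n \<le> real L * real s * \<nu> ^ 4"
    and "real L * (16 * (6 * (real s)\<^sup>2 / (\<nu>\<^sup>2 * (real n)\<^sup>2) + 8 * \<delta> * real s / (\<nu> ^ 4 * real n))) \<le> 1 / 2"
    and "16 * (real L + 1) * (4 * real n + 1) * exp (- ((\<delta> * real n)\<^sup>2 / (4 * (real L * real s) * (12 * 5 ^ L)\<^sup>2))) \<le> 1"
  shows "nibble (board n) (line n) n s L \<nu> \<delta>"
  by unfold_locales
    (use assms in \<open>simp_all only: of_nat_mult of_nat_add of_nat_power of_nat_numeral of_nat_1\<close>)

theorem queens_count_asymptotic_lower_bound:
  fixes \<epsilon> :: real
  assumes e: "\<epsilon> > 0"
  shows "eventually (\<lambda>n. (n * exp (- 3)) ^ n * exp (- \<epsilon> * n) \<le> queens_count n) sequentially"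
proof -
  \<comment> \<open>Each of the five losses costs at most the factor
    \<open>exp (\<epsilon> * n / 6)\<close>: \<open>\<nu>\<close> controls the completion, \<open>\<beta>\<close> and \<open>\<theta>\<close> the collisions,
    \<open>\<theta>\<close> and \<open>\<delta>\<close> the errors \<open>e0\<close> of all rounds; \<open>\<theta> * n\<close> is the size of a round, and \<open>\<Lambda> * n\<close> bounds
    the number of all samples.\<close>
  define a where "a = absorb_const"
  have a: "0 < a" "a < 1" using absorb_const_pos by (auto simp: a_def absorb_const_def)
  define la where "la = ln (4 / a)"
  have la: "la > 0" using a by (simp add: la_def)
  define \<nu> where "\<nu> = Min {1 / 4, a / 54, \<epsilon> / (18 * la)}"
  have nu: "0 < \<nu>" "\<nu> \<le> 1 / 4" "\<nu> \<le> a / 54" "\<nu> \<le> \<epsilon> / (18 * la)"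
    using a la e by (auto simp: \<nu>_def)
  have nu3: "3 * \<nu> * la \<le> \<epsilon> / 6" using nu(4) la by (simp add: field_simps)
  define \<Lambda> where "\<Lambda> = 16 / \<nu> ^ 4 + 1"
  have Lam: "\<Lambda> > 0" using nu by (simp add: \<Lambda>_def add_pos_pos)
  define \<beta> where "\<beta> = min 1 (\<epsilon> / (6 * \<Lambda>))"
  have beta: "0 < \<beta>" "\<beta> \<le> 1" "\<beta> \<le> \<epsilon> / (6 * \<Lambda>)" using e Lam by (auto simp: \<beta>_def)
  have beta_Lam: "\<beta> * \<Lambda> \<le> \<epsilon> / 6" using beta(3) Lam by (simp add: field_simps)
  define lb where "lb = - ln \<beta>"
  have lb: "lb \<ge> 0" using beta by (simp add: lb_def)
  define e0 where "e0 = min (1 / 2) (\<epsilon> / 12)"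
  have e0: "0 < e0" "e0 \<le> 1 / 2" "e0 \<le> \<epsilon> / 12" using e by (auto simp: e0_def)
  define \<theta> where "\<theta> = Min {1 / 80, \<nu> ^ 4 / 32, \<nu>\<^sup>2 * e0 / (192 * \<Lambda>), \<epsilon> / (96 * \<Lambda> * (lb + 1))}"
  have th: "0 < \<theta>" "\<theta> \<le> 1 / 80" "\<theta> \<le> \<nu> ^ 4 / 32" "\<theta> \<le> \<nu>\<^sup>2 * e0 / (192 * \<Lambda>)" "\<theta> \<le> \<epsilon> / (96 * \<Lambda> * (lb + 1))"
    using nu e0 e Lam lb by (auto simp: \<theta>_def)
  have th_lb: "16 * \<Lambda> * \<theta> * lb \<le> \<epsilon> / 6"
  proof -
    have "16 * \<Lambda> * \<theta> * lb \<le> 16 * \<Lambda> * \<theta> * (lb + 1)" using Lam th(1) by (intro mult_left_mono) auto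
    also have "\<dots> = \<theta> * (96 * \<Lambda> * (lb + 1)) / 6" by simp
    also have "\<dots> \<le> \<epsilon> / 6"
    proof (rule divide_right_mono)
      have "0 < 96 * \<Lambda> * (lb + 1)" using Lam lb by simp
      then show "\<theta> * (96 * \<Lambda> * (lb + 1)) \<le> \<epsilon>" using th(5) by (rule iffD1[OF pos_le_divide_eq])
    qed simp
    finally show ?thesis .
  qed
  define \<delta> where "\<delta> = min \<nu> (\<nu> ^ 4 * e0 / (256 * \<Lambda>))"
  have de: "0 < \<delta>" "\<delta> \<le> \<nu>" "\<delta> \<le> \<nu> ^ 4 * e0 / (256 * \<Lambda>)" using nu e0 Lam by (auto simp: \<delta>_def)
  have err: "16 * \<Lambda> * (6 * \<theta> / \<nu>\<^sup>2 + 8 * \<delta> / \<nu> ^ 4) \<le> e0"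
  proof -
    have "16 * \<Lambda> * (6 * \<theta> / \<nu>\<^sup>2) \<le> e0 / 2" using th(4) Lam nu(1) by (simp add: field_simps)
    moreover have "16 * \<Lambda> * (8 * \<delta> / \<nu> ^ 4) \<le> e0 / 2" using de(3) Lam nu(1) by (simp add: field_simps)
    ultimately show ?thesis by (simp add: distrib_left)
  qed
  define L where "L = nat \<lceil>16 / (\<theta> * \<nu> ^ 4)\<rceil>"
  have "16 / (\<theta> * \<nu> ^ 4) > 0" using th(1) nu(1) by simp
  then have L: "16 / (\<theta> * \<nu> ^ 4) \<le> L" "L \<le> 16 / (\<theta> * \<nu> ^ 4) + 1"
    unfolding L_def by linarith+
  define c1 where "c1 = \<delta>\<^sup>2 / (4 * \<Lambda> * (12 * 5 ^ L)\<^sup>2)"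
  have c1: "c1 > 0" using de(1) Lam by (simp add: c1_def)
  have "eventually (\<lambda>n. real n \<ge> 2 / \<theta>) sequentially" "eventually (\<lambda>n. real n \<ge> 4 / a) sequentially"
    "eventually (\<lambda>n. 1024 \<le> n) sequentially"
    using filterlim_real_sequentially by (auto simp: filterlim_at_top eventually_ge_at_top)
  moreover have "eventually (\<lambda>n. (64 * (real L + 1)) * (real n + 1) ^ 1 \<le> exp (c1 * real n)) sequentially"
    by (rule eventually_power_le_exp[OF c1]) simp
  moreover have "eventually (\<lambda>n. 16 * (real n + 1) ^ 2 \<le> exp (a\<^sup>2 / 2500 * real n)) sequentially"
    by (rule eventually_power_le_exp) (use a in simp_all)
  moreover have "eventually (\<lambda>n. 2 * (real n + 1) ^ Suc L \<le> exp (\<epsilon> / 6 * real n)) sequentially"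
    by (rule eventually_power_le_exp) (use e in simp_all)
  ultimately show ?thesis
  proof eventually_elim
    case (elim n)
    have n0: "real n > 0" using elim(3) by simp
    interpret torus n by unfold_locales (use elim(3) in simp)
    define s where "s = nat \<lfloor>\<theta> * n\<rfloor>"
    have "\<theta> * n \<ge> 2" using elim(1) th(1) by (simp add: field_simps)
    then have s: "real s \<le> \<theta> * n" "\<theta> * n / 2 \<le> real s" "s > 0" unfolding s_def by linarith+
    have Ls: "real L * s \<le> \<Lambda> * n"
    proof -
      have "real L * s \<le> (16 / (\<theta> * \<nu> ^ 4) + 1) * (\<theta> * n)" using L(2) s(1) th(1) nu(1) by (intro mult_mono) auto
      also have "\<dots> = (16 / \<nu> ^ 4 + \<theta>) * n" using th(1) by (simp add: field_simps)
      also have "\<dots> \<le> \<Lambda> * n" unfolding \<Lambda>_def using th(2) by (intro mult_right_mono) auto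
      finally show ?thesis .
    qed
    have L8: "8 * real n \<le> real L * real s * \<nu> ^ 4"
    proof -
      have "16 / (\<theta> * \<nu> ^ 4) * (\<theta> * n / 2) * \<nu> ^ 4 \<le> real L * real s * \<nu> ^ 4"
        using L(1) s(2) th(1) nu(1) by (intro mult_right_mono mult_mono) auto
      moreover have "16 / (\<theta> * \<nu> ^ 4) * (\<theta> * n / 2) * \<nu> ^ 4 = 8 * real n" using th(1) nu(1) by simp
      ultimately show ?thesis by linarith
    qed
    have s32: "32 * real s \<le> \<nu> ^ 4 * n"
    proof -
      have "32 * real s \<le> 32 * (\<theta> * n)" using s(1) by simp
      also have "\<dots> \<le> 32 * (\<nu> ^ 4 / 32 * n)" using th(3) by (intro mult_left_mono mult_right_mono) auto
      finally show ?thesis by simp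
    qed
    have error: "L * (16 * (6 * (real s)\<^sup>2 / (\<nu>\<^sup>2 * (real n)\<^sup>2) + 8 * \<delta> * s / (\<nu> ^ 4 * n))) \<le> e0"
    proof -
      have "L * (16 * (6 * (real s)\<^sup>2 / (\<nu>\<^sup>2 * (real n)\<^sup>2) + 8 * \<delta> * s / (\<nu> ^ 4 * n)))
          = (real L * s) * (16 * (6 * real s / (\<nu>\<^sup>2 * (real n)\<^sup>2) + 8 * \<delta> / (\<nu> ^ 4 * n)))"
        using n0 nu(1) by (simp add: field_simps power2_eq_square)
      also have "\<dots> \<le> (\<Lambda> * n) * (16 * (6 * (\<theta> * n) / (\<nu>\<^sup>2 * (real n)\<^sup>2) + 8 * \<delta> / (\<nu> ^ 4 * n)))"
      proof (rule mult_mono[OF Ls])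
        have "6 * real s / (\<nu>\<^sup>2 * (real n)\<^sup>2) \<le> 6 * (\<theta> * n) / (\<nu>\<^sup>2 * (real n)\<^sup>2)"
          by (rule divide_right_mono) (use s(1) in auto)
        then show "16 * (6 * real s / (\<nu>\<^sup>2 * (real n)\<^sup>2) + 8 * \<delta> / (\<nu> ^ 4 * n))
            \<le> 16 * (6 * (\<theta> * n) / (\<nu>\<^sup>2 * (real n)\<^sup>2) + 8 * \<delta> / (\<nu> ^ 4 * n))" by simp
      qed (use Lam de(1) nu(1) in auto)
      also have "\<dots> = 16 * \<Lambda> * (6 * \<theta> / \<nu>\<^sup>2 + 8 * \<delta> / \<nu> ^ 4)"
        using n0 nu(1) by (simp add: field_simps power2_eq_square)
      finally show ?thesis using err by linarith
    qed
    have Lspos: "0 < real L * s" using L8 n0 nu(1) by (smt (verit) mult_nonneg_nonneg of_nat_0_le_iff mult_eq_0_iff)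
    have tail: "16 * (real L + 1) * (4 * n + 1) * exp (- ((\<delta> * n)\<^sup>2 / (4 * (real L * s) * (12 * 5 ^ L)\<^sup>2))) \<le> 1"
    proof -
      have "c1 * n = (\<delta> * n)\<^sup>2 / (4 * (\<Lambda> * n) * (12 * 5 ^ L)\<^sup>2)"
        using n0 by (simp add: c1_def power2_eq_square)
      also have "\<dots> \<le> (\<delta> * n)\<^sup>2 / (4 * (real L * s) * (12 * 5 ^ L)\<^sup>2)"
      proof (rule divide_left_mono)
        show "4 * (real L * s) * (12 * 5 ^ L)\<^sup>2 \<le> 4 * (\<Lambda> * n) * (12 * 5 ^ L)\<^sup>2"
          by (intro mult_right_mono mult_left_mono Ls) auto
        have "0 < 4 * (\<Lambda> * n) * (12 * 5 ^ L)\<^sup>2" using Lam n0 by simp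
        moreover have "0 < real L" using Lspos by (simp add: zero_less_mult_iff)
        then have "0 < 4 * (real L * s) * (12 * 5 ^ L)\<^sup>2" using s(3) by simp
        ultimately show "0 < 4 * (\<Lambda> * n) * (12 * 5 ^ L)\<^sup>2 * (4 * (real L * s) * (12 * 5 ^ L)\<^sup>2)"
          by (rule mult_pos_pos)
      qed simp
      finally have "exp (- ((\<delta> * n)\<^sup>2 / (4 * (real L * s) * (12 * 5 ^ L)\<^sup>2))) \<le> exp (- (c1 * n))" by simp
      moreover have "16 * (real L + 1) * (4 * n + 1) \<le> exp (c1 * n)"
      proof -
        have "16 * (real L + 1) * (4 * n + 1) \<le> 16 * (real L + 1) * (4 * (real n + 1))" by (intro mult_left_mono) auto
        also have "\<dots> = 64 * (real L + 1) * (real n + 1) ^ 1" by (simp add: algebra_simps)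
        finally show ?thesis using elim(4) by linarith
      qed
      ultimately have "16 * (real L + 1) * (4 * n + 1) * exp (- ((\<delta> * n)\<^sup>2 / (4 * (real L * s) * (12 * 5 ^ L)\<^sup>2)))
          \<le> exp (c1 * n) * exp (- (c1 * n))" by (intro mult_mono) auto
      then show ?thesis by (simp flip: exp_add)
    qed
    have nib: "nibble (board n) (line n) n s L \<nu> \<delta>"
    proof (rule nibbleI[OF s(3) nu(1,2) de(1,2)])
      show "real L * (16 * (6 * (real s)\<^sup>2 / (\<nu>\<^sup>2 * (real n)\<^sup>2) + 8 * \<delta> * real s / (\<nu> ^ 4 * real n))) \<le> 1 / 2"
        using error e0(2) by linarith
      show "16 * (real L + 1) * (4 * real n + 1) * exp (- ((\<delta> * real n)\<^sup>2 / (4 * (real L * real s) * (12 * 5 ^ L)\<^sup>2))) \<le> 1"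
        using tail by (simp only: of_nat_add of_nat_mult of_nat_1 of_nat_numeral)
    qed (rule s32 L8)+
    define J where "J = n div (40 * s)"
    have J1: "40 * (J * s) \<le> n" unfolding J_def by (metis div_times_less_eq_dividend mult.commute mult.left_commute)
    have J2: "n \<le> 80 * (J * s)"
    proof -
      have "n = 40 * s * J + n mod (40 * s)" by (simp add: J_def)
      moreover have "n mod (40 * s) < 40 * s" using s(3) by simp
      ultimately have lt: "n < 40 * (J * s) + 40 * s" by (simp add: mult_ac)
      have "80 * real s \<le> 80 * (\<theta> * n)" using s(1) by simp
      also have "\<dots> \<le> 80 * (1 / 80 * n)" using th(2) by (intro mult_left_mono mult_right_mono) auto
      finally have "80 * s \<le> n" by simp
      then show ?thesis using lt by linarith
    qed
    have J3: "J \<le> L"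
    proof -
      have "real (J * s) \<le> real n" using J1 by (simp only: of_nat_le_iff)
      also have "\<dots> \<le> 8 * real n" by simp
      also note L8
      also have "real L * real s * \<nu> ^ 4 \<le> real L * s * 1"
      proof (rule mult_left_mono)
        show "\<nu> ^ 4 \<le> 1" using nu(1,2) by (intro power_le_one) auto
      qed simp
      finally have "real J * s \<le> real L * s" by simp
      then show ?thesis using s(3) by simp
    qed
    define m where "m = nat \<lfloor>a * n / 2\<rfloor>"
    have "a * n \<ge> 4" using elim(2) a(1) by (simp add: field_simps)
    then have m: "real m \<le> a * n / 2" "a * n / 4 \<le> real m" unfolding m_def by linarith+
    have atail: "16 * real n ^ 2 * exp (- ((absorb_const * n)\<^sup>2 / (4 * real (J * s) * 25\<^sup>2))) \<le> 1"
    proof -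
      have Js: "0 < real (J * s)" "real (J * s) \<le> real n"
        using J1 J2 elim(3) by (simp_all only: of_nat_le_iff of_nat_0_less_iff)
      have "a\<^sup>2 / 2500 * n = (a * n)\<^sup>2 / (4 * real n * 25\<^sup>2)" using n0 by (simp add: power2_eq_square)
      also have "\<dots> \<le> (a * n)\<^sup>2 / (4 * real (J * s) * 25\<^sup>2)"
        using Js by (intro divide_left_mono mult_right_mono mult_left_mono mult_pos_pos) auto
      finally have "exp (- ((a * n)\<^sup>2 / (4 * real (J * s) * 25\<^sup>2))) \<le> exp (- (a\<^sup>2 / 2500 * n))" by simp
      moreover have "16 * real n ^ 2 \<le> exp (a\<^sup>2 / 2500 * n)"
        using elim(5) power_mono[of "real n" "real n + 1" 2] by linarith
      ultimately have "16 * real n ^ 2 * exp (- ((a * n)\<^sup>2 / (4 * real (J * s) * 25\<^sup>2)))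
          \<le> exp (a\<^sup>2 / 2500 * n) * exp (- (a\<^sup>2 / 2500 * n))" by (intro mult_mono) auto
      then show ?thesis by (simp add: a_def flip: exp_add)
    qed
    define h where "h = 1 - L * (16 * (6 * s\<^sup>2 / (\<nu>\<^sup>2 * n\<^sup>2) + 8 * \<delta> * s / (\<nu> ^ 4 * n)))"
    have h: "1 - e0 \<le> h" using error by (simp add: h_def)
    have "\<exists>u\<le>n. real u \<le> 3 * \<nu> * n \<and>
      queens_count n \<ge> (n * exp (- 3)) ^ n *
        (h ^ n * (m / n) ^ u * \<beta> powr (16 * L * (real s)\<^sup>2 / n) / (2 * (n + 1) * (1 + \<beta>) ^ (L * s) * real (s + 1) ^ L))"
      unfolding h_def
    proof (rule queens_count_ge[OF nib beta(1,2) J2 J1 J3 elim(3) _ atail])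
      show "27 * \<nu> \<le> absorb_const / 2" using nu(3) by (simp add: a_def)
      show "real m \<le> absorb_const * real n / 2" using m(1) by (simp add: a_def)
    qed
    then obtain u where u: "real u \<le> 3 * \<nu> * n"
      and Q: "queens_count n \<ge> (n * exp (- 3)) ^ n *
        (h ^ n * (m / n) ^ u * \<beta> powr (16 * L * (real s)\<^sup>2 / n) / (2 * (n + 1) * (1 + \<beta>) ^ (L * s) * real (s + 1) ^ L))"
      by blast
    let ?E = "exp (- (\<epsilon> / 6 * n))"
    have h1: "?E \<le> h ^ n"
    proof -
      have "exp (- 2 * e0) \<le> 1 - e0" using e0 by (intro exp_le_one_minus) auto
      also note h
      finally have "exp (- 2 * e0) ^ n \<le> h ^ n" by (intro power_mono) auto
      moreover have "- (\<epsilon> / 6 * n) \<le> n * (- 2 * e0)" using e0(3) n0 mult_left_mono[of "2 * e0" "\<epsilon> / 6" "real n"] by (simp add: mult_ac)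
      then have "?E \<le> exp (n * (- 2 * e0))" unfolding exp_le_cancel_iff .
      then have "?E \<le> exp (- 2 * e0) ^ n" unfolding exp_of_nat_mult .
      ultimately show ?thesis by linarith
    qed
    have h2: "?E \<le> (m / n) ^ u"
    proof -
      have "- (\<epsilon> / 6 * n) \<le> u * (- la)"
      proof -
        have "real u * la \<le> 3 * \<nu> * n * la" using u la by (intro mult_right_mono) auto
        also have "\<dots> = 3 * \<nu> * la * n" by simp
        also have "\<dots> \<le> \<epsilon> / 6 * n" using nu3 by (intro mult_right_mono) auto
        finally show ?thesis by simp
      qed
      then have "?E \<le> exp (u * (- la))" by simp
      also have "\<dots> = exp (- la) ^ u" by (rule exp_of_nat_mult)
      also have "exp (- la) = a / 4" using a by (simp add: la_def exp_minus)
      also have "(a / 4) ^ u \<le> (m / n) ^ u" using m(2) n0 a by (intro power_mono) (auto simp: field_simps)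
      finally show ?thesis .
    qed
    have h3: "?E \<le> \<beta> powr (16 * L * (real s)\<^sup>2 / n)"
    proof -
      have "16 * L * (real s)\<^sup>2 / n = 16 * (real L * s) * (s / n)" by (simp add: power2_eq_square)
      also have "\<dots> \<le> 16 * (\<Lambda> * n) * (\<theta> * n / n)"
      proof (rule mult_mono)
        show "16 * (real L * s) \<le> 16 * (\<Lambda> * n)" using Ls by linarith
        show "s / n \<le> \<theta> * n / n" using s(1) by (rule divide_right_mono) simp
      qed (use Lam in auto)
      also have "\<dots> = 16 * \<Lambda> * \<theta> * n" using n0 by simp
      finally have k: "16 * L * (real s)\<^sup>2 / n \<le> 16 * \<Lambda> * \<theta> * n" .
      have "16 * L * (real s)\<^sup>2 / n * lb \<le> 16 * \<Lambda> * \<theta> * n * lb" using k lb by (rule mult_right_mono)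
      also have "\<dots> = 16 * \<Lambda> * \<theta> * lb * n" by simp
      also have "\<dots> \<le> \<epsilon> / 6 * n" using th_lb by (rule mult_right_mono) simp
      finally have "- (\<epsilon> / 6 * n) \<le> 16 * L * (real s)\<^sup>2 / n * ln \<beta>" by (simp add: lb_def)
      then show ?thesis using beta(1) by (simp add: powr_def)
    qed
    have h4: "(1 + \<beta>) ^ (L * s) \<le> exp (\<epsilon> / 6 * n)"
    proof -
      have "(1 + \<beta>) ^ (L * s) \<le> exp \<beta> ^ (L * s)" using beta(1) by (intro power_mono) auto
      also have "\<dots> = exp (real (L * s) * \<beta>)" by (rule exp_of_nat_mult[symmetric])
      also have "real (L * s) * \<beta> \<le> \<Lambda> * n * \<beta>" using Ls beta(1) by (intro mult_right_mono) auto
      also have "\<Lambda> * n * \<beta> = \<beta> * \<Lambda> * n" by simp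
      also have "\<beta> * \<Lambda> * n \<le> \<epsilon> / 6 * n" using beta_Lam by (rule mult_right_mono) simp
      finally show ?thesis by simp
    qed
    have h5: "2 * (n + 1) * real (s + 1) ^ L \<le> exp (\<epsilon> / 6 * n)"
    proof -
      have "\<theta> * n \<le> 1 * real n" using th(2) by (intro mult_right_mono) auto
      then have "real (s + 1) \<le> real n + 1" using s(1) by simp
      then have "2 * (n + 1) * real (s + 1) ^ L \<le> 2 * (n + 1) * (real n + 1) ^ L" by (intro mult_left_mono power_mono) auto
      also have "\<dots> = 2 * (real n + 1) ^ Suc L" by simp
      finally show ?thesis using elim(6) by linarith
    qed
    have "exp (- \<epsilon> * n) \<le> exp (- (5 * (\<epsilon> / 6 * n)))" using e n0 by simp
    also have "\<dots> = ?E * ?E * ?E / (exp (\<epsilon> / 6 * n) * exp (\<epsilon> / 6 * n))"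
      by (simp add: exp_minus field_simps flip: exp_add)
    also have "\<dots> \<le> h ^ n * (m / n) ^ u * \<beta> powr (16 * L * (real s)\<^sup>2 / n) / ((2 * (n + 1) * real (s + 1) ^ L) * (1 + \<beta>) ^ (L * s))"
    proof (rule frac_le)
      show "?E * ?E * ?E \<le> h ^ n * (m / n) ^ u * \<beta> powr (16 * L * (real s)\<^sup>2 / n)"
        using h1 h2 h3 h e0 by (intro mult_mono) auto
      show "2 * (n + 1) * real (s + 1) ^ L * (1 + \<beta>) ^ (L * s) \<le> exp (\<epsilon> / 6 * n) * exp (\<epsilon> / 6 * n)"
        using h4 h5 beta(1) by (intro mult_mono) auto
      show "0 < 2 * (n + 1) * real (s + 1) ^ L * (1 + \<beta>) ^ (L * s)" using beta(1) by (auto intro!: mult_pos_pos)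
      show "0 \<le> h ^ n * (m / n) ^ u * \<beta> powr (16 * L * (real s)\<^sup>2 / n)" using h e0 by auto
    qed
    finally have "(n * exp (- 3)) ^ n * exp (- \<epsilon> * n) \<le> (n * exp (- 3)) ^ n *
        (h ^ n * (m / n) ^ u * \<beta> powr (16 * L * (real s)\<^sup>2 / n) / ((2 * (n + 1) * real (s + 1) ^ L) * (1 + \<beta>) ^ (L * s)))"
      by (intro mult_left_mono) auto
    also have "(2 * (n + 1) * real (s + 1) ^ L) * (1 + \<beta>) ^ (L * s) = 2 * (n + 1) * (1 + \<beta>) ^ (L * s) * real (s + 1) ^ L"
      by simp
    finally show ?case using Q by linarith
  qed
qed

lemma queens_count_0: "queens_count 0 = 1"
proof -
  have "{Q. queens_config 0 Q} = {{}}"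
    by (auto simp: queens_config_def partial_queens_config_def board_def)
  then show ?thesis by (simp add: queens_count_def)
qed

theorem theorem1p1:
  shows "\<exists>\<delta> :: nat \<Rightarrow> real. \<delta> \<longlonglongrightarrow> 0 \<and>
    (\<forall>n :: nat. real (queens_count n) \<ge> ((1 - \<delta> n) * real n * exp (- 3)) ^ n)"
proof -
  \<comment> \<open>The maximum makes \<open>\<delta>\<close> tend to zero although the lower bound is not sharp.\<close>
  define f where "f n = root n (queens_count n) / (n * exp (- 3))" for n
  define \<delta> where "\<delta> n = max 0 (1 - f n)" for n
  have f0: "f n \<ge> 0" for n by (simp add: f_def real_root_ge_zero)
  have "\<delta> \<longlonglongrightarrow> 0"
  proof (rule LIMSEQ_I)
    fix e :: real assume e: "e > 0"
    have "e / 2 > 0" using e by simp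
    from queens_count_asymptotic_lower_bound[OF this] eventually_gt_at_top[of "0 :: nat"]
    have "eventually (\<lambda>n. norm (\<delta> n - 0) < e) sequentially"
    proof eventually_elim
      case (elim n)
      then have n: "n > 0" and Q: "(n * exp (- 3)) ^ n * exp (- (e / 2) * n) \<le> queens_count n" by auto
      have "(n * exp (- 3) * exp (- (e / 2))) ^ n = (n * exp (- 3)) ^ n * exp (- (e / 2) * n)"
        by (simp add: power_mult_distrib mult.commute flip: exp_of_nat_mult)
      then have "(n * exp (- 3) * exp (- (e / 2))) ^ n \<le> queens_count n" using Q by simp
      then have "root n ((n * exp (- 3) * exp (- (e / 2))) ^ n) \<le> root n (queens_count n)"
        using n by (simp add: real_root_le_iff)
      then have "n * exp (- 3) * exp (- (e / 2)) \<le> root n (queens_count n)"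
        using n by (simp add: real_root_power_cancel)
      then have "exp (- (e / 2)) \<le> f n" using n by (simp add: f_def field_simps)
      moreover have "1 + - (e / 2) \<le> exp (- (e / 2))" by (rule exp_ge_add_one_self)
      ultimately show ?case using e by (simp add: \<delta>_def)
    qed
    then show "\<exists>no. \<forall>n\<ge>no. norm (\<delta> n - 0) < e" by (simp add: eventually_sequentially)
  qed
  moreover have "((1 - \<delta> n) * real n * exp (- 3)) ^ n \<le> real (queens_count n)" for n
  proof (cases "n = 0")
    case False
    have "0 \<le> 1 - \<delta> n" "1 - \<delta> n \<le> f n" using f0[of n] by (auto simp: \<delta>_def)
    then have "(1 - \<delta> n) * real n * exp (- 3) \<le> f n * real n * exp (- 3)" "0 \<le> (1 - \<delta> n) * real n * exp (- 3)"
      by (auto intro!: mult_right_mono)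
    then have "((1 - \<delta> n) * real n * exp (- 3)) ^ n \<le> (f n * real n * exp (- 3)) ^ n" by (intro power_mono) auto
    also have "f n * real n * exp (- 3) = root n (queens_count n)" using False by (simp add: f_def)
    also have "root n (queens_count n) ^ n = queens_count n" using False by (simp add: real_root_pow_pos2)
    finally show ?thesis .
  qed (simp add: queens_count_0)
  ultimately show ?thesis by blast
qed

end
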